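(* Let $p$ be an odd prime and let $n,d$ be positive integers. Consider the commutative, $3$-nilpotent $\mathbb{Z}_p$-algebras $(M,+,\cdot)$ such that $M$ is a free $\mathbb{Z}_p$-module of rank $n$, $\mathrm{Ann}(M)$ has rank $d$, $M\cdot M$ is a nonzero cyclic $\mathbb{Z}_p$-module, and the defining matrix $\Theta$ of $M$ is unimodular. If $n-d$ is even, there are exactly two isomorphism classes of such algebras; if $n-d$ is odd, there is exactly one isomorphism class. Moreover, if $n-d$ is even, the isomorphism class of $M$ is determined by the discriminant $d(\Theta)$.
   Context: $\mathbb{Z}_p$ is the ring of $p$-adic integers and $\mathbb{Q}_p$ its field of fractions. A matrix is unimodular if its entries are in $\mathbb{Z}_p$ and its determinant is a unit of $\mathbb{Z}_p$. The algebra is $3$-nilpotent if $M\cdot M\cdot M=0$, and $\mathrm{Ann}(M)=\{a\in M : a\cdot x=0\ \forall x\in M\}$. Isomorphism means isomorphism of $\mathbb{Z}_p$-algebras. Defining matrix. Since $M\cdot M\subseteq\mathrm{Ann}(M)$, one can write $\mathrm{Ann}(M)=H\oplus K$ with $K$ a cyclic $\mathbb{Z}_p$-module containing $M\cdot M$; then $M/H$ is a commutative $3$-nilpotent algebra, free of rank $n-d+1$ over $\mathbb{Z}_p$, with cyclic annihilator $\mathrm{Ann}(M)/H$. Put $m=n-d$ and choose a basis $e_1,\dots,e_{m+1}$ of $M/H$ with $\mathrm{Ann}(M/H)=\mathbb{Z}_p e_{m+1}$. The defining matrix $\Theta=(\Theta_{i,j})$ of $M$ is the $m\times m$ matrix over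 $\mathbb{Z}_p$ given by $e_i\cdot e_j=\Theta_{i,j}e_{m+1}$ for $1\le i,j\le m$. The discriminant $d(\Theta)$ is the class of $\det(\Theta)$ in $\mathbb{Q}_p^\times/(\mathbb{Z}_p^\times)^2$.
   Formalization: It is assumed that d < n: for n ≤ d there are no such algebras (n = d forces M·M = 0, and the rank of Ann(M) cannot exceed n), so the stated counts of two or one isomorphism classes would be false. *)

theory Defs
  imports "HOL-Algebra.Algebra" "HOL-Combinatorics.Permutations"
begin

hide_const (open) Multiset.mult Wellorder_Constructions.zero Divisibility.prime

section \<open>The p-adic integers and the field of fractions of a domain\<close>

text \<open>
  A p-adic integer is a coherent sequence of residues: the n-th entry is the canonical
  representative modulo p^n, so the carrier is the inverse limit of the rings Z/p^n.
\<close>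

type_synonym padic = "nat \<Rightarrow> int"

definition padic_int :: "nat \<Rightarrow> padic ring" where
  "padic_int p =
    \<lparr>carrier = {x. (\<forall>n. x n \<in> {0..<int p ^ n}) \<and> (\<forall>m n. m \<le> n \<longrightarrow> x n mod int p ^ m = x m)},
     mult = (\<lambda>x y n. (x n * y n) mod int p ^ n),
     one = (\<lambda>n. 1 mod int p ^ n),
     zero = (\<lambda>n. 0),
     add = (\<lambda>x y n. (x n + y n) mod int p ^ n)\<rparr>"

text \<open>The fraction a/b is the set of all pairs (c, d) with nonzero d and ad = cb.\<close>

definition fraction :: "('a, 'b) ring_scheme \<Rightarrow> 'a \<Rightarrow> 'a \<Rightarrow> ('a \<times> 'a) set" where
  "fraction R a b =
    {(c, d). c \<in> carrier R \<and> d \<in> carrier R - {\<zero>\<^bsub>R\<^esub>} \<and> a \<otimes>\<^bsub>R\<^esub> d = c \<otimes>\<^bsub>R\<^esub> b}"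

definition fraction_field :: "('a, 'b) ring_scheme \<Rightarrow> ('a \<times> 'a) set ring" where
  "fraction_field R =
    \<lparr>carrier = {fraction R a b | a b. a \<in> carrier R \<and> b \<in> carrier R - {\<zero>\<^bsub>R\<^esub>}},
     mult = (\<lambda>S T. \<Union>(a, b)\<in>S. \<Union>(c, d)\<in>T. fraction R (a \<otimes>\<^bsub>R\<^esub> c) (b \<otimes>\<^bsub>R\<^esub> d)),
     one = fraction R \<one>\<^bsub>R\<^esub> \<one>\<^bsub>R\<^esub>,
     zero = fraction R \<zero>\<^bsub>R\<^esub> \<one>\<^bsub>R\<^esub>,
     add = (\<lambda>S T. \<Union>(a, b)\<in>S. \<Union>(c, d)\<in>T.
              fraction R (a \<otimes>\<^bsub>R\<^esub> d \<oplus>\<^bsub>R\<^esub> c \<otimes>\<^bsub>R\<^esub> b) (b \<otimes>\<^bsub>R\<^esub> d))\<rparr>"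

definition padic_field :: "nat \<Rightarrow> (padic \<times> padic) set ring" where
  "padic_field p = fraction_field (padic_int p)"


section \<open>Determinants over a commutative ring\<close>

text \<open>An m by m matrix is a function on pairs of indices, read only at indices in {1..m}.\<close>

definition ring_det :: "('a, 'b) ring_scheme \<Rightarrow> nat \<Rightarrow> (nat \<Rightarrow> nat \<Rightarrow> 'a) \<Rightarrow> 'a" where
  "ring_det R m A =
    (\<Oplus>\<^bsub>R\<^esub>\<pi>\<in>{\<pi>. \<pi> permutes {1..m}}.
       (if evenperm \<pi> then \<one>\<^bsub>R\<^esub> else \<ominus>\<^bsub>R\<^esub> \<one>\<^bsub>R\<^esub>) \<otimes>\<^bsub>R\<^esub> (\<Otimes>\<^bsub>R\<^esub>i\<in>{1..m}. A i (\<pi> i)))"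

definition unimodular :: "('a, 'b) ring_scheme \<Rightarrow> nat \<Rightarrow> (nat \<Rightarrow> nat \<Rightarrow> 'a) \<Rightarrow> bool" where
  "unimodular R m A \<longleftrightarrow>
    (\<forall>i\<in>{1..m}. \<forall>j\<in>{1..m}. A i j \<in> carrier R) \<and> ring_det R m A \<in> Units R"

text \<open>
  The discriminant is an element of the quotient group of the units of the p-adic field by
  the squares of the units of the p-adic integers, i.e. a coset of that subgroup.
\<close>

definition unit_squares :: "nat \<Rightarrow> (padic \<times> padic) set set" where
  "unit_squares p =
    {fraction (padic_int p) (u \<otimes>\<^bsub>padic_int p\<^esub> u) \<one>\<^bsub>padic_int p\<^esub> | u. u \<in> Units (padic_int p)}"

definition discriminant ::
    "nat \<Rightarrow> nat \<Rightarrow> (nat \<Rightarrow> nat \<Rightarrow> padic) \<Rightarrow> (padic \<times> padic) set set" where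
  "discriminant p m \<Theta> =
    unit_squares p #>\<^bsub>units_of (padic_field p)\<^esub>
      fraction (padic_int p) (ring_det (padic_int p) m \<Theta>) \<one>\<^bsub>padic_int p\<^esub>"


section \<open>Commutative 3-nilpotent algebras\<close>

text \<open>
  Algebras are not unital. The record type of modules carries a multiplication, which is used
  as the product of the algebra; the field one is also part of that record but plays no role:
  no definition constrains it, and isomorphisms ignore it.
\<close>

locale nonunital_comm_algebra = module R M for R (structure) and M (structure) +
  assumes prod_closed: "\<lbrakk>x \<in> carrier M; y \<in> carrier M\<rbrakk> \<Longrightarrow> x \<otimes>\<^bsub>M\<^esub> y \<in> carrier M"
    and prod_assoc: "\<lbrakk>x \<in> carrier M; y \<in> carrier M; z \<in> carrier M\<rbrakk> \<Longrightarrow>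
      (x \<otimes>\<^bsub>M\<^esub> y) \<otimes>\<^bsub>M\<^esub> z = x \<otimes>\<^bsub>M\<^esub> (y \<otimes>\<^bsub>M\<^esub> z)"
    and prod_comm: "\<lbrakk>x \<in> carrier M; y \<in> carrier M\<rbrakk> \<Longrightarrow> x \<otimes>\<^bsub>M\<^esub> y = y \<otimes>\<^bsub>M\<^esub> x"
    and prod_add: "\<lbrakk>x \<in> carrier M; y \<in> carrier M; z \<in> carrier M\<rbrakk> \<Longrightarrow>
      (x \<oplus>\<^bsub>M\<^esub> y) \<otimes>\<^bsub>M\<^esub> z = x \<otimes>\<^bsub>M\<^esub> z \<oplus>\<^bsub>M\<^esub> y \<otimes>\<^bsub>M\<^esub> z"
    and prod_smult: "\<lbrakk>r \<in> carrier R; x \<in> carrier M; y \<in> carrier M\<rbrakk> \<Longrightarrow>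
      (r \<odot>\<^bsub>M\<^esub> x) \<otimes>\<^bsub>M\<^esub> y = r \<odot>\<^bsub>M\<^esub> (x \<otimes>\<^bsub>M\<^esub> y)"

definition three_nilpotent :: "('r, 'a, 'c) module_scheme \<Rightarrow> bool" where
  "three_nilpotent M \<longleftrightarrow>
    (\<forall>x\<in>carrier M. \<forall>y\<in>carrier M. \<forall>z\<in>carrier M. (x \<otimes>\<^bsub>M\<^esub> y) \<otimes>\<^bsub>M\<^esub> z = \<zero>\<^bsub>M\<^esub>)"

definition algebra_iso ::
    "('r, 's) ring_scheme \<Rightarrow> ('r, 'a, 'c) module_scheme \<Rightarrow> ('r, 'b, 'd) module_scheme
      \<Rightarrow> ('a \<Rightarrow> 'b) set" where
  "algebra_iso R M N =
    {h. bij_betw h (carrier M) (carrier N) \<and>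
        (\<forall>x\<in>carrier M. \<forall>y\<in>carrier M. h (x \<oplus>\<^bsub>M\<^esub> y) = h x \<oplus>\<^bsub>N\<^esub> h y) \<and>
        (\<forall>x\<in>carrier M. \<forall>y\<in>carrier M. h (x \<otimes>\<^bsub>M\<^esub> y) = h x \<otimes>\<^bsub>N\<^esub> h y) \<and>
        (\<forall>r\<in>carrier R. \<forall>x\<in>carrier M. h (r \<odot>\<^bsub>M\<^esub> x) = r \<odot>\<^bsub>N\<^esub> h x)}"

definition isomorphic ::
    "('r, 's) ring_scheme \<Rightarrow> ('r, 'a, 'c) module_scheme \<Rightarrow> ('r, 'b, 'd) module_scheme
      \<Rightarrow> bool" where
  "isomorphic R M N \<longleftrightarrow> algebra_iso R M N \<noteq> {}"

definition annihilator :: "('r, 'a, 'c) module_scheme \<Rightarrow> 'a set" where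
  "annihilator M = {a \<in> carrier M. \<forall>x\<in>carrier M. a \<otimes>\<^bsub>M\<^esub> x = \<zero>\<^bsub>M\<^esub>}"

text \<open>The submodule generated by all products of two elements.\<close>

definition product_module :: "('r, 's) ring_scheme \<Rightarrow> ('r, 'a, 'c) module_scheme \<Rightarrow> 'a set" where
  "product_module R M =
    \<Inter>{N. submodule N R M \<and> (\<forall>x\<in>carrier M. \<forall>y\<in>carrier M. x \<otimes>\<^bsub>M\<^esub> y \<in> N)}"

definition cyclic_span :: "('r, 's) ring_scheme \<Rightarrow> ('r, 'a, 'c) module_scheme \<Rightarrow> 'a \<Rightarrow> 'a set" where
  "cyclic_span R M k = {r \<odot>\<^bsub>M\<^esub> k | r. r \<in> carrier R}"

definition cyclic :: "('r, 's) ring_scheme \<Rightarrow> ('r, 'a, 'c) module_scheme \<Rightarrow> 'a set \<Rightarrow> bool" where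
  "cyclic R M N \<longleftrightarrow> (\<exists>k\<in>carrier M. N = cyclic_span R M k)"

text \<open>A family of n elements, indexed by {1..n}, is a basis if every element is a unique
  linear combination of its members.\<close>

definition is_basis ::
    "('r, 's) ring_scheme \<Rightarrow> ('r, 'a, 'c) module_scheme \<Rightarrow> nat \<Rightarrow> (nat \<Rightarrow> 'a) \<Rightarrow> bool" where
  "is_basis R M n b \<longleftrightarrow>
    b \<in> {1..n} \<rightarrow> carrier M \<and>
    (\<forall>x\<in>carrier M. \<exists>!c. c \<in> {1..n} \<rightarrow>\<^sub>E carrier R \<and> x = (\<Oplus>\<^bsub>M\<^esub>i\<in>{1..n}. c i \<odot>\<^bsub>M\<^esub> b i))"

definition free_of_rank ::
    "('r, 's) ring_scheme \<Rightarrow> ('r, 'a, 'c) module_scheme \<Rightarrow> nat \<Rightarrow> bool" where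
  "free_of_rank R M n \<longleftrightarrow> (\<exists>b. is_basis R M n b)"

definition quotient_algebra :: "('r, 'a, 'c) module_scheme \<Rightarrow> 'a set \<Rightarrow> ('r, 'a set) module" where
  "quotient_algebra M H =
    \<lparr>carrier = a_rcosets\<^bsub>M\<^esub> H, mult = rcoset_mult M H, one = H +>\<^bsub>M\<^esub> \<one>\<^bsub>M\<^esub>, zero = H,
     add = set_add M, smult = (\<lambda>r S. \<Union>x\<in>S. H +>\<^bsub>M\<^esub> (r \<odot>\<^bsub>M\<^esub> x))\<rparr>"


section \<open>Defining matrices\<close>

text \<open>
  The defining matrix depends on the choice of H, K and of the basis e. Hence it is a relation:
  is_defining_matrix R M m A holds if A arises from some admissible choice.
\<close>

definition is_defining_matrix ::
    "('r, 's) ring_scheme \<Rightarrow> ('r, 'a, 'c) module_scheme \<Rightarrow> nat \<Rightarrow> (nat \<Rightarrow> nat \<Rightarrow> 'r) \<Rightarrow> bool" where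
  "is_defining_matrix R M m A \<longleftrightarrow>
    (\<exists>H K e.
       submodule H R M \<and> submodule K R M \<and>
       H <+>\<^bsub>M\<^esub> K = annihilator M \<and> H \<inter> K = {\<zero>\<^bsub>M\<^esub>} \<and>
       cyclic R M K \<and> product_module R M \<subseteq> K \<and>
       (let Q = quotient_algebra M H in
         is_basis R Q (m + 1) e \<and>
         annihilator Q = cyclic_span R Q (e (m + 1)) \<and>
         (\<forall>i\<in>{1..m}. \<forall>j\<in>{1..m}.
            A i j \<in> carrier R \<and> e i \<otimes>\<^bsub>Q\<^esub> e j = A i j \<odot>\<^bsub>Q\<^esub> e (m + 1))))"

definition unimodular_algebras :: "nat \<Rightarrow> nat \<Rightarrow> nat \<Rightarrow> (padic, 'a) module set" where
  "unimodular_algebras p n d =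
    {M. nonunital_comm_algebra (padic_int p) M \<and> three_nilpotent M \<and>
        free_of_rank (padic_int p) M n \<and>
        free_of_rank (padic_int p) (M\<lparr>carrier := annihilator M\<rparr>) d \<and>
        product_module (padic_int p) M \<noteq> {\<zero>\<^bsub>M\<^esub>} \<and>
        cyclic (padic_int p) M (product_module (padic_int p) M) \<and>
        (\<exists>\<Theta>. is_defining_matrix (padic_int p) M (n - d) \<Theta> \<and>
             unimodular (padic_int p) (n - d) \<Theta>)}"

definition isomorphism_classes :: "nat \<Rightarrow> nat \<Rightarrow> nat \<Rightarrow> (padic, 'a) module set set" where
  "isomorphism_classes p n d =
    unimodular_algebras p n d //
      {(M, N). M \<in> unimodular_algebras p n d \<and> N \<in> unimodular_algebras p n d \<and>
               isomorphic (padic_int p) M N}"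

end

theory Submission
  imports Defs "Jordan_Normal_Form.Determinant" "HOL-Number_Theory.Number_Theory"
begin

hide_const (open) Multiset.mult Polynomial.smult

text \<open>
  A defining matrix \<Theta> of M, with its data H, K, e, lifts to a basis of M in which only the first
  m basis vectors multiply nontrivially, and they multiply into the last one by \<Theta>. The annihilator
  has such a basis because a generator of K has a unit coordinate in every basis of it: K is a
  direct summand and the p-adic integers are local. So M is determined by \<Theta>, and two such
  algebras are isomorphic iff the matrices are congruent up to a unit factor u. Taking determinants,
  u^m det \<Theta> and det \<Xi> differ by the square of a unit.

  Conversely, a symmetric integer matrix with determinant prime to p is diagonalized without
  fractions, and a x^2 + b y^2 = 1 is solvable modulo p, so modulo p it is congruent to
  diag(\<delta>, 1, ..., 1). Since p is odd, a congruence modulo p lifts to a p-adic one by Hensel's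
  method applied to the matrix equation. Hence the square class of the determinant modulo p
  decides congruence; scaling by u does not change it for even m and merges both classes for odd m.

  All p-adic statements are checked level by level, on integer matrices modulo p^n.
\<close>

section \<open>Congruence of symmetric integer matrices modulo p\<close>

definition mat_cong :: "int \<Rightarrow> int mat \<Rightarrow> int mat \<Rightarrow> bool" where
  "mat_cong q A B \<longleftrightarrow> dim_row A = dim_row B \<and> dim_col A = dim_col B \<and>
    (\<forall>i<dim_row A. \<forall>j<dim_col A. [A $$ (i, j) = B $$ (i, j)] (mod q))"

lemma mat_cong_refl [simp]: "mat_cong q A A"
  by (simp add: mat_cong_def)

lemma mat_cong_sym: "mat_cong q A B \<Longrightarrow> mat_cong q B A"
  by (auto simp: mat_cong_def cong_sym_eq)

lemma mat_cong_trans: "mat_cong q A B \<Longrightarrow> mat_cong q B C \<Longrightarrow> mat_cong q A C"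
  unfolding mat_cong_def by (metis cong_trans)

lemma mat_cong_dvd: "mat_cong q A B \<Longrightarrow> q' dvd q \<Longrightarrow> mat_cong q' A B"
  unfolding mat_cong_def by (metis cong_dvd_modulus)

lemma mat_cong_one: "mat_cong 1 A B" if "A \<in> carrier_mat m n" "B \<in> carrier_mat m n"
  using that by (auto simp: mat_cong_def)

lemma mat_cong_index:
  "mat_cong q A B \<Longrightarrow> A \<in> carrier_mat m n \<Longrightarrow> i < m \<Longrightarrow> j < n \<Longrightarrow> [A $$ (i, j) = B $$ (i, j)] (mod q)"
  by (auto simp: mat_cong_def)

lemma mat_cong_carrier: "mat_cong q A B \<Longrightarrow> A \<in> carrier_mat m n \<Longrightarrow> B \<in> carrier_mat m n"
  by (auto simp: mat_cong_def)

lemma mat_congI: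
  assumes "A \<in> carrier_mat m n" "B \<in> carrier_mat m n"
    "\<And>i j. i < m \<Longrightarrow> j < n \<Longrightarrow> [A $$ (i, j) = B $$ (i, j)] (mod q)"
  shows "mat_cong q A B"
  using assms by (auto simp: mat_cong_def)

lemma mat_cong_transpose: "mat_cong q A B \<Longrightarrow> mat_cong q A\<^sup>T B\<^sup>T"
  by (auto simp: mat_cong_def)

lemma mat_cong_mult:
  assumes "mat_cong q A B" "mat_cong q C D" "dim_col A = dim_row C"
  shows "mat_cong q (A * C) (B * D)"
  using assms unfolding mat_cong_def by (auto simp: scalar_prod_def intro!: cong_sum cong_mult)

lemma mat_cong_det:
  assumes "mat_cong q A B" "A \<in> carrier_mat n n"
  shows "[det A = det B] (mod q)"
proof -
  have B: "B \<in> carrier_mat n n" using assms mat_cong_carrier by blast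
  show ?thesis
    unfolding det_def'[OF assms(2)] det_def'[OF B]
  proof (intro cong_sum cong_mult cong_prod cong_refl)
    fix \<pi> i assume "\<pi> \<in> {\<pi>. \<pi> permutes {0..<n}}" "i \<in> {0..<n}"
    then have "i < n" "\<pi> i < n" using permutes_in_image[of \<pi> "{0..<n}" i] by auto
    then show "[A $$ (i, \<pi> i) = B $$ (i, \<pi> i)] (mod q)"
      using mat_cong_index[OF assms] by simp
  qed
qed

definition form_equiv :: "int \<Rightarrow> nat \<Rightarrow> int mat \<Rightarrow> int mat \<Rightarrow> bool" where
  "form_equiv q m A B \<longleftrightarrow>
    (\<exists>C\<in>carrier_mat m m. coprime (det C) q \<and> mat_cong q (C\<^sup>T * A * C) B)"

lemma form_equivI:
  assumes "C \<in> carrier_mat m m" "coprime (det C) q" "mat_cong q (C\<^sup>T * A * C) B"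
  shows "form_equiv q m A B"
  using assms by (auto simp: form_equiv_def)

lemma form_equiv_refl_cong: "A \<in> carrier_mat m m \<Longrightarrow> mat_cong q A B \<Longrightarrow> form_equiv q m A B"
  by (rule form_equivI[of "1\<^sub>m m"]) auto

lemma form_equiv_trans:
  assumes "form_equiv q m A B" "form_equiv q m B D" "A \<in> carrier_mat m m" "B \<in> carrier_mat m m"
  shows "form_equiv q m A D"
proof -
  obtain C where C: "C \<in> carrier_mat m m" "coprime (det C) q" "mat_cong q (C\<^sup>T * A * C) B"
    using assms by (auto simp: form_equiv_def)
  obtain E where E: "E \<in> carrier_mat m m" "coprime (det E) q" "mat_cong q (E\<^sup>T * B * E) D"
    using assms by (auto simp: form_equiv_def)
  show ?thesis
  proof (rule form_equivI[of "C * E"])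
    show "C * E \<in> carrier_mat m m" using C E by simp
    show "coprime (det (C * E)) q" using C E by (simp add: det_mult)
    have "(C * E)\<^sup>T * A * (C * E) = E\<^sup>T * (C\<^sup>T * A * C) * E"
      using C(1) E(1) assms(3) by (simp add: transpose_mult[of C m m E m] assoc_mult_mat[of _ m m _ m _ m])
    moreover have "mat_cong q (E\<^sup>T * (C\<^sup>T * A * C) * E) (E\<^sup>T * B * E)"
      using C E assms by (intro mat_cong_mult) auto
    ultimately show "mat_cong q ((C * E)\<^sup>T * A * (C * E)) D" using E(3) mat_cong_trans by metis
  qed
qed

lemma form_equiv_sym:
  assumes "form_equiv q m A B" "A \<in> carrier_mat m m"
  shows "form_equiv q m B A"
proof -
  obtain C where C: "C \<in> carrier_mat m m" "coprime (det C) q" "mat_cong q (C\<^sup>T * A * C) B"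
    using assms by (auto simp: form_equiv_def)
  have B: "B \<in> carrier_mat m m" using mat_cong_carrier[OF C(3)] C assms by auto
  obtain w where w: "[det C * w = 1] (mod q)" using C(2) by (metis coprime_iff_invertible_int)
  define E where "E = w \<cdot>\<^sub>m adj_mat C"
  note adj = adj_mat[OF C(1)]
  have E: "E \<in> carrier_mat m m" using adj by (simp add: E_def)
  have CE: "C * E = (det C * w) \<cdot>\<^sub>m 1\<^sub>m m"
    unfolding E_def using adj C(1) by (simp add: mult_smult_distrib[of _ m m _ m])
      (rule eq_matI, auto)
  then have CE1: "mat_cong q (C * E) (1\<^sub>m m)"
    using w by (intro mat_congI[of _ m m]) (auto intro: cong_trans)
  have "[det (C * E) = 1] (mod q)" using mat_cong_det[OF CE1, of m] C E by simp
  then have dE: "coprime (det E) q"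
    using C(1) E by (simp add: det_mult) (metis coprime_iff_invertible_int mult.commute)
  have "mat_cong q (E\<^sup>T * B * E) (E\<^sup>T * (C\<^sup>T * A * C) * E)"
    using C E assms B by (intro mat_cong_mult mat_cong_refl mat_cong_sym[OF C(3)]) auto
  moreover have "E\<^sup>T * (C\<^sup>T * A * C) * E = (C * E)\<^sup>T * A * (C * E)"
    using C(1) E(1) assms by (simp add: transpose_mult[of C m m E m] assoc_mult_mat[of _ m m _ m _ m])
  moreover have "mat_cong q ((C * E)\<^sup>T * A * (C * E)) ((1\<^sub>m m)\<^sup>T * A * 1\<^sub>m m)"
    using C E assms CE1 by (intro mat_cong_mult mat_cong_refl mat_cong_transpose) auto
  ultimately have "mat_cong q (E\<^sup>T * B * E) A"
    using assms(2) mat_cong_trans by simp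
  then show ?thesis using form_equivI E dE by blast
qed

definition dsum :: "'a::zero mat \<Rightarrow> 'a mat \<Rightarrow> 'a mat" where
  "dsum A B = four_block_mat A (0\<^sub>m (dim_row A) (dim_col B)) (0\<^sub>m (dim_row B) (dim_col A)) B"

lemma dsum_carrier [simp]:
  "A \<in> carrier_mat m m \<Longrightarrow> B \<in> carrier_mat n n \<Longrightarrow> dsum A B \<in> carrier_mat (m + n) (m + n)"
  by (simp add: dsum_def)

lemma dsum_assoc: "dsum A (dsum B C) = dsum (dsum A B) C"
  unfolding dsum_def by (rule assoc_four_block_mat)

lemma dsum_one [simp]: "dsum (1\<^sub>m m) (1\<^sub>m n) = 1\<^sub>m (m + n)"
  by (simp add: dsum_def)

lemma dsum_transpose: "(dsum A B)\<^sup>T = dsum A\<^sup>T B\<^sup>T"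
  unfolding dsum_def by (rule eq_matI) auto

lemma dsum_mult:
  fixes A B C D :: "'a::semiring_1 mat"
  assumes "A \<in> carrier_mat m m" "C \<in> carrier_mat m m" "B \<in> carrier_mat n n" "D \<in> carrier_mat n n"
  shows "dsum A B * dsum C D = dsum (A * C) (B * D)"
  using assms unfolding dsum_def
  by (subst mult_four_block_mat[of _ m m _ n _ n _ _ m _ n]) auto

lemma det_dsum:
  fixes A B :: "'a::idom mat"
  assumes "A \<in> carrier_mat m m" "B \<in> carrier_mat n n"
  shows "det (dsum A B) = det A * det B"
  using assms unfolding dsum_def by (intro det_four_block_mat_lower_left_zero) auto

lemma dsum_cong: "mat_cong q A B \<Longrightarrow> mat_cong q C D \<Longrightarrow> mat_cong q (dsum A C) (dsum B D)"
  unfolding mat_cong_def dsum_def by auto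

lemma form_equiv_dsum:
  assumes "form_equiv q m A A'" "form_equiv q n B B'"
    and [simp]: "A \<in> carrier_mat m m" "B \<in> carrier_mat n n"
  shows "form_equiv q (m + n) (dsum A B) (dsum A' B')"
proof -
  obtain C where C [simp]: "C \<in> carrier_mat m m" and C': "coprime (det C) q" "mat_cong q (C\<^sup>T * A * C) A'"
    using assms by (auto simp: form_equiv_def)
  obtain E where E [simp]: "E \<in> carrier_mat n n" and E': "coprime (det E) q" "mat_cong q (E\<^sup>T * B * E) B'"
    using assms by (auto simp: form_equiv_def)
  have "(dsum C E)\<^sup>T * dsum A B * dsum C E = dsum (C\<^sup>T * A * C) (E\<^sup>T * B * E)"
    using mult_carrier_mat[of "C\<^sup>T" m m A m] mult_carrier_mat[of "E\<^sup>T" n n B n]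
    by (simp add: dsum_transpose dsum_mult[of _ m _ _ n])
  then show ?thesis
    using C' E' by (intro form_equivI[of "dsum C E"]) (auto simp: det_dsum[of _ m _ n] intro: dsum_cong)
qed

lemma smult_smult_mat: "a \<cdot>\<^sub>m (b \<cdot>\<^sub>m A) = (a * b :: 'a :: comm_ring_1) \<cdot>\<^sub>m A"
  by (rule eq_matI) (auto simp: mult.assoc)

abbreviation scalar_mat :: "'a::semiring_1 \<Rightarrow> 'a mat" where
  "scalar_mat a \<equiv> a \<cdot>\<^sub>m 1\<^sub>m 1"

lemma transpose_smult: "(a \<cdot>\<^sub>m A)\<^sup>T = a \<cdot>\<^sub>m A\<^sup>T"
  by (rule eq_matI) auto

lemma smult_one_mult_mat:
  fixes a :: "'a :: comm_ring_1"
  assumes "Z \<in> carrier_mat k n"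
  shows "(a \<cdot>\<^sub>m 1\<^sub>m k) * Z = a \<cdot>\<^sub>m Z"
  using assms by (simp add: mult_smult_assoc_mat[of _ k k _ n])

lemma swaprows_mat_transpose:
  "i < n \<Longrightarrow> j < n \<Longrightarrow> (swaprows_mat n i j)\<^sup>T = swaprows_mat n i j"
  by (rule eq_matI) auto

lemma addrow_mat_transpose:
  "i < n \<Longrightarrow> j < n \<Longrightarrow> (addrow_mat n a i j)\<^sup>T = addrow_mat n a j i"
  by (rule eq_matI) auto

lemma form_equiv_unit_diagonal:
  fixes A :: "int mat"
  assumes p: "prime p" "odd p" and A: "A \<in> carrier_mat m m" "A\<^sup>T = A" and d: "coprime (det A) p"
    and m: "0 < m"
  shows "\<exists>B i. i < m \<and> form_equiv p m A B \<and> B \<in> carrier_mat m m \<and> B\<^sup>T = B \<and> coprime (B $$ (i, i)) p"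
proof (cases "\<exists>i<m. coprime (A $$ (i, i)) p")
  case True
  then show ?thesis using A form_equiv_refl_cong by (metis mat_cong_refl)
next
  case False
  have cop: "coprime x p \<longleftrightarrow> \<not> p dvd x" for x :: int
    using p(1) by (metis coprime_commute prime_imp_coprime coprime_common_divisor dvd_refl not_prime_unit)
  have diag: "p dvd A $$ (i, i)" if "i < m" for i using False that cop by blast
  have "\<exists>k<m. \<exists>l<m. \<not> p dvd A $$ (k, l)"
  proof (rule ccontr)
    assume *: "\<not> ?thesis"
    have "mat_cong p A (0\<^sub>m m m)"
      using * A by (intro mat_congI[of _ m m]) (auto simp: cong_0_iff)
    then have "[det A = det (0\<^sub>m m m :: int mat)] (mod p)" using mat_cong_det A by blast
    then show False using m d cop by (simp add: cong_0_iff)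
  qed
  then obtain k l where kl: "k < m" "l < m" "\<not> p dvd A $$ (k, l)" by blast
  then have ne: "k \<noteq> l" using diag by blast
  have sym: "A $$ (l, k) = A $$ (k, l)" using A kl by (metis carrier_matD index_transpose_mat(1))
  define C :: "int mat" where "C = addrow_mat m 1 k l"
  have C: "C \<in> carrier_mat m m" by (simp add: C_def)
  define B where "B = C\<^sup>T * A * C"
  have B: "B = C\<^sup>T * (A * C)" using C A by (simp add: B_def assoc_mult_mat[of _ m m _ m _ m])
  have AC: "A * C = addcol 1 l k A" using addcol_mat[OF A(1) kl(1)] by (simp add: C_def)
  have CT: "C\<^sup>T = addrow_mat m 1 l k" using kl by (simp add: C_def addrow_mat_transpose)
  have "B = addrow 1 l k (addcol 1 l k A)"
    unfolding B AC CT using A kl by (intro addrow_mat[symmetric]) auto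
  then have "B $$ (l, l) = A $$ (k, k) + 2 * A $$ (k, l) + A $$ (l, l)"
    using A kl sym by simp
  moreover have "\<not> p dvd 2 * A $$ (k, l)"
    using kl p(2) by (simp add: coprime_dvd_mult_right_iff)
  ultimately have "\<not> p dvd B $$ (l, l)"
    using diag kl by (simp add: dvd_add_left_iff dvd_add_right_iff)
  moreover have "B\<^sup>T = B"
    unfolding B_def using C A by (simp add: transpose_mult[of _ m m _ m] assoc_mult_mat[of _ m m _ m _ m])
  moreover have "form_equiv p m A B"
    using C kl ne by (intro form_equivI[of C]) (auto simp: B_def C_def det_addrow_mat)
  moreover have "B \<in> carrier_mat m m" using A C by (simp add: B_def)
  ultimately show ?thesis using kl cop by blast
qed


lemma form_equiv_split_unit:
  fixes A :: "int mat"
  assumes p: "prime p" "odd p" and A: "A \<in> carrier_mat (Suc n) (Suc n)" "A\<^sup>T = A" and d: "coprime (det A) p"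
  shows "\<exists>a A'. coprime a p \<and> A' \<in> carrier_mat n n \<and> A'\<^sup>T = A' \<and> coprime (det A') p \<and>
    form_equiv p (Suc n) A (dsum (scalar_mat a) A')"
proof -
  obtain B i where B: "i < Suc n" "form_equiv p (Suc n) A B" "B \<in> carrier_mat (Suc n) (Suc n)" "B\<^sup>T = B"
    "coprime (B $$ (i, i)) p"
    using form_equiv_unit_diagonal[OF p A d] by auto
  define P :: "int mat" where "P = swaprows_mat (Suc n) 0 i"
  have P: "P \<in> carrier_mat (Suc n) (Suc n)" "P\<^sup>T = P"
    using B by (simp_all add: P_def swaprows_mat_transpose)
  define D where "D = P\<^sup>T * B * P"
  have D: "D \<in> carrier_mat (Suc n) (Suc n)" using P B by (simp add: D_def)
  have DT: "D\<^sup>T = D"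
    unfolding D_def using P(1) B
    by (simp add: transpose_mult[of _ "Suc n" "Suc n" _ "Suc n"] assoc_mult_mat[of _ "Suc n" "Suc n" _
        "Suc n" _ "Suc n"])
  have "D = swaprows 0 i (swapcols 0 i B)"
  proof -
    have "B * P = swapcols 0 i B" unfolding P_def using swapcols_mat[OF B(3)] B(1) by simp
    then have "D = P * swapcols 0 i B"
      using P B by (simp add: D_def assoc_mult_mat[of _ "Suc n" "Suc n" _ "Suc n" _ "Suc n"])
    then show ?thesis unfolding P_def using swaprows_mat[of "swapcols 0 i B" "Suc n" "Suc n" 0 i] B by simp
  qed
  then have D00: "D $$ (0, 0) = B $$ (i, i)" using B by simp
  have AD: "form_equiv p (Suc n) A D"
  proof (rule form_equiv_trans[OF B(2)])
    show "form_equiv p (Suc n) B D"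
    proof (rule form_equivI[of P])
      have "P = 1\<^sub>m (Suc n)" if "i = 0" using that by (intro eq_matI) (auto simp: P_def)
      then show "coprime (det P) p"
        using B(1) by (cases "i = 0") (simp_all add: P_def det_swaprows_mat)
    qed (auto simp: D_def P)
  qed (use A B in auto)
  define a where "a = D $$ (0, 0)"
  have a: "coprime a p" using B D00 by (simp add: a_def)
  obtain A1 r s A2 where split: "split_block D 1 1 = (A1, r, s, A2)" by (metis prod_cases4)
  note sb = split_block[OF split, of n n]
  have c: "A1 \<in> carrier_mat 1 1" "r \<in> carrier_mat 1 n" "s \<in> carrier_mat n 1" "A2 \<in> carrier_mat n n"
    and D4: "D = four_block_mat A1 r s A2" using sb D by auto
  have A1: "A1 = scalar_mat a"
    using c D4 by (intro eq_matI) (auto simp: a_def)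
  have "four_block_mat A1\<^sup>T s\<^sup>T r\<^sup>T A2\<^sup>T = four_block_mat A1 r s A2"
    using DT transpose_four_block_mat[OF c] D4 by simp
  then have s: "s = r\<^sup>T" and A2: "A2\<^sup>T = A2"
  proof -
    assume *: "four_block_mat A1\<^sup>T s\<^sup>T r\<^sup>T A2\<^sup>T = four_block_mat A1 r s A2"
    show "s = r\<^sup>T"
    proof (rule eq_matI)
      fix i j assume "i < dim_row r\<^sup>T" "j < dim_col r\<^sup>T"
      then show "s $$ (i, j) = r\<^sup>T $$ (i, j)"
        using arg_cong[OF *, of "\<lambda>M. M $$ (Suc i, 0)"] c by simp
    qed (use c in auto)
    show "A2\<^sup>T = A2"
    proof (rule eq_matI)
      fix i j assume "i < dim_row A2" "j < dim_col A2"
      then show "A2\<^sup>T $$ (i, j) = A2 $$ (i, j)"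
        using arg_cong[OF *, of "\<lambda>M. M $$ (Suc i, Suc j)"] c by simp
    qed (use c in auto)
  qed
  define C where "C = four_block_mat (1\<^sub>m 1) (- r) (0\<^sub>m n 1) (a \<cdot>\<^sub>m 1\<^sub>m n)"
  have C: "C \<in> carrier_mat (Suc n) (Suc n)"
    using c unfolding C_def by (metis four_block_carrier_mat one_carrier_mat plus_1_eq_Suc smult_carrier_mat)
  define A' where "A' = (a * a) \<cdot>\<^sub>m A2 - a \<cdot>\<^sub>m (r\<^sup>T * r)"
  have A': "A' \<in> carrier_mat n n" using c by (auto simp: A'_def)
  have DC: "D * C = four_block_mat (scalar_mat a) (0\<^sub>m 1 n) (r\<^sup>T) (a \<cdot>\<^sub>m A2 - r\<^sup>T * r)"
    unfolding D4 C_def using c s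
    by (subst mult_four_block_mat[of _ 1 1 _ n _ n _ _ 1 _ n])
       (auto simp: A1 smult_one_mult_mat[of _ "Suc 0" n] mult_smult_distrib[of _ _ n _ n]
           mult_smult_assoc_mat[of _ _ 1 _ n] intro!: cong_four_block_mat eq_matI)
  have CT: "C\<^sup>T = four_block_mat (1\<^sub>m 1) (0\<^sub>m 1 n) (- r\<^sup>T) (a \<cdot>\<^sub>m 1\<^sub>m n)"
    unfolding C_def using c by (subst transpose_four_block_mat[of _ 1 1 _ n _ n])
        (auto intro!: cong_four_block_mat eq_matI)
  have "(a \<cdot>\<^sub>m 1\<^sub>m n) * (a \<cdot>\<^sub>m A2 - r\<^sup>T * r)
      = a \<cdot>\<^sub>m (a \<cdot>\<^sub>m A2 - r\<^sup>T * r)"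
    using mult_carrier_mat[of "r\<^sup>T" n 1 r n] c
    by (intro smult_one_mult_mat[of _ n n] minus_carrier_mat) simp
  note aZ = this
  have "C\<^sup>T * D * C = C\<^sup>T * (D * C)"
    using C D by (simp add: assoc_mult_mat[of _ "Suc n" "Suc n" _ "Suc n" _ "Suc n"])
  also have "\<dots> = dsum (scalar_mat a) A'"
    unfolding CT DC dsum_def A'_def using c
    by (subst mult_four_block_mat[of _ 1 1 _ n _ n _ _ 1 _ n])
       (auto simp: aZ smult_one_mult_mat[of _ n "Suc 0"] mult_smult_distrib[of _ _ n _ n]
          algebra_simps intro!: cong_four_block_mat eq_matI)
  finally have CDC: "C\<^sup>T * D * C = dsum (scalar_mat a) A'" .
  have dC: "det C = a ^ n"
    unfolding C_def using c by (subst det_four_block_mat_lower_left_zero[of _ 1 _ n]) auto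
  have "det C * det D * det C = a * det A'"
  proof -
    have "det (C\<^sup>T * D * C) = det C * det D * det C"
      using C D by (simp add: det_mult[of _ "Suc n"] det_transpose[of _ "Suc n"])
    then show ?thesis using CDC A' det_dsum[of "scalar_mat a" 1 A' n] by simp
  qed
  moreover have "coprime (det D) p"
  proof -
    obtain E where "E \<in> carrier_mat (Suc n) (Suc n)" "coprime (det E) p" "mat_cong p (E\<^sup>T * A * E) D"
      using AD by (auto simp: form_equiv_def)
    then show ?thesis
      using mat_cong_det[of p "E\<^sup>T * A * E" D "Suc n"] A d
      by (simp add: det_mult[of _ "Suc n"] det_transpose[of _ "Suc n"])
         (metis cong_imp_coprime coprime_mult_left_iff)
  qed
  ultimately have "coprime (det A') p"
    using a dC by (metis coprime_mult_left_iff coprime_power_left_iff)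
  moreover have "A'\<^sup>T = A'"
    unfolding A'_def using c A2 by (auto simp: transpose_minus[of _ n n] transpose_mult[of _ n 1 _ n]
        transpose_smult)
  moreover have "form_equiv p (Suc n) A (dsum (scalar_mat a) A')"
  proof (rule form_equiv_trans[OF AD])
    show "form_equiv p (Suc n) D (dsum (scalar_mat a) A')"
      using C CDC dC a by (intro form_equivI[of C]) auto
  qed (use A D in auto)
  ultimately show ?thesis using a A' by blast
qed

lemma sum_two_weighted_squares_cong_one:
  fixes p a b :: int
  assumes p: "prime p" "odd p" and ab: "coprime a p" "coprime b p"
  shows "\<exists>x y. [a * x\<^sup>2 + b * y\<^sup>2 = 1] (mod p)"
proof -
  have p0: "p > 0" using p by (simp add: prime_gt_0_int)
  define I where "I = {0..(p - 1) div 2}"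
  have inj: "inj_on (\<lambda>x. (c + a * x\<^sup>2) mod p) I" if "coprime a p" for a c :: int
  proof (rule inj_onI)
    fix x y assume xy: "x \<in> I" "y \<in> I" and "(c + a * x\<^sup>2) mod p = (c + a * y\<^sup>2) mod p"
    then have "p dvd (c + a * x\<^sup>2) - (c + a * y\<^sup>2)" by (simp add: mod_eq_dvd_iff)
    also have "(c + a * x\<^sup>2) - (c + a * y\<^sup>2) = a * ((x - y) * (x + y))"
      by (simp add: algebra_simps power2_eq_square)
    finally have "p dvd (x - y) * (x + y)"
      using that by (simp add: coprime_commute coprime_dvd_mult_right_iff)
    then have dvd: "p dvd x - y \<or> p dvd x + y" using p by (simp add: prime_dvd_mult_iff)
    have "\<bar>x - y\<bar> < p" "x + y < p" "0 \<le> x + y" using xy p0 by (auto simp: I_def)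
    from dvd show "x = y"
    proof
      assume "p dvd x - y"
      then show ?thesis using \<open>\<bar>x - y\<bar> < p\<close> dvd_imp_le_int[of "x - y" p] p0 by fastforce
    next
      assume "p dvd x + y"
      then have "x + y = 0" using \<open>x + y < p\<close> \<open>0 \<le> x + y\<close> zdvd_imp_le[of p "x + y"] by fastforce
      then show ?thesis using xy by (auto simp: I_def)
    qed
  qed
  define S where "S = (\<lambda>x. (0 + a * x\<^sup>2) mod p) ` I"
  define T where "T = (\<lambda>y. (1 + (- b) * y\<^sup>2) mod p) ` I"
  have "int (card I) = (p + 1) div 2" using p0 by (simp add: I_def)
  then have card: "int (card S + card T) = p + 1"
  proof -
    have "2 * ((p + 1) div 2) = p + 1" using p(2) by presburger
    moreover have "card S = card I" "card T = card I"
      using inj[of a 0] inj[of "- b" 1] ab by (auto simp: S_def T_def card_image)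
    ultimately show ?thesis using \<open>int (card I) = (p + 1) div 2\<close> by linarith
  qed
  have "S \<union> T \<subseteq> {0..<p}" using p0 by (auto simp: S_def T_def)
  then have "card (S \<union> T) \<le> card {0..<p}" by (intro card_mono) auto
  then have "int (card (S \<union> T)) \<le> p" using p0 by simp
  moreover have "finite S" "finite T" by (auto simp: S_def T_def I_def)
  ultimately have "card (S \<inter> T) \<noteq> 0" using card card_Un_Int[of S T] by linarith
  then have "S \<inter> T \<noteq> {}" by auto
  then obtain x y where "(a * x\<^sup>2) mod p = (1 - b * y\<^sup>2) mod p" by (auto simp: S_def T_def)
  then have "[a * x\<^sup>2 + b * y\<^sup>2 = (1 - b * y\<^sup>2) + b * y\<^sup>2] (mod p)"
    by (intro cong_add) (auto simp: cong_def)
  then show ?thesis by auto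
qed

lemma form_equiv_binary:
  fixes a b :: int
  assumes p: "prime p" "odd p" and ab: "coprime a p" "coprime b p"
  shows "form_equiv p 2 (dsum (scalar_mat a) (scalar_mat b)) (dsum (scalar_mat (a * b)) (1\<^sub>m 1))"
proof -
  obtain x y where xy: "[a * x\<^sup>2 + b * y\<^sup>2 = 1] (mod p)"
    using sum_two_weighted_squares_cong_one[OF p ab] by blast
  define C where "C = four_block_mat (scalar_mat (- b * y)) (scalar_mat x) (scalar_mat (a * x)) (scalar_mat y)"
  define D where "D = dsum (scalar_mat a) (scalar_mat b)"
  have C: "C \<in> carrier_mat 2 2" and D: "D \<in> carrier_mat 2 2"
    unfolding C_def D_def dsum_def by auto
  have CT: "C\<^sup>T = four_block_mat (scalar_mat (- b * y)) (scalar_mat (a * x)) (scalar_mat x) (scalar_mat y)"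
    unfolding C_def by (rule eq_matI) auto
  have DC: "D * C = four_block_mat (scalar_mat (- a * b * y)) (scalar_mat (a * x)) (scalar_mat
      (a * b * x)) (scalar_mat (b * y))"
    unfolding C_def D_def dsum_def
    by (subst mult_four_block_mat[of _ 1 1 _ 1 _ 1 _ _ 1 _ 1]) (auto intro!: cong_four_block_mat eq_matI)
  define q where "q = a * x\<^sup>2 + b * y\<^sup>2"
  have "C\<^sup>T * (D * C) = four_block_mat (scalar_mat (a * b * q)) (0\<^sub>m 1 1) (0\<^sub>m 1 1)
      (scalar_mat q)"
    unfolding CT DC q_def
    by (subst mult_four_block_mat[of _ 1 1 _ 1 _ 1 _ _ 1 _ 1])
       (auto intro!: cong_four_block_mat eq_matI simp: algebra_simps power2_eq_square)
  then have CDC: "C\<^sup>T * D * C = dsum (scalar_mat (a * b * q)) (scalar_mat q)"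
    using C D by (simp add: dsum_def assoc_mult_mat[of _ 2 2 _ 2 _ 2])
  have "mat_cong p (dsum (scalar_mat (a * b * q)) (scalar_mat q)) (dsum (scalar_mat (a * b)) (1\<^sub>m 1))"
  proof (rule dsum_cong)
    show "mat_cong p (scalar_mat (a * b * q)) (scalar_mat (a * b))"
      using cong_mult[OF cong_refl[of "a * b"] xy] by (intro mat_congI[of _ 1 1]) (auto simp: q_def)
    show "mat_cong p (scalar_mat q) (1\<^sub>m 1)"
      using xy by (intro mat_congI[of _ 1 1]) (auto simp: q_def)
  qed
  moreover have "coprime (det C) p"
  proof -
    have "det C * det D * det C = det (C\<^sup>T * D * C)"
      using C D by (simp add: det_mult[of _ 2] det_transpose[of _ 2])
    also have "\<dots> = a * b * q * q"
      unfolding CDC by (simp add: det_dsum[of _ 1 _ 1])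
    finally have "coprime (det C * det D * det C) p"
      using ab xy cong_imp_coprime[OF cong_sym[OF xy]] by (simp add: q_def)
    then show ?thesis by simp
  qed
  ultimately show ?thesis using C CDC unfolding D_def by (intro form_equivI[of C]) auto
qed

lemma form_equiv_normal:
  fixes A :: "int mat"
  assumes p: "prime p" "odd p" and "A \<in> carrier_mat (Suc n) (Suc n)" "A\<^sup>T = A" "coprime (det A) p"
  shows "\<exists>\<delta>. coprime \<delta> p \<and> form_equiv p (Suc n) A (dsum (scalar_mat \<delta>) (1\<^sub>m n))"
  using assms(3-)
proof (induction n arbitrary: A)
  case 0
  then have "A = dsum (scalar_mat (A $$ (0, 0))) (1\<^sub>m 0)"
    by (intro eq_matI) (auto simp: dsum_def)
  moreover have "det A = A $$ (0, 0)" using 0 det_single[of A] by simp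
  ultimately show ?case using 0 form_equiv_refl_cong mat_cong_refl by metis
next
  case (Suc n)
  obtain a A' where A': "coprime a p" "A' \<in> carrier_mat (Suc n) (Suc n)" "A'\<^sup>T = A'" "coprime (det A') p"
    "form_equiv p (Suc (Suc n)) A (dsum (scalar_mat a) A')"
    using form_equiv_split_unit[OF p Suc.prems] by blast
  obtain \<delta> where \<delta>: "coprime \<delta> p" "form_equiv p (Suc n) A' (dsum (scalar_mat \<delta>) (1\<^sub>m n))"
    using Suc.IH A' by blast
  have "form_equiv p (1 + Suc n) (dsum (scalar_mat a) A') (dsum (scalar_mat a) (dsum (scalar_mat \<delta>)
      (1\<^sub>m n)))"
    using A' by (intro form_equiv_dsum[OF form_equiv_refl_cong \<delta>(2)]) auto
  moreover have "form_equiv p (2 + n) (dsum (dsum (scalar_mat a) (scalar_mat \<delta>)) (1\<^sub>m n))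
      (dsum (dsum (scalar_mat (a * \<delta>)) (1\<^sub>m 1)) (1\<^sub>m n))"
    using dsum_carrier[of "scalar_mat a" 1 "scalar_mat \<delta>" 1]
    by (intro form_equiv_dsum[OF form_equiv_binary[OF p A'(1) \<delta>(1)] form_equiv_refl_cong])
      (simp_all add: numeral_2_eq_2)
  moreover have "dsum (dsum (scalar_mat (a * \<delta>)) (1\<^sub>m 1)) (1\<^sub>m n)
      = dsum (scalar_mat (a * \<delta>)) (1\<^sub>m (Suc n))"
    by (simp add: dsum_assoc[symmetric])
  moreover have "dsum (scalar_mat a) (dsum (scalar_mat \<delta>) (1\<^sub>m n)) \<in> carrier_mat (1 + (1 + n)) (1 + (1 + n))"
    "dsum (scalar_mat a) A' \<in> carrier_mat (1 + Suc n) (1 + Suc n)"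
    using A' by (intro dsum_carrier; auto)+
  ultimately have "form_equiv p (Suc (Suc n)) (dsum (scalar_mat a) A') (dsum (scalar_mat (a * \<delta>))
      (1\<^sub>m (Suc n)))"
    using form_equiv_trans[of p "Suc (Suc n)" "dsum (scalar_mat a) A'"] by (simp add: dsum_assoc)
  then have "form_equiv p (Suc (Suc n)) A (dsum (scalar_mat (a * \<delta>)) (1\<^sub>m (Suc n)))"
    using A' Suc.prems form_equiv_trans[OF A'(5)] dsum_carrier[of "scalar_mat a" 1 A' "Suc n"] by auto
  then show ?case using A'(1) \<delta>(1) by (metis coprime_mult_left_iff)
qed


lemma form_equiv_if_det:
  fixes A B :: "int mat"
  assumes p: "prime p" "odd p" and A: "A \<in> carrier_mat (Suc n) (Suc n)" "A\<^sup>T = A" "coprime (det A) p"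
    and B: "B \<in> carrier_mat (Suc n) (Suc n)" "B\<^sup>T = B" "coprime (det B) p"
    and s: "coprime s p" "[det B = s\<^sup>2 * det A] (mod p)"
  shows "form_equiv p (Suc n) A B"
proof -
  have *: "\<exists>\<delta> c. coprime c p \<and> [\<delta> = c\<^sup>2 * det Z] (mod p) \<and> form_equiv p (Suc n) Z (dsum
      (scalar_mat \<delta>) (1\<^sub>m n))"
    if Z: "Z \<in> carrier_mat (Suc n) (Suc n)" "Z\<^sup>T = Z" "coprime (det Z) p" for Z :: "int mat"
  proof -
    obtain \<delta> where \<delta>: "form_equiv p (Suc n) Z (dsum (scalar_mat \<delta>) (1\<^sub>m n))"
      using form_equiv_normal[OF p Z] by blast
    then obtain C where C: "C \<in> carrier_mat (Suc n) (Suc n)" "coprime (det C) p"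
      "mat_cong p (C\<^sup>T * Z * C) (dsum (scalar_mat \<delta>) (1\<^sub>m n))" by (auto simp: form_equiv_def)
    have "[det (C\<^sup>T * Z * C) = det (dsum (scalar_mat \<delta>) (1\<^sub>m n))] (mod p)"
      using mat_cong_det[OF C(3), of "Suc n"] C Z by auto
    also have "det (C\<^sup>T * Z * C) = (det C)\<^sup>2 * det Z"
      using C Z by (simp add: det_mult[of _ "Suc n"] det_transpose[of _ "Suc n"] power2_eq_square)
    also have "det (dsum (scalar_mat \<delta>) (1\<^sub>m n)) = \<delta>" by (simp add: det_dsum[of _ 1 _ n])
    finally show ?thesis using \<delta> C(2) cong_sym by blast
  qed
  obtain \<alpha> c where a: "coprime c p" "[\<alpha> = c\<^sup>2 * det A] (mod p)" "form_equiv p (Suc n) A (dsum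
      (scalar_mat \<alpha>) (1\<^sub>m n))"
    using *[OF A] by blast
  obtain \<beta> e where b: "coprime e p" "[\<beta> = e\<^sup>2 * det B] (mod p)" "form_equiv p (Suc n) B (dsum
      (scalar_mat \<beta>) (1\<^sub>m n))"
    using *[OF B] by blast
  obtain c' where c': "[c * c' = 1] (mod p)" using a(1) by (metis coprime_iff_invertible_int)
  define t where "t = e * s * c'"
  have "coprime c' p" using c' by (metis coprime_iff_invertible_int mult.commute)
  then have t: "coprime t p" using b s by (simp add: t_def)
  have "[t\<^sup>2 * \<alpha> = t\<^sup>2 * (c\<^sup>2 * det A)] (mod p)" using a(2) by (intro cong_mult) auto
  also have "t\<^sup>2 * (c\<^sup>2 * det A) = (c * c')\<^sup>2 * (e\<^sup>2 * (s\<^sup>2 * det A))"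
    by (simp add: t_def power_mult_distrib algebra_simps)
  also have "[(c * c')\<^sup>2 * (e\<^sup>2 * (s\<^sup>2 * det A)) = 1\<^sup>2 * (e\<^sup>2 * det B)] (mod p)"
    using s(2) c' by (intro cong_mult cong_pow) (auto simp: cong_sym_eq)
  also have "[1\<^sup>2 * (e\<^sup>2 * det B) = \<beta>] (mod p)" using b(2) by (simp add: cong_sym_eq)
  finally have t2: "[t\<^sup>2 * \<alpha> = \<beta>] (mod p)" .
  have "form_equiv p 1 (scalar_mat \<alpha>) (scalar_mat \<beta>)"
  proof (rule form_equivI[of "scalar_mat t"])
    have "(scalar_mat t)\<^sup>T * scalar_mat \<alpha> * scalar_mat t = scalar_mat (t\<^sup>2 * \<alpha>)"
      by (rule eq_matI) (auto simp: scalar_prod_def power2_eq_square)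
    then show "mat_cong p ((scalar_mat t)\<^sup>T * scalar_mat \<alpha> * scalar_mat t) (scalar_mat \<beta>)"
      using t2 by (auto simp: mat_cong_def)
  qed (use t in auto)
  then have ab: "form_equiv p (1 + n) (dsum (scalar_mat \<alpha>) (1\<^sub>m n)) (dsum (scalar_mat \<beta>) (1\<^sub>m n))"
    by (rule form_equiv_dsum[OF _ form_equiv_refl_cong]) auto
  have car: "dsum (scalar_mat x) (1\<^sub>m n) \<in> carrier_mat (Suc n) (Suc n)" for x :: int
    using dsum_carrier[of "scalar_mat x" 1 "1\<^sub>m n" n] by simp
  have "form_equiv p (Suc n) A (dsum (scalar_mat \<beta>) (1\<^sub>m n))"
    using form_equiv_trans[OF a(3) _ A(1) car] ab by simp
  moreover have "form_equiv p (Suc n) (dsum (scalar_mat \<beta>) (1\<^sub>m n)) B"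
    using form_equiv_sym[OF b(3) B(1)] .
  ultimately show ?thesis using form_equiv_trans A(1) car by blast
qed

lemma mat_hensel_step:
  fixes \<Theta> \<Xi> C :: "int mat"
  assumes p: "prime p" "odd p"
    and \<Theta>: "\<Theta> \<in> carrier_mat m m" "\<Theta>\<^sup>T = \<Theta>" "coprime (det \<Theta>) p"
    and \<Xi>: "\<Xi> \<in> carrier_mat m m" "\<Xi>\<^sup>T = \<Xi>"
    and C: "C \<in> carrier_mat m m" "coprime (det C) p"
    and q: "p dvd q" "mat_cong q (C\<^sup>T * \<Theta> * C) \<Xi>"
  shows "\<exists>C'\<in>carrier_mat m m. coprime (det C') p \<and> mat_cong q C' C \<and> mat_cong (p * q) (C'\<^sup>T * \<Theta> * C') \<Xi>"
proof -
  define E where "E = mat m m (\<lambda>ij. ((C\<^sup>T * \<Theta> * C) $$ ij - \<Xi> $$ ij) div q)"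
  have E: "E \<in> carrier_mat m m" by (simp add: E_def)
  have CTC: "C\<^sup>T * \<Theta> * C \<in> carrier_mat m m" using C \<Theta> by simp
  have qE: "C\<^sup>T * \<Theta> * C = \<Xi> + q \<cdot>\<^sub>m E"
  proof (rule eq_matI)
    fix i j assume "i < dim_row (\<Xi> + q \<cdot>\<^sub>m E)" "j < dim_col (\<Xi> + q \<cdot>\<^sub>m E)"
    then have ij: "i < m" "j < m" using E by auto
    then have "q dvd (C\<^sup>T * \<Theta> * C) $$ (i, j) - \<Xi> $$ (i, j)"
      using mat_cong_index[OF q(2) CTC] by (simp add: cong_iff_dvd_diff)
    then show "(C\<^sup>T * \<Theta> * C) $$ (i, j) = (\<Xi> + q \<cdot>\<^sub>m E) $$ (i, j)"
      using ij \<Xi> E by (simp add: E_def del: index_mult_mat)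
  qed (use C \<Theta> E in auto)
  have CTC_sym: "(C\<^sup>T * \<Theta> * C)\<^sup>T = C\<^sup>T * \<Theta> * C"
    using C \<Theta> by (simp add: transpose_mult[of _ m m _ m] assoc_mult_mat[of _ m m _ m _ m])
  have E_sym: "E\<^sup>T = E"
  proof (rule eq_matI)
    fix i j assume "i < dim_row E" "j < dim_col E"
    then have ij: "i < m" "j < m" using E by auto
    have "(C\<^sup>T * \<Theta> * C) $$ (j, i) = (C\<^sup>T * \<Theta> * C) $$ (i, j)"
      using arg_cong[OF CTC_sym, of "\<lambda>M. M $$ (i, j)"] CTC ij by (simp del: index_mult_mat)
    moreover have "\<Xi> $$ (j, i) = \<Xi> $$ (i, j)"
      using arg_cong[OF \<Xi>(2), of "\<lambda>M. M $$ (i, j)"] \<Xi>(1) ij by simp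
    ultimately show "E\<^sup>T $$ (i, j) = E $$ (i, j)"
      using ij E by (simp add: E_def del: index_mult_mat)
  qed (use E in auto)
  define G where "G = C\<^sup>T * \<Theta>"
  have G: "G \<in> carrier_mat m m" using C \<Theta> by (simp add: G_def)
  have "coprime (det G) p" using C \<Theta> by (simp add: G_def det_mult[of _ m] det_transpose[of _ m])
  then have "coprime (2 * det G) p" using p(2) by simp
  then obtain w where w: "[2 * det G * w = 1] (mod p)" by (metis coprime_iff_invertible_int)
  define Z where "Z = (- w) \<cdot>\<^sub>m (adj_mat G * E)"
  note adj = adj_mat[OF G]
  have Z: "Z \<in> carrier_mat m m" using adj E by (simp add: Z_def)
  have GZ: "G * Z = (- w * det G) \<cdot>\<^sub>m E"
    unfolding Z_def using G adj E
    by (simp add: mult_smult_distrib[of _ m m _ m] assoc_mult_mat[of _ m m _ m _ m, symmetric]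
        mult_smult_assoc_mat[of _ m m _ m] smult_smult_mat)
  have ZG: "Z\<^sup>T * \<Theta> * C = (- w * det G) \<cdot>\<^sub>m E"
  proof -
    have "(G * Z)\<^sup>T = Z\<^sup>T * (\<Theta> * C)"
      using G Z C \<Theta> by (simp add: transpose_mult[of _ m m _ m] G_def)
    also have "\<dots> = Z\<^sup>T * \<Theta> * C" using Z \<Theta> C by (simp add: assoc_mult_mat[of _ m m _ m _ m])
    finally show ?thesis unfolding GZ transpose_smult using E_sym by simp
  qed
  define C' where "C' = C + q \<cdot>\<^sub>m Z"
  have C': "C' \<in> carrier_mat m m" using C Z by (simp add: C'_def)
  have cong: "mat_cong q C' C"
    using C Z C' by (intro mat_congI[of _ m m]) (auto simp: C'_def cong_iff_dvd_diff)
  have "[det C' = det C] (mod p)"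
    using mat_cong_det[OF cong C'] q(1) cong_dvd_modulus by blast
  then have "coprime (det C') p" using C(2) cong_imp_coprime cong_sym by blast
  have "C'\<^sup>T * \<Theta> * C' = C\<^sup>T * \<Theta> * C + q \<cdot>\<^sub>m (G * Z) + q \<cdot>\<^sub>m (Z\<^sup>T * \<Theta> * C) +
      (q * q) \<cdot>\<^sub>m (Z\<^sup>T * \<Theta> * Z)"
  proof -
    have "C'\<^sup>T * \<Theta> = C\<^sup>T * \<Theta> + q \<cdot>\<^sub>m (Z\<^sup>T * \<Theta>)"
      using C Z \<Theta> by (simp add: C'_def transpose_add[of _ m m] transpose_smult add_mult_distrib_mat[of _ m m _ _ m]
          mult_smult_assoc_mat[of _ m m _ m])
    moreover have "(G + q \<cdot>\<^sub>m (Z\<^sup>T * \<Theta>)) * C'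
        = G * C + q \<cdot>\<^sub>m (G * Z) + q \<cdot>\<^sub>m (Z\<^sup>T * \<Theta> * C) + (q * q) \<cdot>\<^sub>m (Z\<^sup>T * \<Theta> * Z)"
    proof -
      have H: "Z\<^sup>T * \<Theta> \<in> carrier_mat m m" using Z \<Theta> by simp
      have "(G + q \<cdot>\<^sub>m H) * (C + q \<cdot>\<^sub>m Z) = G * C + q \<cdot>\<^sub>m (G * Z) + q \<cdot>\<^sub>m
          (H * C) + (q * q) \<cdot>\<^sub>m (H * Z)"
        if "H \<in> carrier_mat m m" for H
        using that G C Z
        by (simp add: add_mult_distrib_mat[of _ m m _ _ m] mult_add_distrib_mat[of _ m m _ m]
            mult_smult_assoc_mat[of _ m m _ m] mult_smult_distrib[of _ m m _ m])
           (intro eq_matI; simp add: algebra_simps)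
      from this[OF H] show ?thesis by (simp add: C'_def)
    qed
    ultimately show ?thesis by (simp add: G_def)
  qed
  then have expand: "C'\<^sup>T * \<Theta> * C' = \<Xi> + q \<cdot>\<^sub>m E + q \<cdot>\<^sub>m
      ((- w * det G) \<cdot>\<^sub>m E) + q \<cdot>\<^sub>m ((- w * det G) \<cdot>\<^sub>m E)
      + (q * q) \<cdot>\<^sub>m (Z\<^sup>T * \<Theta> * Z)"
    unfolding qE GZ ZG .
  have "mat_cong (p * q) (C'\<^sup>T * \<Theta> * C') \<Xi>"
  proof (rule mat_congI[of _ m m])
    fix i j assume ij: "i < m" "j < m"
    obtain k where k: "q = p * k" using q(1) by auto
    obtain l where l: "1 - 2 * det G * w = p * l"
      using w by (metis cong_iff_dvd_diff cong_sym dvd_def)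
    have ZTZ: "Z\<^sup>T * \<Theta> * Z \<in> carrier_mat m m" using Z \<Theta> by simp
    have "(C'\<^sup>T * \<Theta> * C') $$ (i, j) - \<Xi> $$ (i, j)
        = q * E $$ (i, j) * (1 - 2 * det G * w) + q * q * (Z\<^sup>T * \<Theta> * Z) $$ (i, j)"
    proof -
      have "(C'\<^sup>T * \<Theta> * C') $$ (i, j) = \<Xi> $$ (i, j) + q * E $$ (i, j) + q * (- w * det G * E $$ (i, j))
          + q * (- w * det G * E $$ (i, j)) + q * q * (Z\<^sup>T * \<Theta> * Z) $$ (i, j)"
        unfolding expand using ij E \<Xi> ZTZ Z \<Theta>(1) by (simp del: index_mult_mat(1))
      then show ?thesis by (simp add: algebra_simps del: index_mult_mat(1))
    qed
    also have "\<dots> = p * q * (E $$ (i, j) * l + k * (Z\<^sup>T * \<Theta> * Z) $$ (i, j))"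
      unfolding l by (simp add: k algebra_simps del: index_mult_mat(1))
    finally show "[(C'\<^sup>T * \<Theta> * C') $$ (i, j) = \<Xi> $$ (i, j)] (mod p * q)"
      by (simp add: cong_iff_dvd_diff del: index_mult_mat(1))
  qed (use C' \<Theta> \<Xi> in auto)
  then show ?thesis using C' cong \<open>coprime (det C') p\<close> by blast
qed

lemma mat_hensel:
  fixes \<Theta> \<Xi> :: "nat \<Rightarrow> int mat"
  assumes p: "prime p" "odd p"
    and \<Theta>: "\<And>n. \<Theta> n \<in> carrier_mat m m" "\<And>n. (\<Theta> n)\<^sup>T = \<Theta> n" "\<And>n. mat_cong (p ^ n) (\<Theta> (Suc n)) (\<Theta> n)"
    and \<Xi>: "\<And>n. \<Xi> n \<in> carrier_mat m m" "\<And>n. (\<Xi> n)\<^sup>T = \<Xi> n" "\<And>n. mat_cong (p ^ n) (\<Xi> (Suc n)) (\<Xi> n)"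
    and d: "coprime (det (\<Theta> 1)) p" and eq: "form_equiv p m (\<Theta> 1) (\<Xi> 1)"
  shows "\<exists>C. \<forall>n. C n \<in> carrier_mat m m \<and> coprime (det (C n)) p \<and> mat_cong (p ^ n) (C (Suc n)) (C n) \<and>
    mat_cong (p ^ n) ((C n)\<^sup>T * \<Theta> n * C n) (\<Xi> n)"
proof -
  have \<Theta>1: "mat_cong p (\<Theta> (Suc n)) (\<Theta> 1)" for n
  proof (induction n)
    case (Suc n)
    have "mat_cong p (\<Theta> (Suc (Suc n))) (\<Theta> (Suc n))"
      using \<Theta>(3)[of "Suc n"] by (rule mat_cong_dvd) simp
    then show ?case using Suc mat_cong_trans by blast
  qed simp
  have dn: "coprime (det (\<Theta> (Suc n))) p" for n
    using mat_cong_det[OF \<Theta>1 \<Theta>(1)] d cong_imp_coprime cong_sym by blast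
  define P where "P n C \<longleftrightarrow> C \<in> carrier_mat m m \<and> coprime (det C) p \<and>
    mat_cong (p ^ Suc n) (C\<^sup>T * \<Theta> (Suc n) * C) (\<Xi> (Suc n))" for n C
  have "\<exists>C. \<forall>n. P n (C n) \<and> mat_cong (p ^ Suc n) (C (Suc n)) (C n)"
  proof (rule dependent_nat_choice)
    show "\<exists>C. P 0 C" using eq by (auto simp: P_def form_equiv_def)
    fix C n assume C: "P n C"
    have "mat_cong (p ^ Suc n) (C\<^sup>T * \<Theta> (Suc (Suc n)) * C) (C\<^sup>T * \<Theta> (Suc n) * C)"
      using \<Theta>(3)[of "Suc n"] C \<Theta>(1)[of "Suc (Suc n)"] by (intro mat_cong_mult) (auto simp: P_def)
    then have "mat_cong (p ^ Suc n) (C\<^sup>T * \<Theta> (Suc (Suc n)) * C) (\<Xi> (Suc (Suc n)))"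
      using C \<Xi>(3)[of "Suc n"] mat_cong_trans mat_cong_sym unfolding P_def by blast
    then show "\<exists>C'. P (Suc n) C' \<and> mat_cong (p ^ Suc n) C' C"
      using mat_hensel_step[OF p \<Theta>(1,2) dn \<Xi>(1,2), of C "p ^ Suc n" "Suc n" "Suc (Suc n)"] C
      unfolding P_def by auto
  qed
  then obtain C where C: "\<And>n. P n (C n)" "\<And>n. mat_cong (p ^ Suc n) (C (Suc n)) (C n)" by blast
  show ?thesis
  proof (intro exI[of _ "\<lambda>n. C (n - 1)"] allI conjI)
    fix n
    show "C (n - 1) \<in> carrier_mat m m" "coprime (det (C (n - 1))) p" using C(1)[of "n - 1"] by (auto simp: P_def)
    show "mat_cong (p ^ n) (C (Suc n - 1)) (C (n - 1))" using C(2)[of "n - 1"] by (cases n) auto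
    show "mat_cong (p ^ n) ((C (n - 1))\<^sup>T * \<Theta> n * C (n - 1)) (\<Xi> n)"
      using C(1)[of "n - 1"] \<Theta>(1) \<Xi>(1) by (cases n) (auto simp: P_def intro!: mat_cong_one)
  qed
qed

section \<open>The ring of p-adic integers\<close>

locale odd_prime =
  fixes p :: nat
  assumes prime_p: "prime p" and odd_p: "odd p"
begin

abbreviation R where "R \<equiv> padic_int p"

lemma p_gt_0 [simp]: "0 < p" "0 < int p"
  using prime_p by (simp_all add: prime_gt_0_nat)

lemma prime_int_p: "prime (int p)" "odd (int p)"
  using prime_p odd_p by simp_all

lemma padic_mem:
  "x \<in> carrier R \<longleftrightarrow> (\<forall>n. x n \<in> {0..<int p ^ n}) \<and> (\<forall>n. [x (Suc n) = x n] (mod int p ^ n))"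
proof safe
  assume x: "x \<in> carrier R"
  show "x n \<in> {0..<int p ^ n}" for n using x by (auto simp: padic_int_def)
  show "[x (Suc n) = x n] (mod int p ^ n)" for n
  proof -
    have "x (Suc n) mod int p ^ n = x n" using x by (auto simp: padic_int_def)
    then show ?thesis by (metis cong_def mod_mod_trivial)
  qed
next
  assume r: "\<forall>n. x n \<in> {0..<int p ^ n}" and c: "\<forall>n. [x (Suc n) = x n] (mod int p ^ n)"
  have "[x (m + k) = x m] (mod int p ^ m)" for m k
  proof (induction k)
    case (Suc k)
    have "[x (Suc (m + k)) = x (m + k)] (mod int p ^ m)"
      using c cong_dvd_modulus le_imp_power_dvd[of m "m + k" "int p"] le_add1 by blast
    then show ?case using Suc cong_trans by auto
  qed simp
  then have "x n mod int p ^ m = x m" if "m \<le> n" for m n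
    using that r by (metis cong_def le_add_diff_inverse mod_pos_pos_trivial atLeastLessThan_iff)
  then show "x \<in> carrier R" using r by (auto simp: padic_int_def)
qed

lemma padic_mod [simp]: "x \<in> carrier R \<Longrightarrow> x n mod int p ^ n = x n"
  by (simp add: padic_mem)

lemma padic_cong_le: "x \<in> carrier R \<Longrightarrow> m \<le> n \<Longrightarrow> [x n = x m] (mod int p ^ m)"
  by (auto simp: padic_int_def cong_def)

definition of_seq :: "(nat \<Rightarrow> int) \<Rightarrow> padic" where
  "of_seq f = (\<lambda>n. f n mod int p ^ n)"

lemma of_seq_closed: "(\<And>n. [f (Suc n) = f n] (mod int p ^ n)) \<Longrightarrow> of_seq f \<in> carrier R"
  unfolding padic_mem of_seq_def
  by (auto simp: cong_def mod_mod_cancel)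

lemma padic_ops:
  "x \<otimes>\<^bsub>R\<^esub> y = of_seq (\<lambda>n. x n * y n)" "x \<oplus>\<^bsub>R\<^esub> y = of_seq (\<lambda>n. x n + y n)"
  "\<one>\<^bsub>R\<^esub> = of_seq (\<lambda>n. 1)" "\<zero>\<^bsub>R\<^esub> = of_seq (\<lambda>n. 0)"
  by (simp_all add: padic_int_def of_seq_def fun_eq_iff)

lemma padic_step: "x \<in> carrier R \<Longrightarrow> [x (Suc n) = x n] (mod int p ^ n)"
  by (simp add: padic_mem)

lemma padic_closed:
  "x \<in> carrier R \<Longrightarrow> y \<in> carrier R \<Longrightarrow> x \<otimes>\<^bsub>R\<^esub> y \<in> carrier R"
  "x \<in> carrier R \<Longrightarrow> y \<in> carrier R \<Longrightarrow> x \<oplus>\<^bsub>R\<^esub> y \<in> carrier R"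
  "\<one>\<^bsub>R\<^esub> \<in> carrier R" "\<zero>\<^bsub>R\<^esub> \<in> carrier R"
  unfolding padic_ops by (intro of_seq_closed cong_mult cong_add padic_step cong_refl; assumption)+

lemma of_seq_eqI: "(\<And>n. [f n = g n] (mod int p ^ n)) \<Longrightarrow> of_seq f = of_seq g"
  by (simp add: of_seq_def cong_def)

lemma of_seq_id: "x \<in> carrier R \<Longrightarrow> of_seq x = x"
  by (simp add: of_seq_def)

lemma of_seq_mult: "of_seq f \<otimes>\<^bsub>R\<^esub> of_seq g = of_seq (\<lambda>n. f n * g n)"
  and of_seq_add: "of_seq f \<oplus>\<^bsub>R\<^esub> of_seq g = of_seq (\<lambda>n. f n + g n)"
  by (simp_all add: padic_ops of_seq_def mod_simps)

lemma padic_cring: "cring R"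
proof -
  have ex: "\<exists>f. x = of_seq f" if "x \<in> carrier R" for x using of_seq_id[OF that] by metis
  show ?thesis
  proof (rule cringI)
    show "abelian_group R"
    proof (rule abelian_groupI)
      fix x assume x: "x \<in> carrier R"
      show "\<exists>y\<in>carrier R. y \<oplus>\<^bsub>R\<^esub> x = \<zero>\<^bsub>R\<^esub>"
      proof
        show "of_seq (\<lambda>n. - x n) \<in> carrier R"
          using x by (intro of_seq_closed) (metis cong_minus_minus_iff padic_step)
        show "of_seq (\<lambda>n. - x n) \<oplus>\<^bsub>R\<^esub> x = \<zero>\<^bsub>R\<^esub>"
          by (simp add: padic_ops of_seq_def mod_simps)
      qed
      show "\<zero>\<^bsub>R\<^esub> \<oplus>\<^bsub>R\<^esub> x = x"
        using ex[OF x] by (auto simp: padic_ops(4) of_seq_add)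
      fix y assume y: "y \<in> carrier R"
      show "x \<oplus>\<^bsub>R\<^esub> y = y \<oplus>\<^bsub>R\<^esub> x"
        using ex[OF x] ex[OF y] by (auto simp: of_seq_add add.commute)
      fix z assume z: "z \<in> carrier R"
      show "x \<oplus>\<^bsub>R\<^esub> y \<oplus>\<^bsub>R\<^esub> z = x \<oplus>\<^bsub>R\<^esub> (y \<oplus>\<^bsub>R\<^esub> z)"
        using ex[OF x] ex[OF y] ex[OF z] by (auto simp: of_seq_add add.assoc)
    qed (auto simp: padic_closed)
    show "comm_monoid R"
    proof (rule comm_monoidI)
      fix x assume x: "x \<in> carrier R"
      show "\<one>\<^bsub>R\<^esub> \<otimes>\<^bsub>R\<^esub> x = x"
        using ex[OF x] by (auto simp: padic_ops(3) of_seq_mult)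
      fix y assume y: "y \<in> carrier R"
      show "x \<otimes>\<^bsub>R\<^esub> y = y \<otimes>\<^bsub>R\<^esub> x"
        using ex[OF x] ex[OF y] by (auto simp: of_seq_mult mult.commute)
      fix z assume z: "z \<in> carrier R"
      show "x \<otimes>\<^bsub>R\<^esub> y \<otimes>\<^bsub>R\<^esub> z = x \<otimes>\<^bsub>R\<^esub> (y \<otimes>\<^bsub>R\<^esub> z)"
        using ex[OF x] ex[OF y] ex[OF z] by (auto simp: of_seq_mult mult.assoc)
    qed (auto simp: padic_closed)
    fix x y z assume xyz: "x \<in> carrier R" "y \<in> carrier R" "z \<in> carrier R"
    show "(x \<oplus>\<^bsub>R\<^esub> y) \<otimes>\<^bsub>R\<^esub> z = x \<otimes>\<^bsub>R\<^esub> z \<oplus>\<^bsub>R\<^esub> y \<otimes>\<^bsub>R\<^esub> z"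
      using ex[OF xyz(1)] ex[OF xyz(2)] ex[OF xyz(3)]
      by (auto simp: of_seq_mult of_seq_add distrib_right)
  qed
qed

sublocale R: cring R
  by (rule padic_cring)

lemma padic_add: "(x \<oplus>\<^bsub>R\<^esub> y) n = (x n + y n) mod int p ^ n"
  and padic_mult: "(x \<otimes>\<^bsub>R\<^esub> y) n = (x n * y n) mod int p ^ n"
  and padic_zero: "\<zero>\<^bsub>R\<^esub> n = 0"
  and padic_one: "\<one>\<^bsub>R\<^esub> n = 1 mod int p ^ n"
  by (simp_all add: padic_ops of_seq_def)

lemma padic_uminus: "x \<in> carrier R \<Longrightarrow> (\<ominus>\<^bsub>R\<^esub> x) n = (- x n) mod int p ^ n"
proof -
  assume x: "x \<in> carrier R"
  have "(x \<oplus>\<^bsub>R\<^esub> (\<ominus>\<^bsub>R\<^esub> x)) n = 0" using x by (simp add: R.r_neg padic_zero)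
  then have "int p ^ n dvd (\<ominus>\<^bsub>R\<^esub> x) n - (- x n)" by (simp add: padic_add dvd_eq_mod_eq_0 add.commute)
  then have "(\<ominus>\<^bsub>R\<^esub> x) n mod int p ^ n = (- x n) mod int p ^ n" by (simp add: mod_eq_dvd_iff)
  then show ?thesis using x by simp
qed

lemma padic_finsum:
  "finite A \<Longrightarrow> f \<in> A \<rightarrow> carrier R \<Longrightarrow> (finsum R f A) n = (\<Sum>i\<in>A. f i n) mod int p ^ n"
  by (induction A rule: finite_induct) (simp_all add: padic_zero padic_add mod_simps)

lemma padic_finprod:
  "finite A \<Longrightarrow> f \<in> A \<rightarrow> carrier R \<Longrightarrow> (finprod R f A) n = (\<Prod>i\<in>A. f i n) mod int p ^ n"
  by (induction A rule: finite_induct) (simp_all add: padic_one padic_mult mod_simps)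

lemma padic_coprime:
  assumes "x \<in> carrier R" "coprime (x 1) (int p)"
  shows "coprime (x n) (int p ^ n)"
proof (cases n)
  case (Suc k)
  have "[x 1 = x n] (mod int p)"
    using padic_cong_le[OF assms(1), of 1 n] Suc by (simp add: cong_sym_eq)
  then have "coprime (x n) (int p)" using assms(2) by (rule cong_imp_coprime)
  then show ?thesis by simp
qed simp

lemma padic_units: "x \<in> Units R \<longleftrightarrow> x \<in> carrier R \<and> coprime (x 1) (int p)"
proof safe
  assume x: "x \<in> Units R"
  then show "x \<in> carrier R" by blast
  have "x \<otimes>\<^bsub>R\<^esub> (inv\<^bsub>R\<^esub> x) = \<one>\<^bsub>R\<^esub>" using x by simp
  then have "(x \<otimes>\<^bsub>R\<^esub> (inv\<^bsub>R\<^esub> x)) 1 = \<one>\<^bsub>R\<^esub> 1" by (rule arg_cong)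
  then have "[x 1 * (inv\<^bsub>R\<^esub> x) 1 = 1] (mod int p)"
    unfolding padic_mult padic_one by (simp add: cong_def)
  then show "coprime (x 1) (int p)" unfolding coprime_iff_invertible_int by blast
next
  assume x: "x \<in> carrier R" "coprime (x 1) (int p)"
  have "\<exists>w. [x n * w = 1] (mod int p ^ n)" for n
    using padic_coprime[OF x] by (simp add: coprime_iff_invertible_int)
  then obtain w where w: "\<And>n. [x n * w n = 1] (mod int p ^ n)" by metis
  have "of_seq w \<in> carrier R"
  proof (rule of_seq_closed)
    fix n
    have "[x (Suc n) * w (Suc n) = 1] (mod int p ^ n)"
      using w[of "Suc n"] by (rule cong_dvd_modulus) simp
    moreover have "[x (Suc n) * w (Suc n) = x n * w (Suc n)] (mod int p ^ n)"
      using padic_step[OF x(1)] by (intro cong_mult) auto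
    ultimately have "[x n * w (Suc n) = x n * w n] (mod int p ^ n)"
      using w[of n] by (meson cong_sym cong_trans)
    then show "[w (Suc n) = w n] (mod int p ^ n)"
      using padic_coprime[OF x] by (simp add: cong_mult_lcancel)
  qed
  moreover have "x \<otimes>\<^bsub>R\<^esub> of_seq w = \<one>\<^bsub>R\<^esub>"
    using of_seq_mult[of x w] of_seq_eqI[of "\<lambda>n. x n * w n" "\<lambda>n. 1"] w of_seq_id[OF x(1)]
    by (simp add: padic_ops(3))
  ultimately show "x \<in> Units R" using x(1) R.m_comm[of x "of_seq w"] unfolding Units_def by auto
qed

lemma power_add_dvd_mult:
  assumes "prime (q :: int)" "q ^ (k + l) dvd a * b"
  shows "q ^ k dvd a \<or> q ^ l dvd b"
proof (cases "a = 0 \<or> b = 0")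
  case False
  have q: "\<not> is_unit q" "prime_elem q" using assms(1) by auto
  have "k + l \<le> multiplicity q (a * b)"
    using assms False q by (simp add: power_dvd_iff_le_multiplicity)
  also have "\<dots> = multiplicity q a + multiplicity q b"
    using False q by (simp add: prime_elem_multiplicity_mult_distrib)
  finally show ?thesis using False q by (auto simp: power_dvd_iff_le_multiplicity)
qed auto

lemma padic_integral:
  assumes x: "x \<in> carrier R" and y: "y \<in> carrier R" and xy: "x \<otimes>\<^bsub>R\<^esub> y = \<zero>\<^bsub>R\<^esub>"
  shows "x = \<zero>\<^bsub>R\<^esub> \<or> y = \<zero>\<^bsub>R\<^esub>"
proof (rule ccontr)
  assume "\<not> ?thesis"
  then obtain k l where kl: "x k \<noteq> 0" "y l \<noteq> 0" by (auto simp: fun_eq_iff padic_zero)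
  have nd: "\<not> int p ^ k dvd z n" if "z \<in> carrier R" "z k \<noteq> 0" "k \<le> n" for z k n
  proof
    assume "int p ^ k dvd z n"
    then have "int p ^ k dvd z k" using cong_dvd_iff[OF padic_cong_le[OF that(1,3)]] by simp
    then have "z k mod int p ^ k = 0" by simp
    then show False using that(1,2) by simp
  qed
  have "int p ^ (k + l) dvd x (k + l) * y (k + l)"
    using arg_cong[OF xy, of "\<lambda>z. z (k + l)"] by (simp add: padic_mult padic_zero dvd_eq_mod_eq_0)
  then have "int p ^ k dvd x (k + l) \<or> int p ^ l dvd y (k + l)"
    using power_add_dvd_mult[OF prime_int_p(1)] by blast
  then show False using nd[OF x kl(1)] nd[OF y kl(2)] by simp
qed

lemma one_neq_zero: "\<one>\<^bsub>R\<^esub> \<noteq> \<zero>\<^bsub>R\<^esub>"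
proof
  assume "\<one>\<^bsub>R\<^esub> = \<zero>\<^bsub>R\<^esub>"
  then have "\<one>\<^bsub>R\<^esub> 1 = \<zero>\<^bsub>R\<^esub> 1" by (rule fun_cong)
  then have "1 mod int p = 0" unfolding padic_one padic_zero by simp
  then have "int p dvd 1" by (simp only: dvd_eq_mod_eq_0)
  then show False using prime_int_p(1) not_prime_unit by blast
qed

definition of_integer :: "int \<Rightarrow> padic" where
  "of_integer a = of_seq (\<lambda>n. a)"

lemma of_integer_closed [simp]: "of_integer a \<in> carrier R"
  unfolding of_integer_def by (intro of_seq_closed) simp

definition pmat :: "nat \<Rightarrow> (nat \<Rightarrow> nat \<Rightarrow> padic) \<Rightarrow> bool" where
  "pmat m A \<longleftrightarrow> (\<forall>i\<in>{1..m}. \<forall>j\<in>{1..m}. A i j \<in> carrier R)"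

definition lev :: "nat \<Rightarrow> (nat \<Rightarrow> nat \<Rightarrow> padic) \<Rightarrow> nat \<Rightarrow> int mat" where
  "lev m A n = mat m m (\<lambda>(i, j). A (Suc i) (Suc j) n)"

lemma lev_carrier [simp]: "lev m A n \<in> carrier_mat m m"
  by (simp add: lev_def)

lemma lev_step: "pmat m A \<Longrightarrow> mat_cong (int p ^ n) (lev m A (Suc n)) (lev m A n)"
  by (rule mat_congI[of _ m m]) (auto simp: lev_def pmat_def padic_step)

lemma ring_det_level:
  assumes A: "pmat m A"
  shows "ring_det R m A n = det (lev m A n) mod int p ^ n"
proof -
  define B :: "int mat" where "B = dsum (1\<^sub>m 1) (lev m A n)"
  have B: "B \<in> carrier_mat (Suc m) (Suc m)"
    using dsum_carrier[of "1\<^sub>m 1" 1 "lev m A n" m] by (simp add: B_def)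
  have B_index: "B $$ (i, j) = A i j n" if "i \<in> {1..m}" "j \<in> {1..m}" for i j
    using that by (auto simp: B_def dsum_def lev_def)
  have B0: "B $$ (0, 0) = 1" "j \<in> {1..m} \<Longrightarrow> B $$ (0, j) = 0" for j
    by (auto simp: B_def dsum_def lev_def)
  have fin: "finite {\<pi>. \<pi> permutes {1..m}}" by (simp add: finite_permutations)
  have mem: "A i (\<pi> i) \<in> carrier R" if "\<pi> permutes {1..m}" "i \<in> {1..m}" for \<pi> i
    using A that permutes_in_image[OF that(1), of i] by (auto simp: pmat_def)
  have sgn: "(if evenperm \<pi> then \<one>\<^bsub>R\<^esub> else \<ominus>\<^bsub>R\<^esub> \<one>\<^bsub>R\<^esub>) n = sign \<pi> mod int p ^ n" for \<pi> :: "nat \<Rightarrow> nat"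
    by (simp add: sign_def padic_one padic_uminus mod_simps)
  have "ring_det R m A n = (\<Sum>\<pi> | \<pi> permutes {1..m}. sign \<pi> * (\<Prod>i\<in>{1..m}. A i (\<pi> i) n)) mod int p ^ n"
  proof -
    define T where "T \<pi> = (if evenperm \<pi> then \<one>\<^bsub>R\<^esub> else \<ominus>\<^bsub>R\<^esub> \<one>\<^bsub>R\<^esub>) \<otimes>\<^bsub>R\<^esub> (\<Otimes>\<^bsub>R\<^esub>i\<in>{1..m}. A i (\<pi> i))" for \<pi>
    have T: "T \<in> {\<pi>. \<pi> permutes {1..m}} \<rightarrow> carrier R"
      using mem unfolding T_def by (auto intro!: R.m_closed R.finprod_closed)
    have "T \<pi> n = (sign \<pi> * (\<Prod>i\<in>{1..m}. A i (\<pi> i) n)) mod int p ^ n" if "\<pi> permutes {1..m}" for \<pi>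
    proof -
      have "(\<Otimes>\<^bsub>R\<^esub>i\<in>{1..m}. A i (\<pi> i)) n = (\<Prod>i\<in>{1..m}. A i (\<pi> i) n) mod int p ^ n"
        using mem[OF that] by (intro padic_finprod) auto
      then show ?thesis unfolding T_def padic_mult sgn by (simp add: mod_simps)
    qed
    then have "(\<Sum>\<pi> | \<pi> permutes {1..m}. T \<pi> n) =
        (\<Sum>\<pi> | \<pi> permutes {1..m}. (sign \<pi> * (\<Prod>i\<in>{1..m}. A i (\<pi> i) n)) mod int p ^ n)"
      by (intro sum.cong) auto
    then show ?thesis
      using padic_finsum[OF fin T, of n] unfolding ring_det_def T_def by (simp add: mod_sum_eq)
  qed
  also have "(\<Sum>\<pi> | \<pi> permutes {1..m}. sign \<pi> * (\<Prod>i\<in>{1..m}. A i (\<pi> i) n)) = det B"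
  proof -
    have set0: "{0..<Suc m} = insert 0 {1..m}" by auto
    have "det B = (\<Sum>\<pi> | \<pi> permutes {0..<Suc m}. sign \<pi> * (\<Prod>i = 0..<Suc m. B $$ (i, \<pi> i)))"
      using det_def'[OF B] by simp
    also have "\<dots> = (\<Sum>\<pi> | \<pi> permutes {1..m}. sign \<pi> * (\<Prod>i = 0..<Suc m. B $$ (i, \<pi> i)))"
    proof (rule sum.mono_neutral_right)
      show "finite {\<pi>. \<pi> permutes {0..<Suc m}}" by (simp add: finite_permutations)
      show "{\<pi>. \<pi> permutes {1..m}} \<subseteq> {\<pi>. \<pi> permutes {0..<Suc m}}"
        by (auto intro: permutes_subset)
      show "\<forall>\<pi>\<in>{\<pi>. \<pi> permutes {0..<Suc m}} - {\<pi>. \<pi> permutes {1..m}}.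
        sign \<pi> * (\<Prod>i = 0..<Suc m. B $$ (i, \<pi> i)) = 0"
      proof
        fix \<pi> assume \<pi>: "\<pi> \<in> {\<pi>. \<pi> permutes {0..<Suc m}} - {\<pi>. \<pi> permutes {1..m}}"
        have "\<pi> 0 \<noteq> 0"
        proof
          assume "\<pi> 0 = 0"
          then have "\<pi> permutes {1..m}"
            using \<pi> permutes_superset[of \<pi> "{0..<Suc m}" "{1..m}"] set0 by auto
          then show False using \<pi> by simp
        qed
        moreover have "\<pi> 0 \<in> {0..<Suc m}" using \<pi> permutes_in_image[of \<pi> "{0..<Suc m}" 0] by simp
        ultimately have "B $$ (0, \<pi> 0) = 0" using B0(2) by auto
        then show "sign \<pi> * (\<Prod>i = 0..<Suc m. B $$ (i, \<pi> i)) = 0"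
          unfolding set0 by simp
      qed
    qed
    also have "\<dots> = (\<Sum>\<pi> | \<pi> permutes {1..m}. sign \<pi> * (\<Prod>i\<in>{1..m}. A i (\<pi> i) n))"
    proof (intro sum.cong refl arg_cong2[where f = "(*)"])
      fix \<pi> assume "\<pi> \<in> {\<pi>. \<pi> permutes {1..m}}"
      then have \<pi>: "\<pi> permutes {1..m}" by simp
      then have "\<pi> 0 = 0" by (simp add: permutes_not_in)
      moreover have "B $$ (i, \<pi> i) = A i (\<pi> i) n" if "i \<in> {1..m}" for i
        using that permutes_in_image[OF \<pi>, of i] B_index by blast
      ultimately show "(\<Prod>i = 0..<Suc m. B $$ (i, \<pi> i)) = (\<Prod>i\<in>{1..m}. A i (\<pi> i) n)"
        unfolding set0 using B0(1) by simp
    qed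
    finally show ?thesis by simp
  qed
  also have "det B = det (lev m A n)"
    unfolding B_def using det_dsum[of "1\<^sub>m 1" 1 "lev m A n" m] by simp
  finally show ?thesis .
qed

lemma ring_det_closed:
  assumes "pmat m A"
  shows "ring_det R m A \<in> carrier R"
proof -
  have "A i (\<pi> i) \<in> carrier R" if "\<pi> permutes {1..m}" "i \<in> {1..m}" for \<pi> i
    using assms that permutes_in_image[OF that(1), of i] by (auto simp: pmat_def)
  then show ?thesis
    unfolding ring_det_def by (intro R.finsum_closed Pi_I R.m_closed R.finprod_closed) auto
qed

lemma ring_det_cong_level: "pmat m A \<Longrightarrow> [ring_det R m A n = det (lev m A n)] (mod int p ^ n)"
  by (simp add: ring_det_level cong_def)

lemma unimodular_iff: "unimodular R m A \<longleftrightarrow> pmat m A \<and> coprime (det (lev m A 1)) (int p)"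
proof -
  have "coprime (det (lev m A 1) mod int p) (int p) \<longleftrightarrow> coprime (det (lev m A 1)) (int p)"
    by simp
  then show ?thesis
    unfolding unimodular_def pmat_def[symmetric] padic_units
    using ring_det_closed ring_det_level[of m A 1] by auto
qed

lemma unimodular_coprime_level:
  assumes "unimodular R m A"
  shows "coprime (det (lev m A n)) (int p ^ n)"
proof -
  have A: "pmat m A" "ring_det R m A \<in> Units R" using assms by (auto simp: unimodular_def pmat_def)
  have "coprime (ring_det R m A n) (int p ^ n)" using A padic_units padic_coprime by blast
  then have "coprime (det (lev m A n) mod int p ^ n) (int p ^ n)"
    unfolding ring_det_level[OF A(1)] .
  then show ?thesis by (metis coprime_mod_left_iff p_gt_0(2) zero_less_power less_irrefl)
qed

definition of_levels :: "(nat \<Rightarrow> int mat) \<Rightarrow> nat \<Rightarrow> nat \<Rightarrow> padic" where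
  "of_levels C i j = of_seq (\<lambda>n. C n $$ (i - 1, j - 1))"

lemma of_levels:
  assumes C: "\<And>n. C n \<in> carrier_mat m m" "\<And>n. mat_cong (int p ^ n) (C (Suc n)) (C n)"
  shows "pmat m (of_levels C)" "mat_cong (int p ^ n) (lev m (of_levels C) n) (C n)"
proof -
  show "pmat m (of_levels C)"
    unfolding pmat_def of_levels_def
    by (intro ballI of_seq_closed mat_cong_index[OF C(2) C(1)]) auto
  show "mat_cong (int p ^ n) (lev m (of_levels C) n) (C n)"
    by (rule mat_congI[OF lev_carrier C(1)]) (simp add: lev_def of_levels_def of_seq_def)
qed

end

section \<open>Algebras given by a p-adic matrix\<close>

definition ops_closed :: "('r, 's) ring_scheme \<Rightarrow> ('r, 'a, 'c) module_scheme \<Rightarrow> bool" where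
  "ops_closed R M \<longleftrightarrow>
    (\<forall>x\<in>carrier M. \<forall>y\<in>carrier M. x \<oplus>\<^bsub>M\<^esub> y \<in> carrier M \<and> x \<otimes>\<^bsub>M\<^esub> y \<in> carrier M) \<and>
    (\<forall>r\<in>carrier R. \<forall>x\<in>carrier M. r \<odot>\<^bsub>M\<^esub> x \<in> carrier M)"

lemma isomorphic_refl: "isomorphic R M M"
  unfolding isomorphic_def algebra_iso_def by (auto intro!: exI[of _ id])

lemma isomorphic_trans:
  assumes "isomorphic R M N" "isomorphic R N P"
  shows "isomorphic R M P"
proof -
  obtain g h where g: "g \<in> algebra_iso R M N" and h: "h \<in> algebra_iso R N P"
    using assms by (auto simp: isomorphic_def)
  have "g x \<in> carrier N" if "x \<in> carrier M" for x
    using g that by (auto simp: algebra_iso_def bij_betw_def)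
  then have "h \<circ> g \<in> algebra_iso R M P"
    using g h by (auto simp: algebra_iso_def intro: bij_betw_trans)
  then show ?thesis by (auto simp: isomorphic_def)
qed

lemma isomorphic_sym:
  assumes "isomorphic R M N" "ops_closed R M"
  shows "isomorphic R N M"
proof -
  obtain h where h: "h \<in> algebra_iso R M N" using assms by (auto simp: isomorphic_def)
  then have bij: "bij_betw h (carrier M) (carrier N)" by (simp add: algebra_iso_def)
  let ?g = "inv_into (carrier M) h"
  have g: "bij_betw ?g (carrier N) (carrier M)" using bij by (rule bij_betw_inv_into)
  have gh: "?g (h x) = x" if "x \<in> carrier M" for x using bij that by (simp add: bij_betw_def)
  have hg: "h (?g y) = y" "?g y \<in> carrier M" if "y \<in> carrier N" for y
    using bij g that by (auto simp: bij_betw_def f_inv_into_f)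
  have "?g \<in> algebra_iso R N M"
    unfolding algebra_iso_def
  proof (intro CollectI conjI ballI)
    fix x y assume xy: "x \<in> carrier N" "y \<in> carrier N"
    have "?g (h (?g x \<oplus>\<^bsub>M\<^esub> ?g y)) = ?g x \<oplus>\<^bsub>M\<^esub> ?g y" "?g (h (?g x \<otimes>\<^bsub>M\<^esub> ?g y)) = ?g x \<otimes>\<^bsub>M\<^esub> ?g y"
      using assms(2) hg xy gh by (auto simp: ops_closed_def)
    then show "?g (x \<oplus>\<^bsub>N\<^esub> y) = ?g x \<oplus>\<^bsub>M\<^esub> ?g y" "?g (x \<otimes>\<^bsub>N\<^esub> y) = ?g x \<otimes>\<^bsub>M\<^esub> ?g y"
      using h hg xy by (auto simp: algebra_iso_def)
  next
    fix r x assume rx: "r \<in> carrier R" "x \<in> carrier N"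
    have "?g (h (r \<odot>\<^bsub>M\<^esub> ?g x)) = r \<odot>\<^bsub>M\<^esub> ?g x"
      using assms(2) hg rx gh by (auto simp: ops_closed_def)
    then show "?g (r \<odot>\<^bsub>N\<^esub> x) = r \<odot>\<^bsub>M\<^esub> ?g x"
      using h hg rx by (auto simp: algebra_iso_def)
  qed (rule g)
  then show ?thesis by (auto simp: isomorphic_def)
qed

context odd_prime
begin

definition pform :: "nat \<Rightarrow> (nat \<Rightarrow> nat \<Rightarrow> padic) \<Rightarrow> (nat \<Rightarrow> padic) \<Rightarrow> (nat \<Rightarrow> padic) \<Rightarrow> padic" where
  "pform m \<Theta> x y = of_seq (\<lambda>n. \<Sum>i\<in>{1..m}. \<Sum>j\<in>{1..m}. \<Theta> i j n * x i n * y j n)"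

definition std_algebra :: "nat \<Rightarrow> nat \<Rightarrow> (nat \<Rightarrow> nat \<Rightarrow> padic) \<Rightarrow> (padic, nat \<Rightarrow> padic) module" where
  "std_algebra N m \<Theta> =
    \<lparr>carrier = {1..N} \<rightarrow>\<^sub>E carrier R,
     mult = (\<lambda>x y. \<lambda>k\<in>{1..N}. if k = N then pform m \<Theta> x y else \<zero>\<^bsub>R\<^esub>),
     one = (\<lambda>k\<in>{1..N}. \<zero>\<^bsub>R\<^esub>),
     zero = (\<lambda>k\<in>{1..N}. \<zero>\<^bsub>R\<^esub>),
     add = (\<lambda>x y. \<lambda>k\<in>{1..N}. x k \<oplus>\<^bsub>R\<^esub> y k),
     smult = (\<lambda>r x. \<lambda>k\<in>{1..N}. r \<otimes>\<^bsub>R\<^esub> x k)\<rparr>"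

lemma std_algebra_simps:
  "carrier (std_algebra N m \<Theta>) = {1..N} \<rightarrow>\<^sub>E carrier R"
  "x \<otimes>\<^bsub>std_algebra N m \<Theta>\<^esub> y = (\<lambda>k\<in>{1..N}. if k = N then pform m \<Theta> x y else \<zero>\<^bsub>R\<^esub>)"
  "\<zero>\<^bsub>std_algebra N m \<Theta>\<^esub> = (\<lambda>k\<in>{1..N}. \<zero>\<^bsub>R\<^esub>)"
  "x \<oplus>\<^bsub>std_algebra N m \<Theta>\<^esub> y = (\<lambda>k\<in>{1..N}. x k \<oplus>\<^bsub>R\<^esub> y k)"
  "r \<odot>\<^bsub>std_algebra N m \<Theta>\<^esub> x = (\<lambda>k\<in>{1..N}. r \<otimes>\<^bsub>R\<^esub> x k)"
  by (simp_all add: std_algebra_def)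

lemma pform_closed:
  assumes "pmat m \<Theta>" "\<And>i. i \<in> {1..m} \<Longrightarrow> x i \<in> carrier R" "\<And>i. i \<in> {1..m} \<Longrightarrow> y i \<in> carrier R"
  shows "pform m \<Theta> x y \<in> carrier R"
  unfolding pform_def using assms
  by (intro of_seq_closed cong_sum cong_mult padic_step) (auto simp: pmat_def)

lemma pform_cong:
  assumes "\<And>i j. i \<in> {1..m} \<Longrightarrow> j \<in> {1..m} \<Longrightarrow> \<Theta> i j = \<Theta>' i j"
    "\<And>i. i \<in> {1..m} \<Longrightarrow> x i = x' i" "\<And>i. i \<in> {1..m} \<Longrightarrow> y i = y' i"
  shows "pform m \<Theta> x y = pform m \<Theta>' x' y'"
  unfolding pform_def using assms by (intro arg_cong[where f = of_seq] ext sum.cong) auto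

lemma std_algebra_ops_closed:
  assumes "pmat m \<Theta>" "m \<le> N"
  shows "ops_closed R (std_algebra N m \<Theta>)"
proof -
  have V: "x i \<in> carrier R" if "x \<in> {1..N} \<rightarrow>\<^sub>E carrier R" "i \<in> {1..N}" for x and i :: nat
    using that by (rule PiE_mem)
  have "pform m \<Theta> x y \<in> carrier R" if "x \<in> {1..N} \<rightarrow>\<^sub>E carrier R" "y \<in> {1..N} \<rightarrow>\<^sub>E carrier R" for x y
    using that assms by (intro pform_closed V[of x] V[of y]) auto
  then show ?thesis
    unfolding ops_closed_def std_algebra_simps using V by (auto simp del: atLeastAtMost_iff)
qed

definition papply :: "nat \<Rightarrow> (nat \<Rightarrow> nat \<Rightarrow> padic) \<Rightarrow> (nat \<Rightarrow> padic) \<Rightarrow> nat \<Rightarrow> padic" where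
  "papply m C x i = of_seq (\<lambda>n. \<Sum>j\<in>{1..m}. C i j n * x j n)"

lemma papply_closed:
  assumes "pmat m C" "\<And>i. i \<in> {1..m} \<Longrightarrow> x i \<in> carrier R" "i \<in> {1..m}"
  shows "papply m C x i \<in> carrier R"
  unfolding papply_def using assms
  by (intro of_seq_closed cong_sum cong_mult padic_step) (auto simp: pmat_def)

lemma papply_add:
  "papply m C (\<lambda>k. x k \<oplus>\<^bsub>R\<^esub> y k) i = papply m C x i \<oplus>\<^bsub>R\<^esub> papply m C y i"
  unfolding papply_def of_seq_add
proof (rule of_seq_eqI)
  fix n
  have "[(\<Sum>j\<in>{1..m}. C i j n * (x j \<oplus>\<^bsub>R\<^esub> y j) n) = (\<Sum>j\<in>{1..m}. C i j n * (x j n + y j n))] (mod int p ^ n)"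
    by (intro cong_sum cong_mult) (auto simp: padic_add)
  then show "[(\<Sum>j\<in>{1..m}. C i j n * (x j \<oplus>\<^bsub>R\<^esub> y j) n) =
      (\<Sum>j\<in>{1..m}. C i j n * x j n) + (\<Sum>j\<in>{1..m}. C i j n * y j n)] (mod int p ^ n)"
    by (simp add: distrib_left sum.distrib)
qed

lemma papply_smult:
  assumes "r \<in> carrier R"
  shows "papply m C (\<lambda>k. r \<otimes>\<^bsub>R\<^esub> x k) i = r \<otimes>\<^bsub>R\<^esub> papply m C x i"
proof -
  have "r \<otimes>\<^bsub>R\<^esub> papply m C x i = of_seq (\<lambda>n. r n * (\<Sum>j\<in>{1..m}. C i j n * x j n))"
    unfolding papply_def using of_seq_mult[of r] of_seq_id[OF assms] by simp
  moreover have "papply m C (\<lambda>k. r \<otimes>\<^bsub>R\<^esub> x k) i = of_seq (\<lambda>n. r n * (\<Sum>j\<in>{1..m}. C i j n * x j n))"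
    unfolding papply_def
  proof (rule of_seq_eqI)
    fix n
    have "[(\<Sum>j\<in>{1..m}. C i j n * (r \<otimes>\<^bsub>R\<^esub> x j) n) = (\<Sum>j\<in>{1..m}. C i j n * (r n * x j n))] (mod int p ^ n)"
      by (intro cong_sum cong_mult) (auto simp: padic_mult)
    then show "[(\<Sum>j\<in>{1..m}. C i j n * (r \<otimes>\<^bsub>R\<^esub> x j) n) =
        r n * (\<Sum>j\<in>{1..m}. C i j n * x j n)] (mod int p ^ n)"
      by (simp add: sum_distrib_left mult.left_commute)
  qed
  ultimately show ?thesis by simp
qed

lemma papply_cong: "(\<And>j. j \<in> {1..m} \<Longrightarrow> x j = y j) \<Longrightarrow> papply m C x i = papply m C y i"
  unfolding papply_def by (intro arg_cong[where f = of_seq] ext sum.cong) auto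

definition pinverse :: "nat \<Rightarrow> (nat \<Rightarrow> nat \<Rightarrow> padic) \<Rightarrow> (nat \<Rightarrow> nat \<Rightarrow> padic) \<Rightarrow> bool" where
  "pinverse m C D \<longleftrightarrow> (\<forall>n. \<forall>i\<in>{1..m}. \<forall>k\<in>{1..m}.
    [(\<Sum>j\<in>{1..m}. C i j n * D j k n) = (if i = k then 1 else 0)] (mod int p ^ n))"

lemma papply_inverse:
  assumes CD: "pinverse m C D" and x: "\<And>i. i \<in> {1..m} \<Longrightarrow> x i \<in> carrier R" and i: "i \<in> {1..m}"
  shows "papply m C (papply m D x) i = x i"
proof -
  have "papply m C (papply m D x) i = of_seq (x i)"
    unfolding papply_def[of m C]
  proof (rule of_seq_eqI)
    fix n
    have "[(\<Sum>j\<in>{1..m}. C i j n * papply m D x j n) =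
        (\<Sum>j\<in>{1..m}. C i j n * (\<Sum>k\<in>{1..m}. D j k n * x k n))] (mod int p ^ n)"
      by (intro cong_sum cong_mult) (auto simp: papply_def of_seq_def)
    also have "(\<Sum>j\<in>{1..m}. C i j n * (\<Sum>k\<in>{1..m}. D j k n * x k n)) =
        (\<Sum>k\<in>{1..m}. (\<Sum>j\<in>{1..m}. C i j n * D j k n) * x k n)"
      unfolding sum_distrib_left sum_distrib_right by (subst sum.swap) (simp add: mult.assoc)
    also have "[\<dots> = (\<Sum>k\<in>{1..m}. (if i = k then 1 else 0) * x k n)] (mod int p ^ n)"
      using CD i by (intro cong_sum cong_mult) (auto simp: pinverse_def)
    also have "(\<Sum>k\<in>{1..m}. (if i = k then 1 else 0) * x k n) = x i n"
      using i by (simp add: if_distrib[of "\<lambda>c. c * _"] cong: if_cong)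
    finally show "[(\<Sum>j\<in>{1..m}. C i j n * papply m D x j n) = x i n] (mod int p ^ n)" .
  qed
  then show ?thesis using of_seq_id[OF x[OF i]] by simp
qed

definition pcongruent :: "nat \<Rightarrow> padic \<Rightarrow> (nat \<Rightarrow> nat \<Rightarrow> padic) \<Rightarrow> (nat \<Rightarrow> nat \<Rightarrow> padic) \<Rightarrow>
    (nat \<Rightarrow> nat \<Rightarrow> padic) \<Rightarrow> bool" where
  "pcongruent m u \<Theta> \<Xi> C \<longleftrightarrow> (\<forall>n. \<forall>k\<in>{1..m}. \<forall>l\<in>{1..m}.
    [(\<Sum>i\<in>{1..m}. \<Sum>j\<in>{1..m}. C i k n * \<Xi> i j n * C j l n) = u n * \<Theta> k l n] (mod int p ^ n))"

lemma pform_papply: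
  assumes C: "pcongruent m u \<Theta> \<Xi> C" and u: "u \<in> carrier R"
  shows "pform m \<Xi> (papply m C x) (papply m C y) = u \<otimes>\<^bsub>R\<^esub> pform m \<Theta> x y"
proof -
  have "u \<otimes>\<^bsub>R\<^esub> pform m \<Theta> x y = of_seq (\<lambda>n. u n * (\<Sum>i\<in>{1..m}. \<Sum>j\<in>{1..m}. \<Theta> i j n * x i n * y j n))"
    unfolding pform_def using of_seq_mult[of u] of_seq_id[OF u] by simp
  moreover have "pform m \<Xi> (papply m C x) (papply m C y) =
      of_seq (\<lambda>n. u n * (\<Sum>i\<in>{1..m}. \<Sum>j\<in>{1..m}. \<Theta> i j n * x i n * y j n))"
    unfolding pform_def
  proof (rule of_seq_eqI)
    fix n
    have "[(\<Sum>i\<in>{1..m}. \<Sum>j\<in>{1..m}. \<Xi> i j n * papply m C x i n * papply m C y j n) =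
      (\<Sum>i\<in>{1..m}. \<Sum>j\<in>{1..m}. \<Xi> i j n * (\<Sum>k\<in>{1..m}. C i k n * x k n) * (\<Sum>l\<in>{1..m}. C j l n * y l n))]
      (mod int p ^ n)"
      by (intro cong_sum cong_mult) (auto simp: papply_def of_seq_def)
    also have "(\<Sum>i\<in>{1..m}. \<Sum>j\<in>{1..m}. \<Xi> i j n * (\<Sum>k\<in>{1..m}. C i k n * x k n) * (\<Sum>l\<in>{1..m}. C j l n * y l n))
      = (\<Sum>i\<in>{1..m}. \<Sum>j\<in>{1..m}. \<Sum>k\<in>{1..m}. \<Sum>l\<in>{1..m}. C i k n * \<Xi> i j n * C j l n * x k n * y l n)"
      unfolding sum_distrib_left sum_distrib_right
      by (rule sum.cong[OF refl], rule sum.cong[OF refl], subst sum.swap,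
          rule sum.cong[OF refl], rule sum.cong[OF refl]) (simp add: mult_ac)
    also have "\<dots> = (\<Sum>k\<in>{1..m}. \<Sum>l\<in>{1..m}. \<Sum>i\<in>{1..m}. \<Sum>j\<in>{1..m}. C i k n * \<Xi> i j n * C j l n * x k n * y l n)"
    proof -
      have "(\<Sum>i\<in>{1..m}. \<Sum>j\<in>{1..m}. \<Sum>k\<in>{1..m}. \<Sum>l\<in>{1..m}. f i j k l) =
          (\<Sum>k\<in>{1..m}. \<Sum>l\<in>{1..m}. \<Sum>i\<in>{1..m}. \<Sum>j\<in>{1..m}. f i j k l)" for f :: "nat \<Rightarrow> nat \<Rightarrow> nat \<Rightarrow> nat \<Rightarrow> int"
      proof -
        have rot: "(\<Sum>i\<in>{1..m}. \<Sum>j\<in>{1..m}. \<Sum>k\<in>{1..m}. F i j k) =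
            (\<Sum>k\<in>{1..m}. \<Sum>i\<in>{1..m}. \<Sum>j\<in>{1..m}. F i j k)" for F :: "nat \<Rightarrow> nat \<Rightarrow> nat \<Rightarrow> int"
        proof -
          have "(\<Sum>i\<in>{1..m}. \<Sum>j\<in>{1..m}. \<Sum>k\<in>{1..m}. F i j k) =
              (\<Sum>i\<in>{1..m}. \<Sum>k\<in>{1..m}. \<Sum>j\<in>{1..m}. F i j k)"
            by (rule sum.cong[OF refl]) (rule sum.swap)
          also have "\<dots> = (\<Sum>k\<in>{1..m}. \<Sum>i\<in>{1..m}. \<Sum>j\<in>{1..m}. F i j k)" by (rule sum.swap)
          finally show ?thesis .
        qed
        show ?thesis
          by (subst rot, rule sum.cong[OF refl], rule rot)
      qed
      then show ?thesis .
    qed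
    also have "\<dots> = (\<Sum>k\<in>{1..m}. \<Sum>l\<in>{1..m}. (\<Sum>i\<in>{1..m}. \<Sum>j\<in>{1..m}. C i k n * \<Xi> i j n * C j l n) * x k n * y l n)"
      by (simp add: sum_distrib_right)
    also have "[\<dots> = (\<Sum>k\<in>{1..m}. \<Sum>l\<in>{1..m}. (u n * \<Theta> k l n) * x k n * y l n)] (mod int p ^ n)"
      using C by (intro cong_sum cong_mult) (auto simp: pcongruent_def)
    also have "(\<Sum>k\<in>{1..m}. \<Sum>l\<in>{1..m}. (u n * \<Theta> k l n) * x k n * y l n) =
        u n * (\<Sum>i\<in>{1..m}. \<Sum>j\<in>{1..m}. \<Theta> i j n * x i n * y j n)"
      by (simp add: sum_distrib_left mult.assoc)
    finally show "[(\<Sum>i\<in>{1..m}. \<Sum>j\<in>{1..m}. \<Xi> i j n * papply m C x i n * papply m C y j n) =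
        u n * (\<Sum>i\<in>{1..m}. \<Sum>j\<in>{1..m}. \<Theta> i j n * x i n * y j n)] (mod int p ^ n)" .
  qed
  ultimately show ?thesis by simp
qed

lemma std_algebra_isomorphicI:
  assumes m: "m < N" and C: "pmat m C" "pmat m D" "pinverse m C D" "pinverse m D C"
    and u: "u \<in> Units R" and cong: "pcongruent m u \<Theta> \<Xi> C"
  shows "isomorphic R (std_algebra N m \<Theta>) (std_algebra N m \<Xi>)"
proof -
  define h where "h C u x = (\<lambda>k\<in>{1..N}. if k \<le> m then papply m C x k else if k = N then u \<otimes>\<^bsub>R\<^esub> x k else x k)"
    for C u x
  let ?V = "{1..N} \<rightarrow>\<^sub>E carrier R"
  have le: "i \<in> {1..m} \<Longrightarrow> i \<in> {1..N}" for i using m by auto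
  have V: "x i \<in> carrier R" if "x \<in> ?V" "i \<in> {1..N}" for x i using that by (rule PiE_mem)
  have cl: "h C u x \<in> ?V" if "pmat m C" "u \<in> carrier R" "x \<in> ?V" for C u x
  proof -
    have V: "x i \<in> carrier R" if "i \<in> {1..N}" for i using \<open>x \<in> ?V\<close> that by (rule PiE_mem)
    then have "papply m C x i \<in> carrier R" if "i \<in> {1..m}" for i
      by (rule papply_closed[OF \<open>pmat m C\<close> _ that]) (erule le)
    then show ?thesis using V \<open>u \<in> carrier R\<close> unfolding h_def
      by (intro restrict_PiE_iff[THEN iffD2] ballI) simp
  qed
  have h: "h C u x k = papply m C x k" if "k \<in> {1..m}" for C u x k using that le[OF that] by (simp add: h_def)
  have hN: "h C u x N = u \<otimes>\<^bsub>R\<^esub> x N" for C u x using m by (simp add: h_def)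
  have hmid: "h C u x k = x k" if "k \<in> {1..N}" "k \<notin> {1..m}" "k \<noteq> N" for C u x k
    using that by (simp add: h_def)
  have hout: "h C u x k = undefined" if "k \<notin> {1..N}" for C u x k
    using that by (auto simp: h_def)
  have ext: "f = g" if "\<And>k. k \<in> {1..m} \<Longrightarrow> f k = g k" "f N = g N"
      "\<And>k. k \<in> {1..N} \<Longrightarrow> k \<notin> {1..m} \<Longrightarrow> k \<noteq> N \<Longrightarrow> f k = g k" "\<And>k. k \<notin> {1..N} \<Longrightarrow> f k = g k"
    for f g :: "nat \<Rightarrow> padic"
  proof
    fix k
    consider "k \<in> {1..m}" | "k = N" | "k \<in> {1..N}" "k \<notin> {1..m}" "k \<noteq> N" | "k \<notin> {1..N}"
      by blast
    then show "f k = g k"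
      by cases (simp_all only: that simp_thms)
  qed
  have NN: "N \<in> {1..N}" using m by simp
  have inv: "h C u (h D v x) = x" if "pinverse m C D" "u \<otimes>\<^bsub>R\<^esub> v = \<one>\<^bsub>R\<^esub>" "u \<in> carrier R" "v \<in> carrier R" "x
      \<in> ?V" for C D u v x
  proof (rule ext)
    have xV: "x i \<in> carrier R" if "i \<in> {1..N}" for i using \<open>x \<in> ?V\<close> that by (rule PiE_mem)
    show "h C u (h D v x) k = x k" if k: "k \<in> {1..m}" for k
    proof -
      have "papply m C (h D v x) k = papply m C (papply m D x) k"
        by (rule papply_cong) (rule h)
      then show ?thesis using papply_inverse[OF \<open>pinverse m C D\<close> xV[OF le] k] h[OF k] by simp
    qed
    show "h C u (h D v x) N = x N"
      using that(2-4) xV[OF NN] by (simp add: hN R.m_assoc[symmetric])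
    show "h C u (h D v x) k = x k" if "k \<in> {1..N}" "k \<notin> {1..m}" "k \<noteq> N" for k
      by (simp only: hmid[OF that])
    show "h C u (h D v x) k = x k" if "k \<notin> {1..N}" for k
      unfolding hout[OF that] PiE_arb[OF \<open>x \<in> ?V\<close> that] ..
  qed
  let ?v = "inv\<^bsub>R\<^esub> u"
  have uv: "u \<in> carrier R" "?v \<in> carrier R" "u \<otimes>\<^bsub>R\<^esub> ?v = \<one>\<^bsub>R\<^esub>" "?v \<otimes>\<^bsub>R\<^esub> u = \<one>\<^bsub>R\<^esub>"
    using u by auto
  have "bij_betw (h C u) ?V ?V"
  proof (rule bij_betwI)
    show "h C u \<in> ?V \<rightarrow> ?V" using cl[OF C(1) uv(1)] by blast
    show "h D ?v \<in> ?V \<rightarrow> ?V" using cl[OF C(2) uv(2)] by blast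
    show "h D ?v (h C u x) = x" if "x \<in> ?V" for x using inv[OF C(4) uv(4,2,1) that] .
    show "h C u (h D ?v x) = x" if "x \<in> ?V" for x using inv[OF C(3) uv(3,1,2) that] .
  qed
  moreover have "h C u (x \<oplus>\<^bsub>std_algebra N m \<Theta>\<^esub> y) = h C u x \<oplus>\<^bsub>std_algebra N m \<Xi>\<^esub> h C u y"
    if xy: "x \<in> ?V" "y \<in> ?V" for x y
  proof -
    have c: "(\<lambda>k\<in>{1..N}. x k \<oplus>\<^bsub>R\<^esub> y k) i = x i \<oplus>\<^bsub>R\<^esub> y i" if "i \<in> {1..N}" for i using that by simp
    have "papply m C (\<lambda>k\<in>{1..N}. x k \<oplus>\<^bsub>R\<^esub> y k) k = papply m C x k \<oplus>\<^bsub>R\<^esub> papply m C y k" for k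
      unfolding papply_add[symmetric] by (rule papply_cong) (rule c[OF le])
    note low = this
    show ?thesis
      unfolding std_algebra_simps
    proof (rule ext)
      show "h C u (\<lambda>k\<in>{1..N}. x k \<oplus>\<^bsub>R\<^esub> y k) k = (\<lambda>k\<in>{1..N}. h C u x k \<oplus>\<^bsub>R\<^esub> h C u y k) k"
        if k: "k \<in> {1..m}" for k
        unfolding restrict_apply'[OF le[OF k]] h[OF k] by (rule low)
      show "h C u (\<lambda>k\<in>{1..N}. x k \<oplus>\<^bsub>R\<^esub> y k) N = (\<lambda>k\<in>{1..N}. h C u x k \<oplus>\<^bsub>R\<^esub> h C u y k) N"
        unfolding restrict_apply'[OF NN] hN using V[OF xy(1) NN] V[OF xy(2) NN] uv(1) by (simp only: R.r_distr)
      show "h C u (\<lambda>k\<in>{1..N}. x k \<oplus>\<^bsub>R\<^esub> y k) k = (\<lambda>k\<in>{1..N}. h C u x k \<oplus>\<^bsub>R\<^esub> h C u y k) k"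
        if k: "k \<in> {1..N}" "k \<notin> {1..m}" "k \<noteq> N" for k
        unfolding hmid[OF k] restrict_apply'[OF k(1)] hmid[OF k] ..
      show "h C u (\<lambda>k\<in>{1..N}. x k \<oplus>\<^bsub>R\<^esub> y k) k = (\<lambda>k\<in>{1..N}. h C u x k \<oplus>\<^bsub>R\<^esub> h C u y k) k"
        if k: "k \<notin> {1..N}" for k
        by (simp only: hout[OF k] restrict_apply k if_False)
    qed
  qed
  moreover have "h C u (r \<odot>\<^bsub>std_algebra N m \<Theta>\<^esub> x) = r \<odot>\<^bsub>std_algebra N m \<Xi>\<^esub> h C u x"
    if rx: "x \<in> ?V" "r \<in> carrier R" for r x
  proof -
    have c: "(\<lambda>k\<in>{1..N}. r \<otimes>\<^bsub>R\<^esub> x k) i = r \<otimes>\<^bsub>R\<^esub> x i" if "i \<in> {1..N}" for i using that by simp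
    have "papply m C (\<lambda>k\<in>{1..N}. r \<otimes>\<^bsub>R\<^esub> x k) k = r \<otimes>\<^bsub>R\<^esub> papply m C x k" for k
      unfolding papply_smult[OF rx(2), symmetric] by (rule papply_cong) (rule c[OF le])
    note low = this
    show ?thesis
      unfolding std_algebra_simps
    proof (rule ext)
      show "h C u (\<lambda>k\<in>{1..N}. r \<otimes>\<^bsub>R\<^esub> x k) k = (\<lambda>k\<in>{1..N}. r \<otimes>\<^bsub>R\<^esub> h C u x k) k"
        if k: "k \<in> {1..m}" for k
        unfolding restrict_apply'[OF le[OF k]] h[OF k] by (rule low)
      show "h C u (\<lambda>k\<in>{1..N}. r \<otimes>\<^bsub>R\<^esub> x k) N = (\<lambda>k\<in>{1..N}. r \<otimes>\<^bsub>R\<^esub> h C u x k) N"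
        unfolding restrict_apply'[OF NN] hN using V[OF rx(1) NN] rx(2) uv(1) by (simp add: R.m_lcomm)
      show "h C u (\<lambda>k\<in>{1..N}. r \<otimes>\<^bsub>R\<^esub> x k) k = (\<lambda>k\<in>{1..N}. r \<otimes>\<^bsub>R\<^esub> h C u x k) k"
        if k: "k \<in> {1..N}" "k \<notin> {1..m}" "k \<noteq> N" for k
        unfolding hmid[OF k] restrict_apply'[OF k(1)] hmid[OF k] ..
      show "h C u (\<lambda>k\<in>{1..N}. r \<otimes>\<^bsub>R\<^esub> x k) k = (\<lambda>k\<in>{1..N}. r \<otimes>\<^bsub>R\<^esub> h C u x k) k"
        if k: "k \<notin> {1..N}" for k
        by (simp only: hout[OF k] restrict_apply k if_False)
    qed
  qed
  moreover have "h C u (x \<otimes>\<^bsub>std_algebra N m \<Theta>\<^esub> y) = h C u x \<otimes>\<^bsub>std_algebra N m \<Xi>\<^esub> h C u y" for x y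
  proof -
    have "pform m \<Xi> (h C u x) (h C u y) = pform m \<Xi> (papply m C x) (papply m C y)"
      by (rule pform_cong[OF refl h h])
    also have "\<dots> = u \<otimes>\<^bsub>R\<^esub> pform m \<Theta> x y" by (rule pform_papply[OF cong uv(1)])
    finally have f: "pform m \<Xi> (h C u x) (h C u y) = u \<otimes>\<^bsub>R\<^esub> pform m \<Theta> x y" .
    have ne: "k \<noteq> N" if "k \<in> {1..m}" for k using that m by auto
    let ?z = "\<lambda>k\<in>{1..N}. if k = N then pform m \<Theta> x y else \<zero>\<^bsub>R\<^esub>"
    have z: "?z i = \<zero>\<^bsub>R\<^esub>" if "i \<in> {1..m}" for i using le[OF that] ne[OF that] by simp
    have "papply m C ?z k = papply m C (\<lambda>j. \<zero>\<^bsub>R\<^esub>) k" for k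
      by (rule papply_cong) (rule z)
    moreover have "papply m C (\<lambda>j. \<zero>\<^bsub>R\<^esub>) k = \<zero>\<^bsub>R\<^esub>" for k
      by (simp add: papply_def padic_zero) (simp add: padic_ops(4))
    ultimately have low: "papply m C ?z k = \<zero>\<^bsub>R\<^esub>" for k by simp
    show ?thesis
      unfolding std_algebra_simps f
    proof (rule ext)
      let ?w = "\<lambda>k\<in>{1..N}. if k = N then u \<otimes>\<^bsub>R\<^esub> pform m \<Theta> x y else \<zero>\<^bsub>R\<^esub>"
      show "h C u ?z k = ?w k" if k: "k \<in> {1..m}" for k
        unfolding h[OF k] low using le[OF k] ne[OF k] by simp
      show "h C u ?z N = ?w N" unfolding hN restrict_apply'[OF NN] by simp
      show "h C u ?z k = ?w k" if k: "k \<in> {1..N}" "k \<notin> {1..m}" "k \<noteq> N" for k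
        unfolding hmid[OF k] restrict_apply'[OF k(1)] using k(3) by simp
      show "h C u ?z k = ?w k" if k: "k \<notin> {1..N}" for k
        by (simp only: hout[OF k] restrict_apply k if_False)
    qed
  qed
  ultimately have "h C u \<in> algebra_iso R (std_algebra N m \<Theta>) (std_algebra N m \<Xi>)"
    by (simp add: algebra_iso_def std_algebra_simps)
  then show ?thesis by (auto simp: isomorphic_def)
qed


lemma sum_atLeast1_shift: "(\<Sum>i\<in>{1..m}. f i) = (\<Sum>i = 0..<m. f (Suc i))"
  by (simp add: sum.atLeast1_atMost_eq atLeast0LessThan)

lemma lev_transpose:
  assumes "\<And>i j. i \<in> {1..m} \<Longrightarrow> j \<in> {1..m} \<Longrightarrow> \<Theta> i j = \<Theta> j i"
  shows "(lev m \<Theta> n)\<^sup>T = lev m \<Theta> n"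
proof (rule eq_matI)
  fix i j assume "i < dim_row (lev m \<Theta> n)" "j < dim_col (lev m \<Theta> n)"
  then have "i < m" "j < m" by (simp_all add: lev_def)
  then show "(lev m \<Theta> n)\<^sup>T $$ (i, j) = lev m \<Theta> n $$ (i, j)"
    using assms[of "Suc i" "Suc j"] by (simp add: lev_def)
qed (simp_all add: lev_def)

lemma lev_triple_index:
  assumes "k < m" "l < m"
  shows "((lev m C n)\<^sup>T * lev m \<Xi> n * lev m C n) $$ (k, l) =
    (\<Sum>i\<in>{1..m}. \<Sum>j\<in>{1..m}. C i (Suc k) n * \<Xi> i j n * C j (Suc l) n)"
proof -
  have "((lev m C n)\<^sup>T * lev m \<Xi> n * lev m C n) $$ (k, l) =
      (\<Sum>j = 0..<m. (\<Sum>i = 0..<m. C (Suc i) (Suc k) n * \<Xi> (Suc i) (Suc j) n) * C (Suc j) (Suc l) n)"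
    using assms by (simp add: lev_def scalar_prod_def)
  also have "\<dots> = (\<Sum>i = 0..<m. \<Sum>j = 0..<m. C (Suc i) (Suc k) n * \<Xi> (Suc i) (Suc j) n * C (Suc j) (Suc l) n)"
    unfolding sum_distrib_right by (rule sum.swap)
  finally show ?thesis unfolding sum_atLeast1_shift .
qed

lemma pcongruent_iff:
  "pcongruent m u \<Theta> \<Xi> C \<longleftrightarrow>
    (\<forall>n. mat_cong (int p ^ n) ((lev m C n)\<^sup>T * lev m \<Xi> n * lev m C n) (u n \<cdot>\<^sub>m lev m \<Theta> n))"
proof -
  have "(\<forall>k\<in>{1..m}. \<forall>l\<in>{1..m}.
      [(\<Sum>i\<in>{1..m}. \<Sum>j\<in>{1..m}. C i k n * \<Xi> i j n * C j l n) = u n * \<Theta> k l n] (mod int p ^ n)) \<longleftrightarrow>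
    mat_cong (int p ^ n) ((lev m C n)\<^sup>T * lev m \<Xi> n * lev m C n) (u n \<cdot>\<^sub>m lev m \<Theta> n)" (is "?L
        \<longleftrightarrow> ?R") for n
  proof
    assume L: ?L
    show ?R
    proof (rule mat_congI[of _ m m])
      fix k l assume kl: "k < m" "l < m"
      then show "[((lev m C n)\<^sup>T * lev m \<Xi> n * lev m C n) $$ (k, l)
          = (u n \<cdot>\<^sub>m lev m \<Theta> n) $$ (k, l)] (mod int p ^ n)"
        using L unfolding lev_triple_index[OF kl] by (simp add: lev_def)
    qed (auto simp: lev_def)
  next
    assume R: ?R
    show ?L
    proof (intro ballI)
      fix k l assume "k \<in> {1..m}" "l \<in> {1..m}"
      then obtain k' l' where kl: "k = Suc k'" "l = Suc l'" "k' < m" "l' < m"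
        by (cases k; cases l) auto
      have "(lev m C n)\<^sup>T * lev m \<Xi> n * lev m C n \<in> carrier_mat m m" by (auto simp: lev_def)
      from mat_cong_index[OF R this kl(3,4)]
      show "[(\<Sum>i\<in>{1..m}. \<Sum>j\<in>{1..m}. C i k n * \<Xi> i j n * C j l n) = u n * \<Theta> k l n] (mod int p ^ n)"
        unfolding lev_triple_index[OF kl(3,4)] kl using kl by (simp add: lev_def)
    qed
  qed
  then show ?thesis unfolding pcongruent_def by blast
qed

lemma padic_pow: "x \<in> carrier R \<Longrightarrow> (x [^]\<^bsub>R\<^esub> (k :: nat)) n = x n ^ k mod int p ^ n"
proof (induction k)
  case 0
  then show ?case by (simp add: padic_one)
next
  case (Suc k)
  have "(x [^]\<^bsub>R\<^esub> Suc k) n = ((x [^]\<^bsub>R\<^esub> k) n * x n) mod int p ^ n"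
    by (simp add: padic_mult)
  also have "\<dots> = (x n ^ k * x n) mod int p ^ n"
    unfolding Suc.IH[OF Suc.prems] by (rule mod_mult_left_eq)
  finally show ?case by (simp only: power_Suc2)
qed

lemma pcongruent_det:
  assumes "pmat m \<Theta>" "pmat m \<Xi>" "pmat m C" "u \<in> carrier R" "pcongruent m u \<Theta> \<Xi> C"
  shows "u [^]\<^bsub>R\<^esub> m \<otimes>\<^bsub>R\<^esub> ring_det R m \<Theta> = ring_det R m C \<otimes>\<^bsub>R\<^esub> ring_det R m C \<otimes>\<^bsub>R\<^esub> ring_det R m \<Xi>"
proof
  fix n
  have "[det ((lev m C n)\<^sup>T * lev m \<Xi> n * lev m C n) = det (u n \<cdot>\<^sub>m lev m \<Theta> n)] (mod int p ^ n)"
    using assms(5) mult_carrier_mat[OF mult_carrier_mat[OF transpose_carrier_mat[THEN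
        iffD2, OF lev_carrier] lev_carrier] lev_carrier]
    unfolding pcongruent_iff by (intro mat_cong_det[of _ _ _ m]) blast+
  then have "[det (lev m C n) * det (lev m C n) * det (lev m \<Xi> n) = u n ^ m * det (lev m \<Theta> n)] (mod int p ^ n)"
    using mult_carrier_mat[of "(lev m C n)\<^sup>T" m m "lev m \<Xi> n" m]
    by (simp add: det_mult[of _ m] det_transpose[of _ m] carrier_matD[OF lev_carrier] mult_ac)
  then show "(u [^]\<^bsub>R\<^esub> m \<otimes>\<^bsub>R\<^esub> ring_det R m \<Theta>) n =
      (ring_det R m C \<otimes>\<^bsub>R\<^esub> ring_det R m C \<otimes>\<^bsub>R\<^esub> ring_det R m \<Xi>) n"
    unfolding padic_mult padic_pow[OF assms(4)] ring_det_level[OF assms(1)] ring_det_level[OF assms(2)]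
      ring_det_level[OF assms(3)] mod_mult_eq cong_def by simp
qed

lemma pinverse_exists:
  assumes C: "pmat m C" "\<And>n. coprime (det (lev m C n)) (int p ^ n)"
  shows "\<exists>D. pmat m D \<and> pinverse m C D \<and> pinverse m D C"
proof -
  have "\<exists>w. [det (lev m C n) * w = 1] (mod int p ^ n)" for n
    using C(2) by (simp add: coprime_iff_invertible_int)
  then obtain w where w: "\<And>n. [det (lev m C n) * w n = 1] (mod int p ^ n)" by metis
  define E where "E n = w n \<cdot>\<^sub>m adj_mat (lev m C n)" for n
  note adj = adj_mat[OF lev_carrier, of m C]
  have E: "E n \<in> carrier_mat m m" for n using adj by (simp add: E_def)
  have one: "mat_cong (int p ^ n) ((det (lev m C n) * w n) \<cdot>\<^sub>m 1\<^sub>m m) (1\<^sub>m m)" for n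
    using w by (intro mat_congI[of _ m m]) (auto intro: cong_trans)
  have CE: "mat_cong (int p ^ n) (lev m C n * E n) (1\<^sub>m m)" for n
    using one[of n] adj by (simp add: E_def mult_smult_distrib[of _ m m _ m] smult_smult_mat mult.commute)
  have EC: "mat_cong (int p ^ n) (E n * lev m C n) (1\<^sub>m m)" for n
    using one[of n] adj by (simp add: E_def mult_smult_assoc_mat[of _ m m _ m] smult_smult_mat mult.commute)
  have step: "mat_cong (int p ^ n) (E (Suc n)) (E n)" for n
  proof -
    have "mat_cong (int p ^ n) (E (Suc n) * 1\<^sub>m m) (E (Suc n) * (lev m C n * E n))"
      using E by (intro mat_cong_mult mat_cong_refl mat_cong_sym[OF CE]) auto
    moreover have "mat_cong (int p ^ n) (E (Suc n) * lev m C n * E n) (E (Suc n) * lev m C (Suc n) * E n)"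
      using E[of n] E[of "Suc n"] lev_step[OF C(1)] lev_carrier[of m C n]
      by (intro mat_cong_mult mat_cong_refl mat_cong_sym[OF lev_step[OF C(1)]]) (auto simp: lev_def)
    moreover have "mat_cong (int p ^ n) (E (Suc n) * lev m C (Suc n) * E n) (1\<^sub>m m * E n)"
      using E[of n] mat_cong_dvd[OF EC[of "Suc n"], of "int p ^ n"]
      by (intro mat_cong_mult mat_cong_refl) (auto simp: lev_def)
    ultimately show ?thesis
      using E[of n] E[of "Suc n"] by (simp add: assoc_mult_mat[of _ m m _ m _ m]) (metis mat_cong_trans)
  qed
  note D = of_levels[of E m, OF E step]
  define D where "D = of_levels E"
  have idx: "(lev m P n * lev m Q n) $$ (i, k) = (\<Sum>j\<in>{1..m}. P (Suc i) j n * Q j (Suc k) n)"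
    if "i < m" "k < m" for P Q :: "nat \<Rightarrow> nat \<Rightarrow> padic" and i k n
    using that unfolding sum_atLeast1_shift by (simp add: lev_def scalar_prod_def)
  have pinv: "pinverse m P Q" if PQ: "\<And>n. mat_cong (int p ^ n) (lev m P n * lev m Q n) (1\<^sub>m m)"
      for P Q :: "nat \<Rightarrow> nat \<Rightarrow> padic"
    unfolding pinverse_def
  proof (intro allI ballI)
    fix n i k assume "i \<in> {1..m}" "k \<in> {1..m}"
    then obtain i' k' where ik: "i = Suc i'" "k = Suc k'" "i' < m" "k' < m"
      by (cases i; cases k) auto
    have "lev m P n * lev m Q n \<in> carrier_mat m m" by (auto simp: lev_def)
    from mat_cong_index[OF PQ this ik(3,4)]
    show "[(\<Sum>j\<in>{1..m}. P i j n * Q j k n) = (if i = k then 1 else 0)] (mod int p ^ n)"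
      unfolding idx[OF ik(3,4)] using ik by simp
  qed
  have "mat_cong (int p ^ n) (lev m C n * lev m D n) (1\<^sub>m m)" for n
    using mat_cong_mult[OF mat_cong_refl D(2), of "lev m C n" n] CE[of n] mat_cong_trans
    unfolding D_def by (auto simp: lev_def)
  moreover have "mat_cong (int p ^ n) (lev m D n * lev m C n) (1\<^sub>m m)" for n
    using mat_cong_mult[OF D(2) mat_cong_refl, of n "lev m C n"] EC[of n] mat_cong_trans
    unfolding D_def by (auto simp: lev_def)
  ultimately show ?thesis using D(1) pinv unfolding D_def by blast
qed

theorem std_algebra_isomorphic_if_det:
  assumes m: "0 < m" "m < N"
    and \<Theta>: "unimodular R m \<Theta>" "\<And>i j. i \<in> {1..m} \<Longrightarrow> j \<in> {1..m} \<Longrightarrow> \<Theta> i j = \<Theta> j i"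
    and \<Xi>: "unimodular R m \<Xi>" "\<And>i j. i \<in> {1..m} \<Longrightarrow> j \<in> {1..m} \<Longrightarrow> \<Xi> i j = \<Xi> j i"
    and u: "u \<in> Units R" and s: "coprime s (int p)"
    and det: "[u 1 ^ m * det (lev m \<Theta> 1) = s\<^sup>2 * det (lev m \<Xi> 1)] (mod int p)"
  shows "isomorphic R (std_algebra N m \<Theta>) (std_algebra N m \<Xi>)"
proof -
  have uR: "u \<in> carrier R" using u by blast
  obtain m' where m': "m = Suc m'" using m(1) gr0_conv_Suc by blast
  define \<Phi> where "\<Phi> i j = u \<otimes>\<^bsub>R\<^esub> \<Theta> i j" for i j
  have \<Phi>: "pmat m \<Phi>" "\<And>i j. i \<in> {1..m} \<Longrightarrow> j \<in> {1..m} \<Longrightarrow> \<Phi> i j = \<Phi> j i"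
    using \<Theta> uR by (auto simp: \<Phi>_def unimodular_iff pmat_def)
  have \<Phi>n: "mat_cong (int p ^ n) (lev m \<Phi> n) (u n \<cdot>\<^sub>m lev m \<Theta> n)" for n
    by (rule mat_congI[of _ m m]) (auto simp: lev_def \<Phi>_def padic_mult)
  have d\<Phi>: "[det (lev m \<Phi> 1) = u 1 ^ m * det (lev m \<Theta> 1)] (mod int p)"
    using mat_cong_det[OF \<Phi>n[of 1] lev_carrier] by (simp add: lev_def)
  have cu: "coprime (u 1) (int p)" using u padic_units by blast
  have pm: "pmat m \<Xi>" and c: "coprime (det (lev m \<Xi> 1)) (int p)" "coprime (det (lev m \<Theta> 1)) (int p)"
    using \<Theta>(1) \<Xi>(1) unimodular_iff by blast+
  then have c\<Phi>: "coprime (det (lev m \<Phi> 1)) (int p)"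
    using cu cong_imp_coprime[OF cong_sym[OF d\<Phi>]] by simp
  have eq: "form_equiv (int p) m (lev m \<Xi> 1) (lev m \<Phi> 1)"
    unfolding m'
  proof (rule form_equiv_if_det[OF prime_int_p _ _ _ _ _ _ s])
    show "[det (lev (Suc m') \<Phi> 1) = s\<^sup>2 * det (lev (Suc m') \<Xi> 1)] (mod int p)"
      using cong_trans[OF d\<Phi> det] unfolding m' .
  qed (use lev_transpose[OF \<Xi>(2)] lev_transpose[OF \<Phi>(2)] c c\<Phi> in \<open>auto simp: m'\<close>)
  obtain B where B: "\<And>n. B n \<in> carrier_mat m m" "\<And>n. coprime (det (B n)) (int p)"
    "\<And>n. mat_cong (int p ^ n) (B (Suc n)) (B n)"
    "\<And>n. mat_cong (int p ^ n) ((B n)\<^sup>T * lev m \<Xi> n * B n) (lev m \<Phi> n)"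
    using mat_hensel[OF prime_int_p lev_carrier lev_transpose[OF \<Xi>(2)] lev_step[OF pm]
        lev_carrier lev_transpose[OF \<Phi>(2)] lev_step[OF \<Phi>(1)] c(1) eq] by auto
  define C where "C = of_levels B"
  note C = of_levels[of B m, OF B(1,3), folded C_def]
  have "coprime (det (lev m C n)) (int p ^ n)" for n
    using mat_cong_det[OF C(2)[of n] lev_carrier] B(2)[of n] cong_imp_coprime[OF cong_sym]
      coprime_power_right_iff by blast
  then obtain D where D: "pmat m D" "pinverse m C D" "pinverse m D C"
    using pinverse_exists[OF C(1)] by blast
  have "pcongruent m u \<Theta> \<Xi> C"
    unfolding pcongruent_iff
  proof
    fix n
    have "mat_cong (int p ^ n) ((lev m C n)\<^sup>T * lev m \<Xi> n * lev m C n) ((B n)\<^sup>T * lev m \<Xi> n * B n)"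
      by (intro mat_cong_mult mat_cong_refl mat_cong_transpose C(2)) (auto simp: lev_def)
    then show "mat_cong (int p ^ n) ((lev m C n)\<^sup>T * lev m \<Xi> n * lev m C n) (u n \<cdot>\<^sub>m lev m \<Theta> n)"
      using B(4)[of n] \<Phi>n[of n] mat_cong_trans by blast
  qed
  then show ?thesis using std_algebra_isomorphicI[OF m(2) C(1) D u] by blast
qed

end

section \<open>Bases and quotients of modules\<close>

definition lincomb :: "('r, 'a, 'c) module_scheme \<Rightarrow> nat \<Rightarrow> (nat \<Rightarrow> 'a) \<Rightarrow> (nat \<Rightarrow> 'r) \<Rightarrow> 'a" where
  "lincomb M n b c = (\<Oplus>\<^bsub>M\<^esub>i\<in>{1..n}. c i \<odot>\<^bsub>M\<^esub> b i)"

context module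
begin

lemma lincomb_closed [simp, intro]:
  "b \<in> {1..n} \<rightarrow> carrier M \<Longrightarrow> c \<in> {1..n} \<rightarrow> carrier R \<Longrightarrow> lincomb M n b c \<in> carrier M"
  unfolding lincomb_def by (intro M.finsum_closed) (auto simp: Pi_def)

lemma lincomb_cong:
  assumes "\<And>i. i \<in> {1..n} \<Longrightarrow> b i = b' i" "\<And>i. i \<in> {1..n} \<Longrightarrow> c i = c' i"
    "b' \<in> {1..n} \<rightarrow> carrier M" "c' \<in> {1..n} \<rightarrow> carrier R"
  shows "lincomb M n b c = lincomb M n b' c'"
  unfolding lincomb_def using assms by (intro M.finsum_cong') (auto simp: Pi_def)

lemma lincomb_0 [simp]: "lincomb M 0 b c = \<zero>\<^bsub>M\<^esub>"
  by (simp add: lincomb_def)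

lemma lincomb_Suc:
  assumes "b \<in> {1..Suc n} \<rightarrow> carrier M" "c \<in> {1..Suc n} \<rightarrow> carrier R"
  shows "lincomb M (Suc n) b c = lincomb M n b c \<oplus>\<^bsub>M\<^esub> c (Suc n) \<odot>\<^bsub>M\<^esub> b (Suc n)"
proof -
  have "{1..Suc n} = insert (Suc n) {1..n}" by auto
  moreover have "(\<lambda>i. c i \<odot>\<^bsub>M\<^esub> b i) \<in> {1..n} \<rightarrow> carrier M" "c (Suc n) \<odot>\<^bsub>M\<^esub> b (Suc n) \<in> carrier M"
    using assms by (auto simp: Pi_def)
  ultimately show ?thesis
    unfolding lincomb_def using M.a_comm by (simp add: M.finsum_closed)
qed

lemma lincomb_add:
  assumes b: "b \<in> {1..n} \<rightarrow> carrier M" and c: "c \<in> {1..n} \<rightarrow> carrier R" "c' \<in> {1..n} \<rightarrow> carrier R"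
  shows "lincomb M n b (\<lambda>i. c i \<oplus> c' i) = lincomb M n b c \<oplus>\<^bsub>M\<^esub> lincomb M n b c'"
proof -
  have "lincomb M n b (\<lambda>i. c i \<oplus> c' i) = (\<Oplus>\<^bsub>M\<^esub>i\<in>{1..n}. c i \<odot>\<^bsub>M\<^esub> b i \<oplus>\<^bsub>M\<^esub> c' i \<odot>\<^bsub>M\<^esub> b i)"
    unfolding lincomb_def using b c by (intro M.finsum_cong') (auto simp: Pi_def smult_l_distr)
  also have "\<dots> = lincomb M n b c \<oplus>\<^bsub>M\<^esub> lincomb M n b c'"
    unfolding lincomb_def using b c by (intro M.finsum_addf) (auto simp: Pi_def)
  finally show ?thesis .
qed

lemma lincomb_add_vec:
  assumes "b \<in> {1..n} \<rightarrow> carrier M" "b' \<in> {1..n} \<rightarrow> carrier M" "c \<in> {1..n} \<rightarrow> carrier R"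
  shows "lincomb M n (\<lambda>i. b i \<oplus>\<^bsub>M\<^esub> b' i) c = lincomb M n b c \<oplus>\<^bsub>M\<^esub> lincomb M n b' c"
proof -
  have "lincomb M n (\<lambda>i. b i \<oplus>\<^bsub>M\<^esub> b' i) c = (\<Oplus>\<^bsub>M\<^esub>i\<in>{1..n}. c i \<odot>\<^bsub>M\<^esub> b i \<oplus>\<^bsub>M\<^esub> c i \<odot>\<^bsub>M\<^esub> b' i)"
    unfolding lincomb_def using assms by (intro M.finsum_cong') (auto simp: Pi_def smult_r_distr)
  also have "\<dots> = lincomb M n b c \<oplus>\<^bsub>M\<^esub> lincomb M n b' c"
    unfolding lincomb_def using assms by (intro M.finsum_addf) (auto simp: Pi_def)
  finally show ?thesis .
qed

lemma lincomb_smult: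
  assumes b: "b \<in> {1..n} \<rightarrow> carrier M" and c: "c \<in> {1..n} \<rightarrow> carrier R" and r: "r \<in> carrier R"
  shows "lincomb M n b (\<lambda>i. r \<otimes> c i) = r \<odot>\<^bsub>M\<^esub> lincomb M n b c"
proof -
  have "r \<odot>\<^bsub>M\<^esub> lincomb M n b c = (\<Oplus>\<^bsub>M\<^esub>i\<in>{1..n}. r \<odot>\<^bsub>M\<^esub> (c i \<odot>\<^bsub>M\<^esub> b i))"
    unfolding lincomb_def using b c r by (intro finsum_smult_ldistr) (auto simp: Pi_def)
  also have "\<dots> = lincomb M n b (\<lambda>i. r \<otimes> c i)"
    unfolding lincomb_def using b c r by (intro M.finsum_cong') (auto simp: Pi_def smult_assoc1)
  finally show ?thesis by simp
qed

lemma lincomb_delta: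
  assumes "b \<in> {1..n} \<rightarrow> carrier M" "k \<in> {1..n}" "r \<in> carrier R"
  shows "lincomb M n b (\<lambda>i. if i = k then r else \<zero>) = r \<odot>\<^bsub>M\<^esub> b k"
proof -
  have "lincomb M n b (\<lambda>i. if i = k then r else \<zero>) = (\<Oplus>\<^bsub>M\<^esub>i\<in>{1..n}. if k = i then r \<odot>\<^bsub>M\<^esub> b i else \<zero>\<^bsub>M\<^esub>)"
    unfolding lincomb_def using assms by (intro M.finsum_cong') (auto simp: Pi_def)
  also have "\<dots> = r \<odot>\<^bsub>M\<^esub> b k"
    using assms by (intro M.finsum_singleton) (auto simp: Pi_def)
  finally show ?thesis .
qed

lemma lincomb_zero:
  "b \<in> {1..n} \<rightarrow> carrier M \<Longrightarrow> lincomb M n b (\<lambda>i. \<zero>) = \<zero>\<^bsub>M\<^esub>"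
  using lincomb_smult[of b n "\<lambda>i. \<zero>" "\<zero>"] by (simp add: Pi_def lincomb_closed)

lemma minus_eq_zero_iff: "x \<in> carrier M \<Longrightarrow> y \<in> carrier M \<Longrightarrow> x \<ominus>\<^bsub>M\<^esub> y = \<zero>\<^bsub>M\<^esub> \<longleftrightarrow> x = y"
  by (metis M.minus_eq M.minus_equality M.minus_minus M.r_neg M.a_inv_closed)

lemma lincomb_minus:
  assumes b: "b \<in> {1..n} \<rightarrow> carrier M" and c: "c \<in> {1..n} \<rightarrow> carrier R" "c' \<in> {1..n} \<rightarrow> carrier R"
  shows "lincomb M n b (\<lambda>i. c i \<ominus> c' i) = lincomb M n b c \<ominus>\<^bsub>M\<^esub> lincomb M n b c'"
proof -
  have "lincomb M n b (\<lambda>i. c i \<ominus> c' i) = lincomb M n b (\<lambda>i. c i \<oplus> \<ominus> \<one> \<otimes> c' i)"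
    using b c by (intro lincomb_cong) (auto simp: Pi_def R.minus_eq R.l_minus)
  also have "\<dots> = lincomb M n b c \<oplus>\<^bsub>M\<^esub> (\<ominus> \<one>) \<odot>\<^bsub>M\<^esub> lincomb M n b c'"
    using b c by (subst lincomb_add) (auto simp: Pi_def lincomb_smult)
  also have "\<dots> = lincomb M n b c \<ominus>\<^bsub>M\<^esub> lincomb M n b c'"
    using b c by (simp add: smult_l_minus M.minus_eq lincomb_closed)
  finally show ?thesis .
qed

lemma is_basisI:
  assumes b: "b \<in> {1..n} \<rightarrow> carrier M"
    and span: "\<And>x. x \<in> carrier M \<Longrightarrow> \<exists>c\<in>{1..n} \<rightarrow> carrier R. x = lincomb M n b c"
    and indep: "\<And>c i. c \<in> {1..n} \<rightarrow> carrier R \<Longrightarrow> lincomb M n b c = \<zero>\<^bsub>M\<^esub> \<Longrightarrow> i \<in> {1..n} \<Longrightarrow> c i = \<zero>"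
  shows "is_basis R M n b"
  unfolding is_basis_def lincomb_def[symmetric]
proof (intro conjI ballI b)
  fix x assume x: "x \<in> carrier M"
  obtain c where c: "c \<in> {1..n} \<rightarrow> carrier R" "x = lincomb M n b c" using span[OF x] by blast
  show "\<exists>!c. c \<in> {1..n} \<rightarrow>\<^sub>E carrier R \<and> x = lincomb M n b c"
  proof (rule ex1I)
    show "restrict c {1..n} \<in> {1..n} \<rightarrow>\<^sub>E carrier R \<and> x = lincomb M n b (restrict c {1..n})"
      using c b by (auto simp: Pi_def intro!: lincomb_cong)
    fix c' assume c': "c' \<in> {1..n} \<rightarrow>\<^sub>E carrier R \<and> x = lincomb M n b c'"
    then have c'R: "c' \<in> {1..n} \<rightarrow> carrier R" by blast
    have "lincomb M n b (\<lambda>i. c' i \<ominus> c i) = x \<ominus>\<^bsub>M\<^esub> x"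
      using lincomb_minus[OF b c'R c(1)] c(2) c' by simp
    then have z: "lincomb M n b (\<lambda>i. c' i \<ominus> c i) = \<zero>\<^bsub>M\<^esub>" using x by (simp add: minus_eq_zero_iff)
    have "c' i = c i" if "i \<in> {1..n}" for i
    proof -
      have "c' i \<ominus> c i = \<zero>" using c(1) c'R by (intro indep[OF _ z that]) (auto simp: Pi_def)
      then show ?thesis using c(1) c'R that by (simp add: Pi_def R.r_right_minus_eq)
    qed
    then show "c' = restrict c {1..n}" using c' by (auto simp: fun_eq_iff restrict_def PiE_def extensional_def)
  qed
qed

lemma is_basis_closed: "is_basis R M n b \<Longrightarrow> b \<in> {1..n} \<rightarrow> carrier M"
  by (simp add: is_basis_def)

lemma is_basis_span: "is_basis R M n b \<Longrightarrow> x \<in> carrier M \<Longrightarrow> \<exists>c\<in>{1..n} \<rightarrow>\<^sub>E carrier R. x = lincomb M n b c"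
  unfolding is_basis_def lincomb_def by blast

lemma is_basis_unique:
  assumes B: "is_basis R M n b" and c: "c \<in> {1..n} \<rightarrow> carrier R" "c' \<in> {1..n} \<rightarrow> carrier R"
    and eq: "lincomb M n b c = lincomb M n b c'" and i: "i \<in> {1..n}"
  shows "c i = c' i"
proof -
  have b: "b \<in> {1..n} \<rightarrow> carrier M" using B by (rule is_basis_closed)
  have "restrict c {1..n} = restrict c' {1..n}"
  proof -
    have "\<exists>!c''. c'' \<in> {1..n} \<rightarrow>\<^sub>E carrier R \<and> lincomb M n b c = lincomb M n b c''"
      using B lincomb_closed[OF b c(1)] unfolding is_basis_def lincomb_def[symmetric] by blast
    moreover have "restrict c {1..n} \<in> {1..n} \<rightarrow>\<^sub>E carrier R" "restrict c' {1..n}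
        \<in> {1..n} \<rightarrow>\<^sub>E carrier R"
      using c by auto
    moreover have "lincomb M n b (restrict c {1..n}) = lincomb M n b c"
      "lincomb M n b (restrict c' {1..n}) = lincomb M n b c'"
      using b c by (auto intro!: lincomb_cong)
    ultimately show ?thesis using eq by metis
  qed
  then show ?thesis using i by (metis restrict_apply')
qed

lemma is_basis_indep:
  assumes "is_basis R M n b" "c \<in> {1..n} \<rightarrow> carrier R" "lincomb M n b c = \<zero>\<^bsub>M\<^esub>" "i \<in> {1..n}"
  shows "c i = \<zero>"
  using is_basis_unique[OF assms(1,2), of "\<lambda>i. \<zero>" i] assms lincomb_zero[OF is_basis_closed[OF assms(1)]]
  by (simp add: Pi_def)

lemma lincomb_permute:
  assumes "\<pi> permutes {1..n}" "b \<in> {1..n} \<rightarrow> carrier M" "c \<in> {1..n} \<rightarrow> carrier R"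
  shows "lincomb M n (b \<circ> \<pi>) (c \<circ> \<pi>) = lincomb M n b c"
proof -
  have "lincomb M n b c = (\<Oplus>\<^bsub>M\<^esub>i\<in>\<pi> ` {1..n}. c i \<odot>\<^bsub>M\<^esub> b i)"
    unfolding permutes_image[OF assms(1)] lincomb_def ..
  also have "\<dots> = (\<Oplus>\<^bsub>M\<^esub>i\<in>{1..n}. c (\<pi> i) \<odot>\<^bsub>M\<^esub> b (\<pi> i))"
    using assms permutes_image[OF assms(1)] permutes_inj_on[OF assms(1)]
    by (intro M.finsum_reindex) (auto simp: Pi_def)
  finally show ?thesis by (simp add: lincomb_def)
qed

lemma is_basis_permute:
  assumes B: "is_basis R M n b" and \<pi>: "\<pi> permutes {1..n}"
  shows "is_basis R M n (b \<circ> \<pi>)"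
proof (rule is_basisI)
  note b = is_basis_closed[OF B]
  have \<pi>i: "\<pi> i \<in> {1..n}" if "i \<in> {1..n}" for i using permutes_in_image[OF \<pi>] that by blast
  show "b \<circ> \<pi> \<in> {1..n} \<rightarrow> carrier M" using b \<pi>i by (auto simp: Pi_def)
  show "\<exists>c\<in>{1..n} \<rightarrow> carrier R. x = lincomb M n (b \<circ> \<pi>) c" if x: "x \<in> carrier M" for x
  proof -
    obtain c where c: "c \<in> {1..n} \<rightarrow>\<^sub>E carrier R" "x = lincomb M n b c" using is_basis_span[OF B x] by blast
    then have "c \<circ> \<pi> \<in> {1..n} \<rightarrow> carrier R" using \<pi>i by auto
    moreover have "lincomb M n (b \<circ> \<pi>) (c \<circ> \<pi>) = x"
      using c lincomb_permute[OF \<pi> b, of c] by blast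
    ultimately show ?thesis by blast
  qed
  show "c i = \<zero>" if c: "c \<in> {1..n} \<rightarrow> carrier R" "lincomb M n (b \<circ> \<pi>) c = \<zero>\<^bsub>M\<^esub>" "i \<in> {1..n}" for c i
  proof -
    have inv: "inv_into UNIV \<pi> j \<in> {1..n}" if "j \<in> {1..n}" for j
      using permutes_in_image[OF permutes_inv[OF \<pi>]] that by blast
    then have c': "c \<circ> inv_into UNIV \<pi> \<in> {1..n} \<rightarrow> carrier R" using c(1) by (auto simp: Pi_def)
    have "c \<circ> inv_into UNIV \<pi> \<circ> \<pi> = c" using permutes_inv_o(2)[OF \<pi>] by (simp add: o_assoc[symmetric])
    then have "lincomb M n b (c \<circ> inv_into UNIV \<pi>) = \<zero>\<^bsub>M\<^esub>"
      using lincomb_permute[OF \<pi> b c'] c(2) by simp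
    then have "(c \<circ> inv_into UNIV \<pi>) (\<pi> i) = \<zero>" using is_basis_indep[OF B c'] \<pi>i[OF c(3)] by blast
    then show ?thesis using permutes_inverses(2)[OF \<pi>] by simp
  qed
qed

lemma is_basis_exchange_last:
  assumes B: "is_basis R M (Suc n) b" and \<kappa>: "\<kappa> \<in> {1..Suc n} \<rightarrow> carrier R" "\<kappa> (Suc n) \<in> Units R"
  shows "is_basis R M (Suc n) (b(Suc n := lincomb M (Suc n) b \<kappa>))"
proof -
  note b = is_basis_closed[OF B]
  define g where "g = lincomb M (Suc n) b \<kappa>"
  define b' where "b' = b(Suc n := g)"
  define T where "T c i = (if i = Suc n then c (Suc n) \<otimes> \<kappa> (Suc n) else c i \<oplus> c (Suc n) \<otimes> \<kappa> i)" for c i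
  have g: "g \<in> carrier M" using b \<kappa> by (simp add: g_def)
  have b': "b' \<in> {1..Suc n} \<rightarrow> carrier M" using b g by (auto simp: b'_def)
  have n: "b \<in> {1..n} \<rightarrow> carrier M" "\<kappa> \<in> {1..n} \<rightarrow> carrier R" "b (Suc n) \<in> carrier M" "\<kappa> (Suc n) \<in> carrier R"
    using b \<kappa> by (auto simp: Pi_def)
  have T: "lincomb M (Suc n) b' c = lincomb M (Suc n) b (T c)" "T c \<in> {1..Suc n} \<rightarrow> carrier R"
    if c: "c \<in> {1..Suc n} \<rightarrow> carrier R" for c
  proof -
    have cn: "c \<in> {1..n} \<rightarrow> carrier R" "c (Suc n) \<in> carrier R" using c by (auto simp: Pi_def)
    show TR: "T c \<in> {1..Suc n} \<rightarrow> carrier R" using cn n \<kappa>(1) c by (auto simp: T_def Pi_def)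
    have "lincomb M (Suc n) b' c = lincomb M n b' c \<oplus>\<^bsub>M\<^esub> c (Suc n) \<odot>\<^bsub>M\<^esub> g"
      using lincomb_Suc[OF b' c] by (simp add: b'_def)
    also have "lincomb M n b' c = lincomb M n b c"
      using n cn by (intro lincomb_cong) (auto simp: b'_def)
    also have "c (Suc n) \<odot>\<^bsub>M\<^esub> g =
        lincomb M n b (\<lambda>i. c (Suc n) \<otimes> \<kappa> i) \<oplus>\<^bsub>M\<^esub> (c (Suc n) \<otimes> \<kappa> (Suc n)) \<odot>\<^bsub>M\<^esub> b (Suc n)"
      unfolding g_def lincomb_Suc[OF b \<kappa>(1)] using n cn
      by (simp add: lincomb_smult smult_r_distr smult_assoc1)
    also have "lincomb M n b c \<oplus>\<^bsub>M\<^esub> \<dots> =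
        (lincomb M n b c \<oplus>\<^bsub>M\<^esub> lincomb M n b (\<lambda>i. c (Suc n) \<otimes> \<kappa> i)) \<oplus>\<^bsub>M\<^esub> (c (Suc n) \<otimes> \<kappa> (Suc n)) \<odot>\<^bsub>M\<^esub> b (Suc n)"
      using n cn by (intro M.a_assoc[symmetric] lincomb_closed) (auto simp: Pi_def)
    also have "lincomb M n b c \<oplus>\<^bsub>M\<^esub> lincomb M n b (\<lambda>i. c (Suc n) \<otimes> \<kappa> i) = lincomb M n b (\<lambda>i. c i \<oplus> c (Suc n) \<otimes> \<kappa> i)"
      using n cn by (intro lincomb_add[symmetric]) (auto simp: Pi_def)
    also have "\<dots> = lincomb M n b (T c)"
      using n TR by (intro lincomb_cong) (auto simp: T_def Pi_def)
    also have "lincomb M n b (T c) \<oplus>\<^bsub>M\<^esub> (c (Suc n) \<otimes> \<kappa> (Suc n)) \<odot>\<^bsub>M\<^esub> b (Suc n) = lincomb M (Suc n) b (T c)"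
      using lincomb_Suc[OF b TR] by (simp add: T_def)
    finally show "lincomb M (Suc n) b' c = lincomb M (Suc n) b (T c)" .
  qed
  have "is_basis R M (Suc n) b'"
  proof (rule is_basisI[OF b'])
    fix x assume x: "x \<in> carrier M"
    obtain a where a: "a \<in> {1..Suc n} \<rightarrow>\<^sub>E carrier R" "x = lincomb M (Suc n) b a"
        using is_basis_span[OF B x] by blast
    have an: "a i \<in> carrier R" if "i \<in> {1..Suc n}" for i using a that by auto
    define t where "t = a (Suc n) \<otimes> inv \<kappa> (Suc n)"
    define c where "c i = (if i = Suc n then t else a i \<ominus> t \<otimes> \<kappa> i)" for i
    have t: "t \<in> carrier R" "t \<otimes> \<kappa> (Suc n) = a (Suc n)"
      using an[of "Suc n"] \<kappa>(2) by (auto simp: t_def R.m_assoc R.Units_closed)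
    have c: "c \<in> {1..Suc n} \<rightarrow> carrier R" using an t \<kappa>(1) by (auto simp: c_def Pi_def)
    have "T c i = a i" if "i \<in> {1..Suc n}" for i
    proof (cases "i = Suc n")
      case False
      then show ?thesis
        using an[OF that] t \<kappa>(1) that by (simp add: T_def c_def R.minus_eq R.a_assoc R.l_neg Pi_def)
    qed (simp add: T_def c_def t)
    then have "lincomb M (Suc n) b (T c) = x"
      unfolding a(2) using b an by (intro lincomb_cong) auto
    then show "\<exists>c\<in>{1..Suc n} \<rightarrow> carrier R. x = lincomb M (Suc n) b' c" using T(1)[OF c] c by metis
  next
    fix c i assume c: "c \<in> {1..Suc n} \<rightarrow> carrier R" and z: "lincomb M (Suc n) b' c = \<zero>\<^bsub>M\<^esub>" and i: "i \<in> {1..Suc n}"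
    have T0: "T c j = \<zero>" if "j \<in> {1..Suc n}" for j
      using is_basis_indep[OF B T(2)[OF c] _ that] T(1)[OF c] z by simp
    have "c (Suc n) \<otimes> \<kappa> (Suc n) = \<zero>" using T0[of "Suc n"] by (simp add: T_def)
    moreover have cN: "c (Suc n) \<in> carrier R" using c by auto
    ultimately have c0: "c (Suc n) = \<zero>"
      using \<kappa>(2) by (metis R.Units_r_inv R.m_assoc R.r_one R.l_null R.Units_closed R.Units_inv_closed)
    show "c i = \<zero>"
    proof (cases "i = Suc n")
      case False
      then show ?thesis using T0[OF i] c0 c i \<kappa>(1) by (simp add: T_def Pi_def)
    qed (simp add: c0)
  qed
  then show ?thesis by (simp add: b'_def g_def)
qed

lemma append_funcset:
  fixes m d :: nat
  assumes "f \<in> {1..m} \<rightarrow> V" "b \<in> {1..d} \<rightarrow> V"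
  shows "(\<lambda>i. if i \<le> m then f i else b (i - m)) \<in> {1..m + d} \<rightarrow> V"
proof
  fix i assume i: "i \<in> {1..m + d}"
  show "(if i \<le> m then f i else b (i - m)) \<in> V"
  proof (cases "i \<le> m")
    case True
    then show ?thesis using i funcset_mem[OF assms(1), of i] by simp
  next
    case False
    have "1 \<le> i - m \<and> i - m \<le> d" using i False unfolding atLeastAtMost_iff by arith
    then have "i - m \<in> {1..d}" by simp
    then show ?thesis using False funcset_mem[OF assms(2)] by simp
  qed
qed

lemma lincomb_append:
  assumes "f \<in> {1..m} \<rightarrow> carrier M" "b \<in> {1..d} \<rightarrow> carrier M" "c \<in> {1..m + d} \<rightarrow> carrier R"
  shows "lincomb M (m + d) (\<lambda>i. if i \<le> m then f i else b (i - m)) c =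
    lincomb M m f c \<oplus>\<^bsub>M\<^esub> lincomb M d b (\<lambda>j. c (m + j))"
  using assms
proof (induction d)
  case 0
  have "lincomb M m (\<lambda>i. if i \<le> m then f i else b (i - m)) c = lincomb M m f c"
    using 0 by (intro lincomb_cong) auto
  then show ?case using 0 by simp
next
  case (Suc d)
  let ?F = "\<lambda>i. if i \<le> m then f i else b (i - m)"
  have b: "b \<in> {1..d} \<rightarrow> carrier M" "b (Suc d) \<in> carrier M" and c: "c
      \<in> {1..m + d} \<rightarrow> carrier R" "c (Suc (m + d)) \<in> carrier R"
    "c \<in> {1..m} \<rightarrow> carrier R" "(\<lambda>j. c (m + j)) \<in> {1..d} \<rightarrow> carrier R"
    using Suc.prems by (auto simp: Pi_def)
  have F: "?F \<in> {1..Suc (m + d)} \<rightarrow> carrier M" using append_funcset[OF Suc.prems(1,2)] by simp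
  have "lincomb M (Suc (m + d)) ?F c = lincomb M (m + d) ?F c \<oplus>\<^bsub>M\<^esub> c (Suc (m + d)) \<odot>\<^bsub>M\<^esub> b (Suc d)"
    using lincomb_Suc[OF F, of c] Suc.prems by simp
  also have "\<dots> = (lincomb M m f c \<oplus>\<^bsub>M\<^esub> lincomb M d b (\<lambda>j. c (m + j))) \<oplus>\<^bsub>M\<^esub> c (Suc (m + d)) \<odot>\<^bsub>M\<^esub> b (Suc d)"
    using Suc.IH[OF Suc.prems(1) b(1) c(1)] by simp
  also have "\<dots> = lincomb M m f c \<oplus>\<^bsub>M\<^esub> (lincomb M d b (\<lambda>j. c (m + j)) \<oplus>\<^bsub>M\<^esub> c (m + Suc d) \<odot>\<^bsub>M\<^esub> b (Suc d))"
    using Suc.prems(1) b c by (simp add: M.a_assoc lincomb_closed)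
  also have "lincomb M d b (\<lambda>j. c (m + j)) \<oplus>\<^bsub>M\<^esub> c (m + Suc d) \<odot>\<^bsub>M\<^esub> b (Suc d) = lincomb M (Suc d) b (\<lambda>j. c (m + j))"
    using Suc.prems by (intro lincomb_Suc[symmetric]) (auto simp: Pi_def)
  finally show ?case by simp
qed

lemma submodule_finsum:
  assumes A: "submodule A R M" and "finite I" "f \<in> I \<rightarrow> A"
  shows "finsum (M\<lparr>carrier := A\<rparr>) f I = finsum M f I"
proof -
  interpret A: module R "M\<lparr>carrier := A\<rparr>" by (rule submodule.submodule_is_module[OF A module_axioms])
  have sub: "A \<subseteq> carrier M" by (rule submoduleE(1)[OF A])
  show ?thesis
    using assms(2,3)
  proof (induction I rule: finite_induct)
    case (insert x F)
    have "f \<in> F \<rightarrow> carrier M" "f x \<in> carrier M" "f \<in> F \<rightarrow> A" "f x \<in> A" using insert.prems sub by auto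
    then show ?case using insert by simp
  qed (use A.M.finsum_empty in simp)
qed

lemma submodule_lincomb:
  assumes A: "submodule A R M" and b: "b \<in> {1..d} \<rightarrow> A" and c: "c \<in> {1..d} \<rightarrow> carrier R"
  shows "lincomb (M\<lparr>carrier := A\<rparr>) d b c = lincomb M d b c" "lincomb M d b c \<in> A"
proof -
  interpret A: module R "M\<lparr>carrier := A\<rparr>" by (rule submodule.submodule_is_module[OF A module_axioms])
  show eq: "lincomb (M\<lparr>carrier := A\<rparr>) d b c = lincomb M d b c"
    using submodule_finsum[OF A, of "{1..d}" "\<lambda>i. c i \<odot>\<^bsub>M\<^esub> b i"] b c submoduleE(4)[OF A]
    by (simp add: lincomb_def Pi_def)
  show "lincomb M d b c \<in> A"
    using A.lincomb_closed[of b d c] b c unfolding eq by simp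
qed

lemma is_basis_append:
  assumes A: "submodule A R M" and B: "is_basis R (M\<lparr>carrier := A\<rparr>) d b"
    and f: "f \<in> {1..m} \<rightarrow> carrier M"
    and span: "\<And>x. x \<in> carrier M \<Longrightarrow> \<exists>c\<in>{1..m} \<rightarrow> carrier R. x \<ominus>\<^bsub>M\<^esub> lincomb M m f c \<in> A"
    and indep: "\<And>c i. c \<in> {1..m} \<rightarrow> carrier R \<Longrightarrow> lincomb M m f c \<in> A \<Longrightarrow> i \<in> {1..m} \<Longrightarrow> c i = \<zero>"
  shows "is_basis R M (m + d) (\<lambda>i. if i \<le> m then f i else b (i - m))"
proof -
  let ?F = "\<lambda>i. if i \<le> m then f i else b (i - m)"
  interpret A: module R "M\<lparr>carrier := A\<rparr>" by (rule submodule.submodule_is_module[OF A module_axioms])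
  have sub: "A \<subseteq> carrier M" by (rule submoduleE(1)[OF A])
  have bA: "b \<in> {1..d} \<rightarrow> A" using A.is_basis_closed[OF B] by simp
  then have b: "b \<in> {1..d} \<rightarrow> carrier M" using sub by auto
  show ?thesis
  proof (rule is_basisI)
    show "?F \<in> {1..m + d} \<rightarrow> carrier M" by (rule append_funcset[OF f b])
    fix x assume x: "x \<in> carrier M"
    obtain c where c: "c \<in> {1..m} \<rightarrow> carrier R" "x \<ominus>\<^bsub>M\<^esub> lincomb M m f c \<in> A" using span[OF x] by blast
    obtain a where a: "a \<in> {1..d} \<rightarrow>\<^sub>E carrier R" "x \<ominus>\<^bsub>M\<^esub> lincomb M m f c = lincomb (M\<lparr>carrier := A\<rparr>) d b a"
      using A.is_basis_span[OF B, of "x \<ominus>\<^bsub>M\<^esub> lincomb M m f c"] c by auto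
    have aR: "a \<in> {1..d} \<rightarrow> carrier R" using a by blast
    define e where "e i = (if i \<le> m then c i else a (i - m))" for i
    have e: "e \<in> {1..m + d} \<rightarrow> carrier R" unfolding e_def by (rule append_funcset[OF c(1) aR])
    have "lincomb M m f e = lincomb M m f c" using f c by (intro lincomb_cong) (auto simp: e_def)
    moreover have "lincomb M d b (\<lambda>j. e (m + j)) = lincomb M d b a"
      using b aR by (intro lincomb_cong) (auto simp: e_def)
    ultimately have "lincomb M (m + d) ?F e = lincomb M m f c \<oplus>\<^bsub>M\<^esub> (x \<ominus>\<^bsub>M\<^esub> lincomb M m f c)"
      using lincomb_append[OF f b e] a(2) submodule_lincomb(1)[OF A bA aR] by simp
    also have "\<dots> = x"
    proof -
      have "lincomb M m f c \<in> carrier M" using f c by blast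
      then show ?thesis using x by (metis M.a_comm M.a_inv_closed M.minus_closed M.minus_eq M.a_assoc
          M.l_neg M.r_zero)
    qed
    finally show "\<exists>c\<in>{1..m + d} \<rightarrow> carrier R. x = lincomb M (m + d) ?F c" using e by metis
  next
    fix c i assume c: "c \<in> {1..m + d} \<rightarrow> carrier R" and z: "lincomb M (m + d) ?F c = \<zero>\<^bsub>M\<^esub>" and i: "i \<in> {1..m + d}"
    have cm: "c \<in> {1..m} \<rightarrow> carrier R" and cd: "(\<lambda>j. c (m + j)) \<in> {1..d} \<rightarrow> carrier R"
      using c by (auto simp: Pi_def)
    define y where "y = lincomb M d b (\<lambda>j. c (m + j))"
    have y: "y \<in> A" using submodule_lincomb(2)[OF A bA cd] by (simp add: y_def)
    have sum: "lincomb M m f c \<oplus>\<^bsub>M\<^esub> y = \<zero>\<^bsub>M\<^esub>" using lincomb_append[OF f b c] z by (simp add: y_def)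
    then have "lincomb M m f c = \<ominus>\<^bsub>M\<^esub> y"
      using M.minus_equality[OF sum] lincomb_closed[OF f cm] y sub by auto
    then have "lincomb M m f c \<in> A" using submoduleE(3)[OF A y] by simp
    then have c0: "c j = \<zero>" if "j \<in> {1..m}" for j using indep[OF cm _ that] by blast
    have "lincomb M m f c = lincomb M m f (\<lambda>i. \<zero>)" using f c0 by (intro lincomb_cong) auto
    then have "y = \<zero>\<^bsub>M\<^esub>" using sum y sub f by (auto simp: lincomb_zero)
    then have "lincomb (M\<lparr>carrier := A\<rparr>) d b (\<lambda>j. c (m + j)) = \<zero>\<^bsub>M\<lparr>carrier := A\<rparr>\<^esub>"
      using submodule_lincomb(1)[OF A bA cd] by (simp add: y_def)
    then have d0: "c (m + j) = \<zero>" if "j \<in> {1..d}" for j using A.is_basis_indep[OF B cd _ that] by blast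
    show "c i = \<zero>"
    proof (cases "i \<le> m")
      case True
      then show ?thesis using c0 i by simp
    next
      case False
      then have "i - m \<in> {1..d}" "m + (i - m) = i" using i unfolding atLeastAtMost_iff by arith+
      then show ?thesis using d0[of "i - m"] by simp
    qed
  qed
qed


lemma submodule_abelian_subgroup:
  assumes "submodule H R M"
  shows "abelian_subgroup H M"
  by (rule abelian_subgroupI3[OF additive_subgroupI[OF submodule.axioms(1)[OF assms]] M.abelian_group_axioms])

lemma coset_eq_iff:
  assumes H: "submodule H R M" and x: "x \<in> carrier M" and y: "y \<in> carrier M"
  shows "H +>\<^bsub>M\<^esub> x = H +>\<^bsub>M\<^esub> y \<longleftrightarrow> x \<ominus>\<^bsub>M\<^esub> y \<in> H"
proof -
  interpret H: abelian_subgroup H M by (rule submodule_abelian_subgroup[OF H])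
  have "H +>\<^bsub>M\<^esub> x = H +>\<^bsub>M\<^esub> y \<longleftrightarrow> x \<in> H +>\<^bsub>M\<^esub> y"
  proof
    assume "H +>\<^bsub>M\<^esub> x = H +>\<^bsub>M\<^esub> y"
    then show "x \<in> H +>\<^bsub>M\<^esub> y" by (intro H.a_repr_independenceD[OF x]) simp
  next
    assume "x \<in> H +>\<^bsub>M\<^esub> y"
    then show "H +>\<^bsub>M\<^esub> x = H +>\<^bsub>M\<^esub> y" using H.a_repr_independence'[OF _ y] by simp
  qed
  also have "\<dots> \<longleftrightarrow> x \<oplus>\<^bsub>M\<^esub> \<ominus>\<^bsub>M\<^esub> y \<in> H" by (rule H.a_rcos_module[OF y x])
  finally show ?thesis by (simp add: M.minus_eq)
qed

lemma mem_cosetE: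
  assumes "y \<in> H +>\<^bsub>M\<^esub> x"
  obtains h where "h \<in> H" "y = h \<oplus>\<^bsub>M\<^esub> x"
  using assms unfolding a_r_coset_def' by blast

lemma mem_coset_self:
  assumes "submodule H R M" "x \<in> carrier M"
  shows "x \<in> H +>\<^bsub>M\<^esub> x"
  by (rule abelian_subgroup.a_rcos_self[OF submodule_abelian_subgroup[OF assms(1)] assms(2)])

lemma coset_zero: "submodule H R M \<Longrightarrow> H +>\<^bsub>M\<^esub> \<zero>\<^bsub>M\<^esub> = H"
  by (rule M.a_coset_add_zero[OF submoduleE(1)])

lemma quotient_carrier: "carrier (quotient_algebra M H) = (\<lambda>x. H +>\<^bsub>M\<^esub> x) ` carrier M"
  by (auto simp: quotient_algebra_def A_RCOSETS_def')

lemma quotient_zero: "\<zero>\<^bsub>quotient_algebra M H\<^esub> = H"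
  by (simp add: quotient_algebra_def)

lemma quotient_add:
  assumes "submodule H R M" "x \<in> carrier M" "y \<in> carrier M"
  shows "(H +>\<^bsub>M\<^esub> x) \<oplus>\<^bsub>quotient_algebra M H\<^esub> (H +>\<^bsub>M\<^esub> y) = H +>\<^bsub>M\<^esub> (x \<oplus>\<^bsub>M\<^esub> y)"
  using abelian_subgroup.a_rcos_sum[OF submodule_abelian_subgroup[OF assms(1)] assms(2,3)]
  by (simp add: quotient_algebra_def)

lemma quotient_smult:
  assumes H: "submodule H R M" and r: "r \<in> carrier R" and x: "x \<in> carrier M"
  shows "r \<odot>\<^bsub>quotient_algebra M H\<^esub> (H +>\<^bsub>M\<^esub> x) = H +>\<^bsub>M\<^esub> (r \<odot>\<^bsub>M\<^esub> x)"
proof -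
  have "H +>\<^bsub>M\<^esub> (r \<odot>\<^bsub>M\<^esub> y) = H +>\<^bsub>M\<^esub> (r \<odot>\<^bsub>M\<^esub> x)" if yx: "y \<in> H +>\<^bsub>M\<^esub> x" for y
  proof -
    obtain h where h: "h \<in> H" "y = h \<oplus>\<^bsub>M\<^esub> x" using yx by (rule mem_cosetE)
    have hM: "h \<in> carrier M" "r \<odot>\<^bsub>M\<^esub> h \<in> H" using h(1) submoduleE(1,4)[OF H] r by auto
    have "r \<odot>\<^bsub>M\<^esub> y \<ominus>\<^bsub>M\<^esub> r \<odot>\<^bsub>M\<^esub> x = r \<odot>\<^bsub>M\<^esub> h"
      using h hM r x by (simp add: smult_r_distr M.minus_eq M.a_assoc M.r_neg)
    then show ?thesis using coset_eq_iff[OF H] h hM r x by simp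
  qed
  then have "(\<Union>y\<in>H +>\<^bsub>M\<^esub> x. H +>\<^bsub>M\<^esub> (r \<odot>\<^bsub>M\<^esub> y)) = H +>\<^bsub>M\<^esub> (r \<odot>\<^bsub>M\<^esub> x)"
    by (rule UN_constant_eq[OF mem_coset_self[OF H x] ballI])
  then show ?thesis by (simp add: quotient_algebra_def)
qed

lemma quotient_abelian_group:
  assumes H: "submodule H R M"
  shows "abelian_group (quotient_algebra M H)"
proof (rule abelian_groupI; (unfold quotient_carrier)?)
  let ?Q = "quotient_algebra M H" and ?C = "(\<lambda>x. H +>\<^bsub>M\<^esub> x) ` carrier M"
  note add = quotient_add[OF H]
  have zero: "\<zero>\<^bsub>?Q\<^esub> = H +>\<^bsub>M\<^esub> \<zero>\<^bsub>M\<^esub>" by (simp add: quotient_zero coset_zero[OF H])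
  show "\<zero>\<^bsub>?Q\<^esub> \<in> ?C" unfolding zero by blast
  fix S assume S: "S \<in> ?C"
  then obtain x where x: "x \<in> carrier M" "S = H +>\<^bsub>M\<^esub> x" by blast
  show "\<zero>\<^bsub>?Q\<^esub> \<oplus>\<^bsub>?Q\<^esub> S = S" unfolding zero x(2) using x(1) by (simp add: add)
  show "\<exists>T\<in>?C. T \<oplus>\<^bsub>?Q\<^esub> S = \<zero>\<^bsub>?Q\<^esub>"
    unfolding zero x(2) using x(1) by (intro bexI[of _ "H +>\<^bsub>M\<^esub> (\<ominus>\<^bsub>M\<^esub> x)"]) (auto simp: add M.l_neg)
  fix T assume T: "T \<in> ?C"
  then obtain y where y: "y \<in> carrier M" "T = H +>\<^bsub>M\<^esub> y" by blast
  show "S \<oplus>\<^bsub>?Q\<^esub> T \<in> ?C" unfolding x(2) y(2) add[OF x(1) y(1)] using x y by blast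
  show "S \<oplus>\<^bsub>?Q\<^esub> T = T \<oplus>\<^bsub>?Q\<^esub> S"
    unfolding x(2) y(2) using x(1) y(1) by (simp add: add M.a_comm)
  fix U assume U: "U \<in> ?C"
  then obtain z where z: "z \<in> carrier M" "U = H +>\<^bsub>M\<^esub> z" by blast
  show "S \<oplus>\<^bsub>?Q\<^esub> T \<oplus>\<^bsub>?Q\<^esub> U = S \<oplus>\<^bsub>?Q\<^esub> (T \<oplus>\<^bsub>?Q\<^esub> U)"
    unfolding x(2) y(2) z(2) using x(1) y(1) z(1) by (simp add: add M.a_assoc)
qed

lemma quotient_lincomb:
  assumes H: "submodule H R M" and f: "f \<in> {1..n} \<rightarrow> carrier M" and c: "c \<in> {1..n} \<rightarrow> carrier R"
    and e: "\<And>i. i \<in> {1..n} \<Longrightarrow> e i = H +>\<^bsub>M\<^esub> f i"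
  shows "lincomb (quotient_algebra M H) n e c = H +>\<^bsub>M\<^esub> lincomb M n f c"
proof -
  let ?Q = "quotient_algebra M H"
  interpret Q: abelian_group ?Q by (rule quotient_abelian_group[OF H])
  have fin: "(\<Oplus>\<^bsub>?Q\<^esub>i\<in>I. H +>\<^bsub>M\<^esub> g i) = H +>\<^bsub>M\<^esub> finsum M g I" if "finite I" "g \<in> I \<rightarrow> carrier M" for g and I :: "nat set"
    using that
  proof (induction I rule: finite_induct)
    case empty
    then show ?case by (simp add: quotient_zero coset_zero[OF H])
  next
    case (insert x F)
    have g: "g \<in> F \<rightarrow> carrier M" "g x \<in> carrier M" using insert.prems by auto
    then have "(\<lambda>i. H +>\<^bsub>M\<^esub> g i) \<in> F \<rightarrow> carrier ?Q" "H +>\<^bsub>M\<^esub> g x \<in> carrier ?Q"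
      by (auto simp: quotient_carrier)
    then show ?case using insert g by (simp add: quotient_add[OF H])
  qed
  have "lincomb ?Q n e c = (\<Oplus>\<^bsub>?Q\<^esub>i\<in>{1..n}. H +>\<^bsub>M\<^esub> (c i \<odot>\<^bsub>M\<^esub> f i))"
    unfolding lincomb_def
  proof (rule Q.finsum_cong')
    show "(\<lambda>i. H +>\<^bsub>M\<^esub> (c i \<odot>\<^bsub>M\<^esub> f i)) \<in> {1..n} \<rightarrow> carrier ?Q"
      using f c by (auto simp: quotient_carrier Pi_def)
    fix i assume i: "i \<in> {1..n}"
    then show "c i \<odot>\<^bsub>?Q\<^esub> e i = H +>\<^bsub>M\<^esub> (c i \<odot>\<^bsub>M\<^esub> f i)"
      using f c e[OF i] quotient_smult[OF H, of "c i" "f i"] by (simp add: Pi_def)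
  qed simp
  also have "\<dots> = H +>\<^bsub>M\<^esub> lincomb M n f c"
    unfolding lincomb_def using f c by (intro fin) (auto simp: Pi_def)
  finally show ?thesis .
qed

end

context nonunital_comm_algebra
begin

lemma prod_zero: "x \<in> carrier M \<Longrightarrow> \<zero>\<^bsub>M\<^esub> \<otimes>\<^bsub>M\<^esub> x = \<zero>\<^bsub>M\<^esub>" "x \<in> carrier M \<Longrightarrow> x \<otimes>\<^bsub>M\<^esub> \<zero>\<^bsub>M\<^esub> = \<zero>\<^bsub>M\<^esub>"
proof -
  assume x: "x \<in> carrier M"
  have "\<zero>\<^bsub>M\<^esub> \<otimes>\<^bsub>M\<^esub> x = (\<zero> \<odot>\<^bsub>M\<^esub> \<zero>\<^bsub>M\<^esub>) \<otimes>\<^bsub>M\<^esub> x" by simp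
  also have "\<dots> = \<zero> \<odot>\<^bsub>M\<^esub> (\<zero>\<^bsub>M\<^esub> \<otimes>\<^bsub>M\<^esub> x)" using x by (intro prod_smult) auto
  also have "\<dots> = \<zero>\<^bsub>M\<^esub>" using x prod_closed by simp
  finally show "\<zero>\<^bsub>M\<^esub> \<otimes>\<^bsub>M\<^esub> x = \<zero>\<^bsub>M\<^esub>" .
  then show "x \<otimes>\<^bsub>M\<^esub> \<zero>\<^bsub>M\<^esub> = \<zero>\<^bsub>M\<^esub>" using prod_comm x by simp
qed

lemma annihilator_submodule: "submodule (annihilator M) R M"
proof (rule submoduleI)
  fix a b assume ab: "a \<in> annihilator M" "b \<in> annihilator M"
  then show "a \<oplus>\<^bsub>M\<^esub> b \<in> annihilator M" by (auto simp: annihilator_def prod_add)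
next
  fix r a assume "r \<in> carrier R" "a \<in> annihilator M"
  then show "r \<odot>\<^bsub>M\<^esub> a \<in> annihilator M" by (auto simp: annihilator_def prod_smult)
next
  fix a assume a: "a \<in> annihilator M"
  then have "\<ominus>\<^bsub>M\<^esub> a = (\<ominus> \<one>) \<odot>\<^bsub>M\<^esub> a" by (simp add: annihilator_def smult_l_minus)
  then show "\<ominus>\<^bsub>M\<^esub> a \<in> annihilator M" using a by (auto simp: annihilator_def prod_smult)
qed (auto simp: annihilator_def prod_zero)

lemma quotient_mult:
  assumes H: "submodule H R M" "H \<subseteq> annihilator M" and xy: "x \<in> carrier M" "y \<in> carrier M"
  shows "(H +>\<^bsub>M\<^esub> x) \<otimes>\<^bsub>quotient_algebra M H\<^esub> (H +>\<^bsub>M\<^esub> y) = H +>\<^bsub>M\<^esub> (x \<otimes>\<^bsub>M\<^esub> y)"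
proof -
  have 1: "(h \<oplus>\<^bsub>M\<^esub> x) \<otimes>\<^bsub>M\<^esub> y = x \<otimes>\<^bsub>M\<^esub> y" if "h \<in> H" "x \<in> carrier M" "y \<in> carrier M" for h x y
    using that H(2) prod_closed by (auto simp: annihilator_def prod_add)
  have "x' \<otimes>\<^bsub>M\<^esub> y' = x \<otimes>\<^bsub>M\<^esub> y" if x': "x' \<in> H +>\<^bsub>M\<^esub> x" and y': "y' \<in> H +>\<^bsub>M\<^esub> y" for x' y'
  proof -
    obtain h where h: "h \<in> H" "x' = h \<oplus>\<^bsub>M\<^esub> x" using x' by (rule mem_cosetE)
    obtain g where g: "g \<in> H" "y' = g \<oplus>\<^bsub>M\<^esub> y" using y' by (rule mem_cosetE)
    have c: "h \<in> carrier M" "g \<in> carrier M" using h g submoduleE(1)[OF H(1)] by auto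
    have "x' \<otimes>\<^bsub>M\<^esub> y' = x \<otimes>\<^bsub>M\<^esub> y'" unfolding h(2) using 1[OF h(1) xy(1)] g c xy by simp
    also have "\<dots> = y' \<otimes>\<^bsub>M\<^esub> x" using g c xy by (intro prod_comm) auto
    also have "\<dots> = y \<otimes>\<^bsub>M\<^esub> x" unfolding g(2) using 1[OF g(1) xy(2,1)] .
    finally show ?thesis using prod_comm xy by simp
  qed
  note const = this
  have "(\<Union>x'\<in>H +>\<^bsub>M\<^esub> x. \<Union>y'\<in>H +>\<^bsub>M\<^esub> y. H +>\<^bsub>M\<^esub> (x' \<otimes>\<^bsub>M\<^esub> y')) = H +>\<^bsub>M\<^esub> (x \<otimes>\<^bsub>M\<^esub> y)"
    by (rule UN_constant_eq[OF mem_coset_self[OF H(1) xy(1)] ballI],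
        rule UN_constant_eq[OF mem_coset_self[OF H(1) xy(2)] ballI], rule arg_cong[OF const])
  then show ?thesis by (simp add: quotient_algebra_def rcoset_mult_def)
qed

lemma finsum_prod:
  assumes "finite I" "f \<in> I \<rightarrow> carrier M" "y \<in> carrier M"
  shows "finsum M f I \<otimes>\<^bsub>M\<^esub> y = (\<Oplus>\<^bsub>M\<^esub>i\<in>I. f i \<otimes>\<^bsub>M\<^esub> y)"
  using assms
proof (induction I rule: finite_induct)
  case (insert x F)
  have "f \<in> F \<rightarrow> carrier M" "f x \<in> carrier M" "(\<lambda>i. f i \<otimes>\<^bsub>M\<^esub> y) \<in> F \<rightarrow> carrier M"
    using insert.prems prod_closed by auto
  then show ?case using insert prod_closed by (simp add: prod_add)
qed (simp add: prod_zero)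

lemma lincomb_prod:
  assumes f: "f \<in> {1..n} \<rightarrow> carrier M" and c: "c \<in> {1..n} \<rightarrow> carrier R" and y: "y \<in> carrier M"
  shows "lincomb M n f c \<otimes>\<^bsub>M\<^esub> y = lincomb M n (\<lambda>i. f i \<otimes>\<^bsub>M\<^esub> y) c"
proof -
  have "lincomb M n f c \<otimes>\<^bsub>M\<^esub> y = (\<Oplus>\<^bsub>M\<^esub>i\<in>{1..n}. (c i \<odot>\<^bsub>M\<^esub> f i) \<otimes>\<^bsub>M\<^esub> y)"
    unfolding lincomb_def using f c y by (intro finsum_prod) (auto simp: Pi_def)
  also have "\<dots> = lincomb M n (\<lambda>i. f i \<otimes>\<^bsub>M\<^esub> y) c"
    unfolding lincomb_def using f c y prod_closed
    by (intro M.finsum_cong') (auto simp: Pi_def prod_smult)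
  finally show ?thesis .
qed

lemma lincomb_smult_generator:
  assumes "g \<in> carrier M" "c \<in> {1..n} \<rightarrow> carrier R" "a \<in> {1..n} \<rightarrow> carrier R"
  shows "lincomb M n (\<lambda>i. a i \<odot>\<^bsub>M\<^esub> g) c = (\<Oplus>i\<in>{1..n}. c i \<otimes> a i) \<odot>\<^bsub>M\<^esub> g"
proof -
  have "(\<Oplus>i\<in>I. c i \<otimes> a i) \<odot>\<^bsub>M\<^esub> g = (\<Oplus>\<^bsub>M\<^esub>i\<in>I. c i \<odot>\<^bsub>M\<^esub> (a i \<odot>\<^bsub>M\<^esub> g))"
    if "finite I" "c \<in> I \<rightarrow> carrier R" "a \<in> I \<rightarrow> carrier R" for I
    using that
  proof (induction I rule: finite_induct)
    case (insert x F)
    have F: "c \<in> F \<rightarrow> carrier R" "a \<in> F \<rightarrow> carrier R" "c x \<in> carrier R" "a x \<in> carrier R"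
      using insert.prems by auto
    then have "(\<lambda>i. c i \<otimes> a i) \<in> F \<rightarrow> carrier R" "(\<lambda>i. c i \<odot>\<^bsub>M\<^esub> (a i \<odot>\<^bsub>M\<^esub> g)) \<in> F \<rightarrow> carrier M"
      using assms(1) by (auto simp: Pi_def)
    then show ?case using insert F assms(1) by (simp add: smult_l_distr smult_assoc1 R.finsum_closed)
  qed (use assms(1) in simp)
  then show ?thesis using assms by (simp add: lincomb_def)
qed

end

section \<open>Reconstruction from a defining matrix\<close>

context odd_prime
begin

lemma std_algebra_isomorphic_basis:
  assumes M: "nonunital_comm_algebra R M" and B: "is_basis R M N F" and m: "m < N" and \<Theta>: "pmat m \<Theta>"
    and table: "\<And>i j. i \<in> {1..m} \<Longrightarrow> j \<in> {1..m} \<Longrightarrow> F i \<otimes>\<^bsub>M\<^esub> F j = \<Theta> i j \<odot>\<^bsub>M\<^esub> F N"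
    and ann: "\<And>i. i \<in> {1..N} \<Longrightarrow> i \<notin> {1..m} \<Longrightarrow> F i \<in> annihilator M"
  shows "isomorphic R (std_algebra N m \<Theta>) M"
proof -
  interpret A: nonunital_comm_algebra R M by (rule M)
  let ?V = "{1..N} \<rightarrow>\<^sub>E carrier R"
  define \<phi> where "\<phi> = lincomb M N F"
  note F = A.is_basis_closed[OF B]
  have NN: "N \<in> {1..N}" using m by simp
  have FN: "F N \<in> carrier M" by (rule funcset_mem[OF F NN])
  have V: "x \<in> {1..N} \<rightarrow> carrier R" if "x \<in> ?V" for x using that by blast
  have \<phi>_closed: "\<phi> x \<in> carrier M" if "x \<in> ?V" for x
    unfolding \<phi>_def by (rule A.lincomb_closed[OF F V[OF that]])
  have bij: "bij_betw \<phi> ?V (carrier M)"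
  proof (rule bij_betw_imageI)
    show "inj_on \<phi> ?V"
    proof (rule inj_onI)
      fix x y assume x: "x \<in> ?V" and y: "y \<in> ?V" and eq: "\<phi> x = \<phi> y"
      have "x i = y i" if "i \<in> {1..N}" for i
        by (rule A.is_basis_unique[OF B V[OF x] V[OF y] _ that]) (use eq in \<open>simp add: \<phi>_def\<close>)
      then show "x = y" by (rule PiE_ext[OF x y])
    qed
    show "\<phi> ` ?V = carrier M"
    proof
      show "\<phi> ` ?V \<subseteq> carrier M" using \<phi>_closed by blast
      show "carrier M \<subseteq> \<phi> ` ?V" using A.is_basis_span[OF B] unfolding \<phi>_def by blast
    qed
  qed
  have add: "\<phi> (x \<oplus>\<^bsub>std_algebra N m \<Theta>\<^esub> y) = \<phi> x \<oplus>\<^bsub>M\<^esub> \<phi> y" if x: "x \<in> ?V" and y: "y \<in> ?V" for x y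
  proof -
    have "\<phi> (x \<oplus>\<^bsub>std_algebra N m \<Theta>\<^esub> y) = lincomb M N F (\<lambda>i. x i \<oplus>\<^bsub>R\<^esub> y i)"
      unfolding \<phi>_def std_algebra_simps using V[OF x] V[OF y]
      by (intro A.lincomb_cong F) (auto simp: Pi_def)
    then show ?thesis unfolding \<phi>_def using A.lincomb_add[OF F V[OF x] V[OF y]] by simp
  qed
  have smult: "\<phi> (r \<odot>\<^bsub>std_algebra N m \<Theta>\<^esub> x) = r \<odot>\<^bsub>M\<^esub> \<phi> x" if r: "r \<in> carrier R" and x: "x \<in> ?V" for r x
  proof -
    have "\<phi> (r \<odot>\<^bsub>std_algebra N m \<Theta>\<^esub> x) = lincomb M N F (\<lambda>i. r \<otimes>\<^bsub>R\<^esub> x i)"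
      unfolding \<phi>_def std_algebra_simps using V[OF x] r
      by (intro A.lincomb_cong F) (auto simp: Pi_def)
    then show ?thesis unfolding \<phi>_def using A.lincomb_smult[OF F V[OF x] r] by simp
  qed
  define \<Theta>' where "\<Theta>' i j = (if i \<in> {1..m} \<and> j \<in> {1..m} then \<Theta> i j else \<zero>\<^bsub>R\<^esub>)" for i j
  have \<Theta>': "\<Theta>' i j \<in> carrier R" for i j using \<Theta> by (auto simp: \<Theta>'_def pmat_def)
  have table': "F i \<otimes>\<^bsub>M\<^esub> F j = \<Theta>' i j \<odot>\<^bsub>M\<^esub> F N" if i: "i \<in> {1..N}" and j: "j \<in> {1..N}" for i j
  proof -
    have c: "F i \<in> carrier M" "F j \<in> carrier M" using funcset_mem[OF F] i j by blast+
    consider "i \<in> {1..m}" "j \<in> {1..m}" | "i \<notin> {1..m}" | "j \<notin> {1..m}" by blast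
    then show ?thesis
    proof cases
      case 1
      then show ?thesis using table by (simp add: \<Theta>'_def)
    next
      case 2
      then have "F i \<otimes>\<^bsub>M\<^esub> F j = \<zero>\<^bsub>M\<^esub>" using ann[OF i] c by (simp add: annihilator_def)
      moreover have "\<Theta>' i j = \<zero>\<^bsub>R\<^esub>" unfolding \<Theta>'_def using 2 by (simp only: simp_thms if_False)
      ultimately show ?thesis using FN by simp
    next
      case 3
      then have "F j \<otimes>\<^bsub>M\<^esub> F i = \<zero>\<^bsub>M\<^esub>" using ann[OF j] c by (simp add: annihilator_def)
      moreover have "F i \<otimes>\<^bsub>M\<^esub> F j = F j \<otimes>\<^bsub>M\<^esub> F i" by (rule A.prod_comm[OF c])
      moreover have "\<Theta>' i j = \<zero>\<^bsub>R\<^esub>" unfolding \<Theta>'_def using 3 by (simp only: simp_thms if_False)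
      ultimately show ?thesis using FN by simp
    qed
  qed
  have mult: "\<phi> (x \<otimes>\<^bsub>std_algebra N m \<Theta>\<^esub> y) = \<phi> x \<otimes>\<^bsub>M\<^esub> \<phi> y" if x: "x \<in> ?V" and y: "y \<in> ?V" for x y
  proof -
    define a where "a i = (\<Oplus>\<^bsub>R\<^esub>j\<in>{1..N}. y j \<otimes>\<^bsub>R\<^esub> \<Theta>' j i)" for i
    have a_fun: "(\<lambda>j. y j \<otimes>\<^bsub>R\<^esub> \<Theta>' j i) \<in> {1..N} \<rightarrow> carrier R" for i
      using V[OF y] \<Theta>' by (auto simp: Pi_def)
    have a: "a i \<in> carrier R" for i unfolding a_def by (rule R.finsum_closed[OF a_fun])
    have xa_fun: "(\<lambda>i. x i \<otimes>\<^bsub>R\<^esub> a i) \<in> {1..N} \<rightarrow> carrier R"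
      using V[OF x] a by (auto simp: Pi_def)
    have Fi: "F i \<otimes>\<^bsub>M\<^esub> \<phi> y = a i \<odot>\<^bsub>M\<^esub> F N" if i: "i \<in> {1..N}" for i
    proof -
      have c: "F i \<in> carrier M" by (rule funcset_mem[OF F i])
      have "F i \<otimes>\<^bsub>M\<^esub> \<phi> y = \<phi> y \<otimes>\<^bsub>M\<^esub> F i" by (rule A.prod_comm[OF c \<phi>_closed[OF y]])
      also have "\<dots> = lincomb M N (\<lambda>j. F j \<otimes>\<^bsub>M\<^esub> F i) y"
        unfolding \<phi>_def by (rule A.lincomb_prod[OF F V[OF y] c])
      also have "\<dots> = lincomb M N (\<lambda>j. \<Theta>' j i \<odot>\<^bsub>M\<^esub> F N) y"
        using table' i V[OF y] FN \<Theta>' by (intro A.lincomb_cong) auto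
      also have "\<dots> = a i \<odot>\<^bsub>M\<^esub> F N"
        unfolding a_def using \<Theta>' by (intro A.lincomb_smult_generator FN V[OF y]) auto
      finally show ?thesis .
    qed
    have "\<phi> x \<otimes>\<^bsub>M\<^esub> \<phi> y = lincomb M N (\<lambda>i. F i \<otimes>\<^bsub>M\<^esub> \<phi> y) x"
      unfolding \<phi>_def[THEN fun_cong, of x] by (rule A.lincomb_prod[OF F V[OF x] \<phi>_closed[OF y]])
    also have "\<dots> = lincomb M N (\<lambda>i. a i \<odot>\<^bsub>M\<^esub> F N) x"
      using Fi V[OF x] FN a by (intro A.lincomb_cong) auto
    also have "\<dots> = (\<Oplus>\<^bsub>R\<^esub>i\<in>{1..N}. x i \<otimes>\<^bsub>R\<^esub> a i) \<odot>\<^bsub>M\<^esub> F N"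
      using a by (intro A.lincomb_smult_generator FN V[OF x]) auto
    also have "(\<Oplus>\<^bsub>R\<^esub>i\<in>{1..N}. x i \<otimes>\<^bsub>R\<^esub> a i) = pform m \<Theta> x y"
    proof
      fix n
      have "[(\<Oplus>\<^bsub>R\<^esub>i\<in>{1..N}. x i \<otimes>\<^bsub>R\<^esub> a i) n = (\<Sum>i\<in>{1..N}. (x i \<otimes>\<^bsub>R\<^esub> a i) n)] (mod int p ^ n)"
        using padic_finsum[OF _ xa_fun, of n] by simp
      also have "[(\<Sum>i\<in>{1..N}. (x i \<otimes>\<^bsub>R\<^esub> a i) n) =
          (\<Sum>i\<in>{1..N}. x i n * (\<Sum>j\<in>{1..N}. y j n * \<Theta>' j i n))] (mod int p ^ n)"
      proof (rule cong_sum)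
        fix i
        have "[a i n = (\<Sum>j\<in>{1..N}. (y j \<otimes>\<^bsub>R\<^esub> \<Theta>' j i) n)] (mod int p ^ n)"
          unfolding a_def using padic_finsum[OF _ a_fun, of i n] by simp
        also have "[(\<Sum>j\<in>{1..N}. (y j \<otimes>\<^bsub>R\<^esub> \<Theta>' j i) n) = (\<Sum>j\<in>{1..N}. y j n * \<Theta>' j i n)] (mod int p ^ n)"
          by (rule cong_sum) (simp add: padic_mult)
        finally have "[x i n * a i n = x i n * (\<Sum>j\<in>{1..N}. y j n * \<Theta>' j i n)] (mod int p ^ n)"
          by (intro cong_mult cong_refl)
        then show "[(x i \<otimes>\<^bsub>R\<^esub> a i) n = x i n * (\<Sum>j\<in>{1..N}. y j n * \<Theta>' j i n)] (mod int p ^ n)"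
          by (simp add: padic_mult)
      qed
      also have "(\<Sum>i\<in>{1..N}. x i n * (\<Sum>j\<in>{1..N}. y j n * \<Theta>' j i n)) =
          (\<Sum>j\<in>{1..N}. \<Sum>i\<in>{1..N}. \<Theta>' j i n * y j n * x i n)"
        unfolding sum_distrib_left by (subst sum.swap) (simp add: mult_ac)
      also have "\<dots> = (\<Sum>j\<in>{1..m}. \<Sum>i\<in>{1..m}. \<Theta> j i n * y j n * x i n)"
      proof (rule sum.mono_neutral_cong_right)
        show "{1..m} \<subseteq> {1..N}" using m by auto
        show "\<forall>j\<in>{1..N} - {1..m}. (\<Sum>i\<in>{1..N}. \<Theta>' j i n * y j n * x i n) = 0"
        proof
          fix j assume "j \<in> {1..N} - {1..m}"
          then have "\<Theta>' j i = \<zero>\<^bsub>R\<^esub>" for i unfolding \<Theta>'_def by (simp only: Diff_iff simp_thms if_False)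
          then show "(\<Sum>i\<in>{1..N}. \<Theta>' j i n * y j n * x i n) = 0" by (simp add: padic_zero)
        qed
        fix j assume j: "j \<in> {1..m}"
        show "(\<Sum>i\<in>{1..N}. \<Theta>' j i n * y j n * x i n) = (\<Sum>i\<in>{1..m}. \<Theta> j i n * y j n * x i n)"
        proof (rule sum.mono_neutral_cong_right)
          show "{1..m} \<subseteq> {1..N}" using m by auto
          show "\<forall>i\<in>{1..N} - {1..m}. \<Theta>' j i n * y j n * x i n = 0"
          proof
            fix i assume "i \<in> {1..N} - {1..m}"
            then have "\<Theta>' j i = \<zero>\<^bsub>R\<^esub>" unfolding \<Theta>'_def by (simp only: Diff_iff simp_thms if_False)
            then show "\<Theta>' j i n * y j n * x i n = 0" by (simp add: padic_zero)
          qed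
        qed (use j in \<open>simp_all add: \<Theta>'_def\<close>)
      qed simp
      also have "\<dots> = (\<Sum>i\<in>{1..m}. \<Sum>j\<in>{1..m}. \<Theta> j i n * x i n * y j n)"
        by (subst sum.swap) (simp add: mult_ac)
      also have "\<dots> = (\<Sum>i\<in>{1..m}. \<Sum>j\<in>{1..m}. \<Theta> i j n * x i n * y j n)"
      proof (intro sum.cong refl)
        fix i j assume i: "i \<in> {1..m}" and j: "j \<in> {1..m}"
        have iN: "i \<in> {1..N}" "j \<in> {1..N}" using i j m by auto
        have "F i \<otimes>\<^bsub>M\<^esub> F j = F j \<otimes>\<^bsub>M\<^esub> F i" using funcset_mem[OF F] iN by (intro A.prod_comm) auto
        then have "\<Theta> i j \<odot>\<^bsub>M\<^esub> F N = \<Theta> j i \<odot>\<^bsub>M\<^esub> F N" using table i j by simp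
        then have "lincomb M N F (\<lambda>k. if k = N then \<Theta> i j else \<zero>\<^bsub>R\<^esub>) = lincomb M N F (\<lambda>k. if k
            = N then \<Theta> j i else \<zero>\<^bsub>R\<^esub>)"
          using A.lincomb_delta[OF F NN] \<Theta> i j by (simp add: pmat_def)
        then have "\<Theta> i j = \<Theta> j i"
          using A.is_basis_unique[OF B, of "\<lambda>k. if k = N then \<Theta> i j else \<zero>\<^bsub>R\<^esub>" "\<lambda>k. if k = N then \<Theta> j i else \<zero>\<^bsub>R\<^esub>" N]
            \<Theta> i j NN by (auto simp: pmat_def Pi_def)
        then show "\<Theta> j i n * x i n * y j n = \<Theta> i j n * x i n * y j n" by simp
      qed
      finally have "[(\<Oplus>\<^bsub>R\<^esub>i\<in>{1..N}. x i \<otimes>\<^bsub>R\<^esub> a i) n = (\<Sum>i\<in>{1..m}. \<Sum>j\<in>{1..m}. \<Theta> i j n * x i n * y j n)]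
          (mod int p ^ n)" .
      moreover have "(\<Oplus>\<^bsub>R\<^esub>i\<in>{1..N}. x i \<otimes>\<^bsub>R\<^esub> a i) n mod int p ^ n = (\<Oplus>\<^bsub>R\<^esub>i\<in>{1..N}. x i \<otimes>\<^bsub>R\<^esub> a i) n"
        by (rule padic_mod[OF R.finsum_closed[OF xa_fun]])
      ultimately show "(\<Oplus>\<^bsub>R\<^esub>i\<in>{1..N}. x i \<otimes>\<^bsub>R\<^esub> a i) n = pform m \<Theta> x y n"
        by (simp add: pform_def of_seq_def cong_def)
    qed
    finally have "\<phi> x \<otimes>\<^bsub>M\<^esub> \<phi> y = pform m \<Theta> x y \<odot>\<^bsub>M\<^esub> F N" .
    moreover have "\<phi> (x \<otimes>\<^bsub>std_algebra N m \<Theta>\<^esub> y) = pform m \<Theta> x y \<odot>\<^bsub>M\<^esub> F N"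
    proof -
      have "i \<in> {1..m} \<Longrightarrow> i \<in> {1..N}" for i using m by simp
      then have pf: "pform m \<Theta> x y \<in> carrier R"
        by (intro pform_closed[OF \<Theta>] funcset_mem[OF V[OF x]] funcset_mem[OF V[OF y]])
      have "\<phi> (x \<otimes>\<^bsub>std_algebra N m \<Theta>\<^esub> y) = lincomb M N F (\<lambda>k. if k = N then pform m \<Theta> x y else \<zero>\<^bsub>R\<^esub>)"
        unfolding \<phi>_def std_algebra_simps using pf by (intro A.lincomb_cong F) auto
      then show ?thesis using A.lincomb_delta[OF F NN pf] by simp
    qed
    ultimately show ?thesis by simp
  qed
  have "\<phi> \<in> algebra_iso R (std_algebra N m \<Theta>) M"
    unfolding algebra_iso_def std_algebra_simps(1) using bij add mult smult by blast
  then show ?thesis by (auto simp: isomorphic_def)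
qed

theorem defining_matrix_standard_form:
  assumes M: "nonunital_comm_algebra R M" and def: "is_defining_matrix R M m \<Theta>"
    and d: "0 < d" "free_of_rank R (M\<lparr>carrier := annihilator M\<rparr>) d"
  shows "isomorphic R (std_algebra (m + d) m \<Theta>) M" "pmat m \<Theta>"
    "\<And>i j. i \<in> {1..m} \<Longrightarrow> j \<in> {1..m} \<Longrightarrow> \<Theta> i j = \<Theta> j i"
proof -
  interpret A: nonunital_comm_algebra R M by (rule M)
  let ?A = "annihilator M"
  obtain H K e where H: "submodule H R M" and K: "submodule K R M"
    and HK: "H <+>\<^bsub>M\<^esub> K = ?A" "H \<inter> K = {\<zero>\<^bsub>M\<^esub>}" and cyc: "cyclic R M K" and PK: "product_module R M \<subseteq> K"
    and e: "is_basis R (quotient_algebra M H) (m + 1) e"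
    and ann_Q: "annihilator (quotient_algebra M H) = cyclic_span R (quotient_algebra M H) (e (m + 1))"
    and table: "\<And>i j. i \<in> {1..m} \<Longrightarrow> j \<in> {1..m} \<Longrightarrow> \<Theta> i j \<in> carrier R \<and>
      e i \<otimes>\<^bsub>quotient_algebra M H\<^esub> e j = \<Theta> i j \<odot>\<^bsub>quotient_algebra M H\<^esub> e (m + 1)"
    using def unfolding is_defining_matrix_def Let_def by blast
  define Q where "Q = quotient_algebra M H"
  note e = e[folded Q_def] and ann_Q = ann_Q[folded Q_def] and table = table[folded Q_def]
  show \<Theta>: "pmat m \<Theta>" using table by (auto simp: pmat_def)
  define \<pi> where "\<pi> x = H +>\<^bsub>M\<^esub> x" for x
  have \<pi>_eq: "\<pi> x = \<pi> y \<longleftrightarrow> x \<ominus>\<^bsub>M\<^esub> y \<in> H" if "x \<in> carrier M" "y \<in> carrier M" for x y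
    unfolding \<pi>_def by (rule A.coset_eq_iff[OF H that])
  note subA = A.submoduleE(1)[OF A.annihilator_submodule]
  note subH = A.submoduleE(1)[OF H] and subK = A.submoduleE(1)[OF K]
  have sumD: "\<exists>h\<in>H. \<exists>k\<in>K. a = h \<oplus>\<^bsub>M\<^esub> k" if "a \<in> ?A" for a
    using that unfolding HK(1)[symmetric] set_add_def' by blast
  have zH: "\<zero>\<^bsub>M\<^esub> \<in> H" "\<zero>\<^bsub>M\<^esub> \<in> K" using HK(2) by blast+
  have sumI: "h \<oplus>\<^bsub>M\<^esub> k \<in> ?A" if "h \<in> H" "k \<in> K" for h k
    using that unfolding HK(1)[symmetric] set_add_def' by blast
  have HA: "H \<subseteq> ?A"
  proof
    fix h assume "h \<in> H"
    then show "h \<in> ?A" using sumI[OF _ zH(2), of h] subH by auto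
  qed
  have KA: "K \<subseteq> ?A"
  proof
    fix k assume "k \<in> K"
    then show "k \<in> ?A" using sumI[OF zH(1), of k] subK by auto
  qed
  have Q_mult: "\<pi> x \<otimes>\<^bsub>Q\<^esub> \<pi> y = \<pi> (x \<otimes>\<^bsub>M\<^esub> y)" if "x \<in> carrier M" "y \<in> carrier M" for x y
    unfolding \<pi>_def Q_def by (rule A.quotient_mult[OF H HA that])
  have Q_smult: "r \<odot>\<^bsub>Q\<^esub> \<pi> x = \<pi> (r \<odot>\<^bsub>M\<^esub> x)" if "r \<in> carrier R" "x \<in> carrier M" for r x
    unfolding \<pi>_def Q_def by (rule A.quotient_smult[OF H that])
  have Q_carrier: "carrier Q = \<pi> ` carrier M" unfolding Q_def \<pi>_def by (rule A.quotient_carrier)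
  have Q_zero: "\<zero>\<^bsub>Q\<^esub> = \<pi> \<zero>\<^bsub>M\<^esub>" unfolding Q_def \<pi>_def A.quotient_zero A.coset_zero[OF H] ..
  have prod_K: "x \<otimes>\<^bsub>M\<^esub> y \<in> K" if "x \<in> carrier M" "y \<in> carrier M" for x y
    using that PK unfolding product_module_def by blast
  have "\<exists>f. f \<in> carrier M \<and> e i = \<pi> f" if "i \<in> {1..m + 1}" for i
  proof -
    have "e i \<in> carrier Q" using e that unfolding is_basis_def by blast
    then show ?thesis unfolding Q_carrier by blast
  qed
  then obtain f0 where f0: "\<And>i. i \<in> {1..m + 1} \<Longrightarrow> f0 i \<in> carrier M \<and> e i = \<pi> (f0 i)" by metis
  have eQ: "e (m + 1) = \<pi> (f0 (m + 1))" and f0m: "f0 (m + 1) \<in> carrier M" using f0[of "m + 1"] by auto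
  have f0A: "f0 (m + 1) \<in> ?A"
  proof -
    have "e (m + 1) \<in> annihilator Q"
    proof -
      have "e (m + 1) = \<one>\<^bsub>R\<^esub> \<odot>\<^bsub>Q\<^esub> e (m + 1)"
        unfolding eQ using f0m by (simp add: Q_smult)
      then show ?thesis unfolding ann_Q cyclic_span_def by blast
    qed
    then have *: "e (m + 1) \<otimes>\<^bsub>Q\<^esub> \<pi> x = \<zero>\<^bsub>Q\<^esub>" if "x \<in> carrier M" for x
      using that unfolding annihilator_def Q_carrier by blast
    have "f0 (m + 1) \<otimes>\<^bsub>M\<^esub> x = \<zero>\<^bsub>M\<^esub>" if x: "x \<in> carrier M" for x
    proof -
      have c: "f0 (m + 1) \<otimes>\<^bsub>M\<^esub> x \<in> carrier M" by (rule A.prod_closed[OF f0m x])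
      have "\<pi> (f0 (m + 1) \<otimes>\<^bsub>M\<^esub> x) = \<pi> \<zero>\<^bsub>M\<^esub>"
        using *[OF x] unfolding eQ Q_mult[OF f0m x] Q_zero .
      then have "f0 (m + 1) \<otimes>\<^bsub>M\<^esub> x \<ominus>\<^bsub>M\<^esub> \<zero>\<^bsub>M\<^esub> \<in> H" unfolding \<pi>_eq[OF c A.M.zero_closed] .
      moreover have "\<ominus>\<^bsub>M\<^esub> \<zero>\<^bsub>M\<^esub> = \<zero>\<^bsub>M\<^esub>" by (rule A.M.minus_equality) simp_all
      ultimately have "f0 (m + 1) \<otimes>\<^bsub>M\<^esub> x \<in> H" using c by (simp add: A.M.minus_eq)
      then show ?thesis using HK(2) prod_K[OF f0m x] by blast
    qed
    then show ?thesis unfolding annihilator_def using f0m by blast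
  qed
  then obtain h0 g where g: "h0 \<in> H" "g \<in> K" "f0 (m + 1) = h0 \<oplus>\<^bsub>M\<^esub> g" using sumD by blast
  have gM: "g \<in> carrier M" and h0M: "h0 \<in> carrier M" and gA: "g \<in> ?A" using g subK subH KA by blast+
  have eg: "e (m + 1) = \<pi> g"
  proof -
    have "f0 (m + 1) \<ominus>\<^bsub>M\<^esub> g = h0" unfolding g(3) using gM h0M by (simp add: A.M.minus_eq A.M.a_assoc A.M.r_neg)
    then show ?thesis unfolding eQ using \<pi>_eq[OF f0m gM] g(1) by simp
  qed
  define f where "f i = (if i = m + 1 then g else f0 i)" for i
  have f: "f i \<in> carrier M" "e i = \<pi> (f i)" if "i \<in> {1..m + 1}" for i
    using f0[OF that] gM eg by (auto simp: f_def)
  have fm1: "f \<in> {1..m + 1} \<rightarrow> carrier M" and fm: "f \<in> {1..m} \<rightarrow> carrier M" using f by auto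
  have f_last: "f (m + 1) = g" by (simp add: f_def)
  have Q_lin: "lincomb Q (m + 1) e c = \<pi> (lincomb M (m + 1) f c)" if "c \<in> {1..m + 1} \<rightarrow> carrier R" for c
    unfolding Q_def \<pi>_def by (rule A.quotient_lincomb[OF H fm1 that]) (use f \<pi>_def in auto)
  have lin_Suc: "lincomb M (m + 1) f c = lincomb M m f c \<oplus>\<^bsub>M\<^esub> c (m + 1) \<odot>\<^bsub>M\<^esub> g" if "c \<in> {1..m + 1} \<rightarrow> carrier R" for c
    using A.lincomb_Suc[of f m c] fm1 that f_last by simp
  have uniq: "c i = c' i"
    if "c \<in> {1..m + 1} \<rightarrow> carrier R" "c' \<in> {1..m + 1} \<rightarrow> carrier R" "i \<in> {1..m + 1}"
      "lincomb M (m + 1) f c \<ominus>\<^bsub>M\<^esub> lincomb M (m + 1) f c' \<in> H" for c c' i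
  proof -
    have cl: "lincomb M (m + 1) f c \<in> carrier M" "lincomb M (m + 1) f c' \<in> carrier M"
      using A.lincomb_closed[OF fm1] that by blast+
    have eq: "lincomb Q (m + 1) e c = lincomb Q (m + 1) e c'"
      unfolding Q_lin[OF that(1)] Q_lin[OF that(2)] \<pi>_eq[OF cl] by (rule that(4))
    have mem: "lincomb Q (m + 1) e c \<in> carrier Q" unfolding Q_lin[OF that(1)] Q_carrier using cl by blast
    have r: "lincomb Q (m + 1) e (restrict a {1..m + 1}) = lincomb Q (m + 1) e a"
      "restrict a {1..m + 1} \<in> {1..m + 1} \<rightarrow>\<^sub>E carrier R" if "a \<in> {1..m + 1} \<rightarrow> carrier R" for a
    proof -
      show R: "restrict a {1..m + 1} \<in> {1..m + 1} \<rightarrow>\<^sub>E carrier R" using that by auto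
      have "lincomb M (m + 1) f (restrict a {1..m + 1}) = lincomb M (m + 1) f a"
        using that by (intro A.lincomb_cong fm1) auto
      moreover have "restrict a {1..m + 1} \<in> {1..m + 1} \<rightarrow> carrier R" using that by auto
      ultimately show "lincomb Q (m + 1) e (restrict a {1..m + 1}) = lincomb Q (m + 1) e a"
        using Q_lin that by simp
    qed
    have ex1: "\<exists>!a. a \<in> {1..m + 1} \<rightarrow>\<^sub>E carrier R \<and> lincomb Q (m + 1) e c = lincomb Q (m + 1) e a"
      by (rule bspec[OF conjunct2[OF e[unfolded is_basis_def lincomb_def[symmetric]]] mem])
    have "restrict c {1..m + 1} = restrict c' {1..m + 1}"
    proof -
      obtain a0 where a0: "\<And>a. a \<in> {1..m + 1} \<rightarrow>\<^sub>E carrier R \<Longrightarrow> lincomb Q (m + 1) e c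
          = lincomb Q (m + 1) e a \<Longrightarrow> a = a0"
        using ex1 by (elim ex1E) blast
      have "restrict c {1..m + 1} = a0" by (rule a0[OF r(2)[OF that(1)]]) (simp only: r(1)[OF that(1)])
      moreover have "restrict c' {1..m + 1} = a0" by (rule a0[OF r(2)[OF that(2)]])
          (simp only: r(1)[OF that(2)] eq)
      ultimately show ?thesis by simp
    qed
    then show ?thesis using that(3) by (metis restrict_apply')
  qed
  have torsion_free: "r = s" if r: "r \<in> carrier R" and s: "s \<in> carrier R" and eq: "r \<odot>\<^bsub>M\<^esub> g = s \<odot>\<^bsub>M\<^esub> g" for r s
  proof -
    have m1: "m + 1 \<in> {1..m + 1}" by simp
    have "lincomb M (m + 1) f (\<lambda>i. if i = m + 1 then r else \<zero>\<^bsub>R\<^esub>) = r \<odot>\<^bsub>M\<^esub> g"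
      "lincomb M (m + 1) f (\<lambda>i. if i = m + 1 then s else \<zero>\<^bsub>R\<^esub>) = s \<odot>\<^bsub>M\<^esub> g"
      using A.lincomb_delta[OF fm1 m1 r] A.lincomb_delta[OF fm1 m1 s] f_last by simp_all
    then have "lincomb M (m + 1) f (\<lambda>i. if i = m + 1 then r else \<zero>\<^bsub>R\<^esub>) \<ominus>\<^bsub>M\<^esub> lincomb M (m + 1) f (\<lambda>i. if i
        = m + 1 then s else \<zero>\<^bsub>R\<^esub>) \<in> H"
      using eq s gM zH by (simp add: A.M.minus_eq A.M.r_neg)
    then have "(\<lambda>i. if i = m + 1 then r else \<zero>\<^bsub>R\<^esub>) (m + 1) = (\<lambda>i. if i = m + 1 then s else \<zero>\<^bsub>R\<^esub>) (m + 1)"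
      by (intro uniq) (use r s in auto)
    then show ?thesis by simp
  qed
  have HK0: "x = \<zero>\<^bsub>M\<^esub>" if "x \<in> H" "x \<in> K" for x using HK(2) that by blast
  have minus_closed: "x \<ominus>\<^bsub>M\<^esub> y \<in> P" if "submodule P R M" "x \<in> P" "y \<in> P" for x y P
    unfolding A.M.minus_eq using A.submoduleE(3,5)[OF that(1)] that by blast
  have K_span: "\<exists>r\<in>carrier R. x = r \<odot>\<^bsub>M\<^esub> g" if x: "x \<in> K" for x
  proof -
    have xM: "x \<in> carrier M" "x \<in> ?A" using x subK KA by blast+
    have "\<pi> x \<in> annihilator Q"
      unfolding annihilator_def Q_carrier
    proof (intro CollectI conjI ballI)
      fix S assume "S \<in> \<pi> ` carrier M"
      then obtain y where y: "y \<in> carrier M" "S = \<pi> y" by blast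
      have "x \<otimes>\<^bsub>M\<^esub> y = \<zero>\<^bsub>M\<^esub>" using xM(2) y(1) unfolding annihilator_def by blast
      then show "\<pi> x \<otimes>\<^bsub>Q\<^esub> S = \<zero>\<^bsub>Q\<^esub>" unfolding y(2) Q_mult[OF xM(1) y(1)] Q_zero by simp
    qed (use xM in blast)
    then obtain r where r: "r \<in> carrier R" "\<pi> x = r \<odot>\<^bsub>Q\<^esub> e (m + 1)"
      unfolding ann_Q cyclic_span_def by blast
    have rg: "r \<odot>\<^bsub>M\<^esub> g \<in> K" "r \<odot>\<^bsub>M\<^esub> g \<in> carrier M" using A.submoduleE(4)[OF K r(1) g(2)] subK by blast+
    have "\<pi> x = \<pi> (r \<odot>\<^bsub>M\<^esub> g)" using r(2) unfolding eg Q_smult[OF r(1) gM] .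
    then have "x \<ominus>\<^bsub>M\<^esub> r \<odot>\<^bsub>M\<^esub> g \<in> H" using \<pi>_eq[OF xM(1) rg(2)] by simp
    then have "x \<ominus>\<^bsub>M\<^esub> r \<odot>\<^bsub>M\<^esub> g = \<zero>\<^bsub>M\<^esub>" using minus_closed[OF K x rg(1)] by (rule HK0)
    then show ?thesis using A.minus_eq_zero_iff[OF xM(1) rg(2)] r(1) by blast
  qed
  have f_table: "f i \<otimes>\<^bsub>M\<^esub> f j = \<Theta> i j \<odot>\<^bsub>M\<^esub> g" if i: "i \<in> {1..m}" and j: "j \<in> {1..m}" for i j
  proof -
    have im: "i \<in> {1..m + 1}" "j \<in> {1..m + 1}" using i j by auto
    note fi = f[OF im(1)] and fj = f[OF im(2)]
    have \<Theta>ij: "\<Theta> i j \<in> carrier R" using table[OF i j] by blast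
    have p: "f i \<otimes>\<^bsub>M\<^esub> f j \<in> K" "f i \<otimes>\<^bsub>M\<^esub> f j \<in> carrier M"
      using prod_K[OF fi(1) fj(1)] A.prod_closed[OF fi(1) fj(1)] .
    have t: "\<Theta> i j \<odot>\<^bsub>M\<^esub> g \<in> K" "\<Theta> i j \<odot>\<^bsub>M\<^esub> g \<in> carrier M"
      using A.submoduleE(4)[OF K \<Theta>ij g(2)] subK by blast+
    have "\<pi> (f i \<otimes>\<^bsub>M\<^esub> f j) = \<pi> (\<Theta> i j \<odot>\<^bsub>M\<^esub> g)"
      using table[OF i j] unfolding fi(2) fj(2) eg Q_mult[OF fi(1) fj(1)] Q_smult[OF \<Theta>ij gM] by blast
    then have "f i \<otimes>\<^bsub>M\<^esub> f j \<ominus>\<^bsub>M\<^esub> \<Theta> i j \<odot>\<^bsub>M\<^esub> g \<in> H" using \<pi>_eq[OF p(2) t(2)] by simp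
    then have "f i \<otimes>\<^bsub>M\<^esub> f j \<ominus>\<^bsub>M\<^esub> \<Theta> i j \<odot>\<^bsub>M\<^esub> g = \<zero>\<^bsub>M\<^esub>"
      using minus_closed[OF K p(1) t(1)] by (rule HK0)
    then show ?thesis using A.minus_eq_zero_iff[OF p(2) t(2)] by blast
  qed
  show "\<Theta> i j = \<Theta> j i" if i: "i \<in> {1..m}" and j: "j \<in> {1..m}" for i j
  proof -
    have "f i \<otimes>\<^bsub>M\<^esub> f j = f j \<otimes>\<^bsub>M\<^esub> f i" by (rule A.prod_comm[OF funcset_mem[OF fm i] funcset_mem[OF fm j]])
    then have "\<Theta> i j \<odot>\<^bsub>M\<^esub> g = \<Theta> j i \<odot>\<^bsub>M\<^esub> g" unfolding f_table[OF i j] f_table[OF j i] .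
    then show ?thesis using table[OF i j] table[OF j i] by (intro torsion_free) blast+
  qed
  obtain b where b: "is_basis R (M\<lparr>carrier := ?A\<rparr>) d b" using d(2) unfolding free_of_rank_def by blast
  interpret MA: module R "M\<lparr>carrier := ?A\<rparr>"
    by (rule submodule.submodule_is_module[OF A.annihilator_submodule A.module_axioms])
  have bA: "b \<in> {1..d} \<rightarrow> ?A" using MA.is_basis_closed[OF b] by simp
  obtain \<kappa> where \<kappa>E: "\<kappa> \<in> {1..d} \<rightarrow>\<^sub>E carrier R" and g_MA: "g = lincomb (M\<lparr>carrier := ?A\<rparr>) d b \<kappa>"
    using MA.is_basis_span[OF b, of g] gA by auto
  have \<kappa>: "\<kappa> \<in> {1..d} \<rightarrow> carrier R" using \<kappa>E by blast
  have g_lin: "g = lincomb M d b \<kappa>" using g_MA A.submodule_lincomb(1)[OF A.annihilator_submodule bA \<kappa>] by simp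
  have "\<exists>h s. h \<in> H \<and> s \<in> carrier R \<and> b j = h \<oplus>\<^bsub>M\<^esub> s \<odot>\<^bsub>M\<^esub> g" if "j \<in> {1..d}" for j
    using sumD[OF funcset_mem[OF bA that]] K_span by metis
  then obtain h s where hs: "\<And>j. j \<in> {1..d} \<Longrightarrow> h j \<in> H \<and> s j \<in> carrier R \<and> b j = h j \<oplus>\<^bsub>M\<^esub> s j \<odot>\<^bsub>M\<^esub> g"
    by metis
  have hH: "h \<in> {1..d} \<rightarrow> H" and hM: "h \<in> {1..d} \<rightarrow> carrier M" and sR: "s \<in> {1..d} \<rightarrow> carrier R"
    using hs subH by auto
  define \<sigma> where "\<sigma> = (\<Oplus>\<^bsub>R\<^esub>j\<in>{1..d}. \<kappa> j \<otimes>\<^bsub>R\<^esub> s j)"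
  have \<sigma>_fun: "(\<lambda>j. \<kappa> j \<otimes>\<^bsub>R\<^esub> s j) \<in> {1..d} \<rightarrow> carrier R" using \<kappa> sR by (auto simp: Pi_def)
  have \<sigma>: "\<sigma> \<in> carrier R" unfolding \<sigma>_def by (rule R.finsum_closed[OF \<sigma>_fun])
  have "\<sigma> = \<one>\<^bsub>R\<^esub>"
  proof -
    have sg: "(\<lambda>j. s j \<odot>\<^bsub>M\<^esub> g) \<in> {1..d} \<rightarrow> carrier M" using sR gM by (auto simp: Pi_def)
    have "g = lincomb M d (\<lambda>j. h j \<oplus>\<^bsub>M\<^esub> s j \<odot>\<^bsub>M\<^esub> g) \<kappa>"
      unfolding g_lin[symmetric] using hs hM sg \<kappa> by (subst g_lin, intro A.lincomb_cong) (auto simp: Pi_def)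
    also have "\<dots> = lincomb M d h \<kappa> \<oplus>\<^bsub>M\<^esub> lincomb M d (\<lambda>j. s j \<odot>\<^bsub>M\<^esub> g) \<kappa>"
      by (rule A.lincomb_add_vec[OF hM sg \<kappa>])
    also have "lincomb M d (\<lambda>j. s j \<odot>\<^bsub>M\<^esub> g) \<kappa> = \<sigma> \<odot>\<^bsub>M\<^esub> g"
      unfolding \<sigma>_def by (rule A.lincomb_smult_generator[OF gM \<kappa> sR])
    finally have eq: "g = lincomb M d h \<kappa> \<oplus>\<^bsub>M\<^esub> \<sigma> \<odot>\<^bsub>M\<^esub> g" .
    have lH: "lincomb M d h \<kappa> \<in> H" by (rule A.submodule_lincomb(2)[OF H hH \<kappa>])
    have lM: "lincomb M d h \<kappa> \<in> carrier M" and \<sigma>M: "\<sigma> \<odot>\<^bsub>M\<^esub> g \<in> carrier M" using lH subH \<sigma> gM by auto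
    have "g \<ominus>\<^bsub>M\<^esub> \<sigma> \<odot>\<^bsub>M\<^esub> g = lincomb M d h \<kappa>"
      by (subst (1) eq) (use lM \<sigma>M in \<open>simp add: A.M.minus_eq A.M.a_assoc A.M.r_neg\<close>)
    moreover have "g \<ominus>\<^bsub>M\<^esub> \<sigma> \<odot>\<^bsub>M\<^esub> g \<in> K"
      using minus_closed[OF K g(2) A.submoduleE(4)[OF K \<sigma> g(2)]] .
    ultimately have "g \<ominus>\<^bsub>M\<^esub> \<sigma> \<odot>\<^bsub>M\<^esub> g = \<zero>\<^bsub>M\<^esub>" using lH HK0 by simp
    then have "\<sigma> \<odot>\<^bsub>M\<^esub> g = \<one>\<^bsub>R\<^esub> \<odot>\<^bsub>M\<^esub> g" using A.minus_eq_zero_iff[OF gM \<sigma>M] gM by simp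
    then show ?thesis using torsion_free[OF \<sigma> R.one_closed] by blast
  qed
  have "\<exists>i\<in>{1..d}. \<kappa> i \<in> Units R"
  proof (rule ccontr)
    assume "\<not> ?thesis"
    then have dvd: "int p dvd \<kappa> i 1" if "i \<in> {1..d}" for i
      using that \<kappa> padic_units prime_imp_coprime[OF prime_int_p(1)] coprime_commute funcset_mem by metis
    have "\<sigma> 1 = (\<Sum>j\<in>{1..d}. (\<kappa> j \<otimes>\<^bsub>R\<^esub> s j) 1) mod int p"
      unfolding \<sigma>_def using padic_finsum[OF _ \<sigma>_fun, of 1] by simp
    moreover have "int p dvd (\<Sum>j\<in>{1..d}. (\<kappa> j \<otimes>\<^bsub>R\<^esub> s j) 1)"
      using dvd by (intro dvd_sum) (simp add: padic_mult dvd_mod_iff)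
    ultimately have "\<sigma> 1 = 0" by simp
    then have "1 mod int p = 0" using \<open>\<sigma> = \<one>\<^bsub>R\<^esub>\<close> by (simp add: padic_one)
    then have "int p dvd 1" by (simp only: dvd_eq_mod_eq_0)
    then show False using prime_int_p(1) not_prime_unit by blast
  qed
  then obtain i0 where i0: "i0 \<in> {1..d}" "\<kappa> i0 \<in> Units R" by blast
  obtain d' where d': "d = Suc d'" using d(1) gr0_conv_Suc by blast
  define \<tau> where "\<tau> = Transposition.transpose i0 d"
  have \<tau>: "\<tau> permutes {1..d}" unfolding \<tau>_def using i0(1) by (intro permutes_swap_id) auto
  have \<tau>d: "\<tau> d = i0" by (simp add: \<tau>_def)
  have \<kappa>\<tau>: "\<kappa> \<circ> \<tau> \<in> {1..d} \<rightarrow> carrier R"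
    using \<kappa> permutes_in_image[OF \<tau>] by (auto simp: Pi_def simp del: atLeastAtMost_iff)
  have "lincomb (M\<lparr>carrier := ?A\<rparr>) d (b \<circ> \<tau>) (\<kappa> \<circ> \<tau>) = g"
    using MA.lincomb_permute[OF \<tau>, of b \<kappa>] bA \<kappa> g_MA by simp
  moreover have "is_basis R (M\<lparr>carrier := ?A\<rparr>) d (b \<circ> \<tau>)" by (rule MA.is_basis_permute[OF b \<tau>])
  ultimately have b': "is_basis R (M\<lparr>carrier := ?A\<rparr>) d ((b \<circ> \<tau>)(d := g))"
    using MA.is_basis_exchange_last[of d' "b \<circ> \<tau>" "\<kappa> \<circ> \<tau>"] \<kappa>\<tau> i0(2) \<tau>d unfolding d' by simp
  define b' where "b' = (b \<circ> \<tau>)(d := g)"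
  note b' = b'[folded b'_def]
  have b'A: "b' \<in> {1..d} \<rightarrow> ?A" using MA.is_basis_closed[OF b'] by simp
  define F where "F i = (if i \<le> m then f i else b' (i - m))" for i
  have "is_basis R M (m + d) F"
    unfolding F_def
  proof (rule A.is_basis_append[OF A.annihilator_submodule b' fm])
    fix x assume x: "x \<in> carrier M"
    have "\<pi> x \<in> carrier Q" unfolding Q_carrier using x by blast
    then obtain c where c: "c \<in> {1..m + 1} \<rightarrow>\<^sub>E carrier R" "\<pi> x = lincomb Q (m + 1) e c"
      using bspec[OF conjunct2[OF e[unfolded is_basis_def lincomb_def[symmetric]]]] by (metis ex1_implies_ex)
    have cR: "c \<in> {1..m + 1} \<rightarrow> carrier R" "c \<in> {1..m} \<rightarrow> carrier R" "c (m + 1) \<in> carrier R" using c(1) by auto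
    define y where "y = lincomb M m f c"
    have y: "y \<in> carrier M" unfolding y_def by (rule A.lincomb_closed[OF fm cR(2)])
    have cg: "c (m + 1) \<odot>\<^bsub>M\<^esub> g \<in> carrier M" "c (m + 1) \<odot>\<^bsub>M\<^esub> g \<in> K"
      using A.submoduleE(4)[OF K cR(3) g(2)] subK by blast+
    have "\<pi> x = \<pi> (y \<oplus>\<^bsub>M\<^esub> c (m + 1) \<odot>\<^bsub>M\<^esub> g)"
      using c(2) unfolding Q_lin[OF cR(1)] lin_Suc[OF cR(1)] y_def .
    then have "x \<ominus>\<^bsub>M\<^esub> (y \<oplus>\<^bsub>M\<^esub> c (m + 1) \<odot>\<^bsub>M\<^esub> g) \<in> H" using \<pi>_eq[OF x A.M.a_closed[OF y cg(1)]] by simp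
    then have "(x \<ominus>\<^bsub>M\<^esub> (y \<oplus>\<^bsub>M\<^esub> c (m + 1) \<odot>\<^bsub>M\<^esub> g)) \<oplus>\<^bsub>M\<^esub> c (m + 1) \<odot>\<^bsub>M\<^esub> g \<in> ?A"
      using sumI cg(2) by blast
    also have "(x \<ominus>\<^bsub>M\<^esub> (y \<oplus>\<^bsub>M\<^esub> c (m + 1) \<odot>\<^bsub>M\<^esub> g)) \<oplus>\<^bsub>M\<^esub> c (m + 1) \<odot>\<^bsub>M\<^esub> g = x \<ominus>\<^bsub>M\<^esub> y"
      using x y cg(1) by (simp add: A.M.minus_eq A.M.minus_add A.M.a_assoc A.M.l_neg)
    finally show "\<exists>c\<in>{1..m} \<rightarrow> carrier R. x \<ominus>\<^bsub>M\<^esub> lincomb M m f c \<in> ?A" using cR(2) unfolding y_def by blast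
  next
    fix c i assume c: "c \<in> {1..m} \<rightarrow> carrier R" and cA: "lincomb M m f c \<in> ?A" and i: "i \<in> {1..m}"
    obtain h' r where h': "h' \<in> H" "r \<in> carrier R" "lincomb M m f c = h' \<oplus>\<^bsub>M\<^esub> r \<odot>\<^bsub>M\<^esub> g"
      using sumD[OF cA] K_span by metis
    have h'M: "h' \<in> carrier M" using h'(1) subH by blast
    define c1 where "c1 j = (if j = m + 1 then \<zero>\<^bsub>R\<^esub> else c j)" for j
    have c1: "c1 \<in> {1..m + 1} \<rightarrow> carrier R" using c by (auto simp: c1_def Pi_def)
    have "lincomb M m f c1 = lincomb M m f c" using c by (intro A.lincomb_cong fm) (auto simp: c1_def)
    then have 1: "lincomb M (m + 1) f c1 = lincomb M m f c"
      using lin_Suc[OF c1] gM A.lincomb_closed[OF fm c] by (simp add: c1_def)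
    have m1: "m + 1 \<in> {1..m + 1}" by simp
    have 2: "lincomb M (m + 1) f (\<lambda>j. if j = m + 1 then r else \<zero>\<^bsub>R\<^esub>) = r \<odot>\<^bsub>M\<^esub> g"
      using A.lincomb_delta[OF fm1 m1 h'(2)] f_last by simp
    have "lincomb M m f c \<ominus>\<^bsub>M\<^esub> r \<odot>\<^bsub>M\<^esub> g = h'"
      unfolding h'(3) using h'M h'(2) gM by (simp add: A.M.minus_eq A.M.a_assoc A.M.r_neg)
    then have "c1 i = (\<lambda>j. if j = m + 1 then r else \<zero>\<^bsub>R\<^esub>) i"
      using i h'(1,2) by (intro uniq c1) (auto simp only: 1 2, auto)
    then show "c i = \<zero>\<^bsub>R\<^esub>" using i by (simp add: c1_def)
  qed
  moreover have FN: "F (m + d) = g" using d(1) by (simp add: F_def b'_def)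
  moreover have "F i \<in> ?A" if "i \<in> {1..m + d}" "i \<notin> {1..m}" for i
  proof -
    have "\<not> i \<le> m" "i - m \<in> {1..d}" using that unfolding atLeastAtMost_iff by arith+
    then show ?thesis using funcset_mem[OF b'A] by (simp add: F_def)
  qed
  moreover have "F i \<otimes>\<^bsub>M\<^esub> F j = \<Theta> i j \<odot>\<^bsub>M\<^esub> F (m + d)" if "i \<in> {1..m}" "j \<in> {1..m}" for i j
    unfolding FN using f_table[OF that] that by (simp add: F_def)
  ultimately show "isomorphic R (std_algebra (m + d) m \<Theta>) M"
    using d(1) \<Theta> by (intro std_algebra_isomorphic_basis[OF M]) auto
qed

end

section \<open>The determinant as an invariant\<close>

context odd_prime
begin

definition unitv :: "nat \<Rightarrow> nat \<Rightarrow> nat \<Rightarrow> padic" where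
  "unitv N i = (\<lambda>k\<in>{1..N}. if k = i then \<one>\<^bsub>R\<^esub> else \<zero>\<^bsub>R\<^esub>)"

lemma unitv_mem: "unitv N i \<in> {1..N} \<rightarrow>\<^sub>E carrier R"
  unfolding unitv_def by auto

lemma unitv_apply: "k \<in> {1..N} \<Longrightarrow> unitv N i k = (if k = i then \<one>\<^bsub>R\<^esub> else \<zero>\<^bsub>R\<^esub>)"
  by (simp add: unitv_def)

lemma pform_unitv:
  assumes \<Theta>: "pmat m \<Theta>" and m: "m \<le> N" and i: "i \<in> {1..m}"
  shows "pform m \<Theta> (unitv N i) y = papply m \<Theta> y i"
  unfolding pform_def papply_def
proof (rule of_seq_eqI)
  fix n
  have "[(\<Sum>k\<in>{1..m}. \<Sum>j\<in>{1..m}. \<Theta> k j n * unitv N i k n * y j n) =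
      (\<Sum>k\<in>{1..m}. \<Sum>j\<in>{1..m}. \<Theta> k j n * (if k = i then 1 else 0) * y j n)] (mod int p ^ n)"
    using m by (intro cong_sum cong_mult) (auto simp: unitv_apply padic_one padic_zero)
  also have "(\<Sum>k\<in>{1..m}. \<Sum>j\<in>{1..m}. \<Theta> k j n * (if k = i then 1 else 0) * y j n) =
      (\<Sum>k\<in>{1..m}. if k = i then \<Sum>j\<in>{1..m}. \<Theta> k j n * y j n else 0)"
    by (intro sum.cong refl) simp
  also have "\<dots> = (\<Sum>j\<in>{1..m}. \<Theta> i j n * y j n)" using i by simp
  finally show "[(\<Sum>k\<in>{1..m}. \<Sum>j\<in>{1..m}. \<Theta> k j n * unitv N i k n * y j n) =
      (\<Sum>j\<in>{1..m}. \<Theta> i j n * y j n)] (mod int p ^ n)" .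
qed

lemma papply_unitv:
  assumes \<Theta>: "pmat m \<Theta>" and m: "m \<le> N" and i: "i \<in> {1..m}" and j: "j \<in> {1..m}"
  shows "papply m \<Theta> (unitv N j) i = \<Theta> i j"
proof -
  have "papply m \<Theta> (unitv N j) i = of_seq (\<Theta> i j)"
    unfolding papply_def
  proof (rule of_seq_eqI)
    fix n
    have "[(\<Sum>k\<in>{1..m}. \<Theta> i k n * unitv N j k n) = (\<Sum>k\<in>{1..m}. \<Theta> i k n * (if k = j then 1 else 0))] (mod int p ^ n)"
      using m by (intro cong_sum cong_mult) (auto simp: unitv_apply padic_one padic_zero)
    also have "(\<Sum>k\<in>{1..m}. \<Theta> i k n * (if k = j then 1 else 0)) = (\<Sum>k\<in>{1..m}. if k = j then \<Theta> i k n else 0)"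
      by (intro sum.cong refl) simp
    also have "\<dots> = \<Theta> i j n" using j by simp
    finally show "[(\<Sum>k\<in>{1..m}. \<Theta> i k n * unitv N j k n) = \<Theta> i j n] (mod int p ^ n)" .
  qed
  also have "\<dots> = \<Theta> i j" using \<Theta> i j by (intro of_seq_id) (auto simp: pmat_def)
  finally show ?thesis .
qed

lemma unitv_table:
  assumes \<Theta>: "pmat m \<Theta>" and m: "m \<le> N" and i: "i \<in> {1..m}" and j: "j \<in> {1..m}"
  shows "unitv N i \<otimes>\<^bsub>std_algebra N m \<Theta>\<^esub> unitv N j = \<Theta> i j \<odot>\<^bsub>std_algebra N m \<Theta>\<^esub> unitv N N"
proof
  fix k
  have "\<Theta> i j \<in> carrier R" using \<Theta> i j by (auto simp: pmat_def)
  then show "(unitv N i \<otimes>\<^bsub>std_algebra N m \<Theta>\<^esub> unitv N j) k = (\<Theta> i j \<odot>\<^bsub>std_algebra N m \<Theta>\<^esub> unitv N N) k"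
    unfolding std_algebra_simps pform_unitv[OF \<Theta> m i] papply_unitv[OF \<Theta> m i j]
    by (simp add: unitv_def)
qed

lemma unimodular_unit_entry:
  assumes m: "0 < m" and \<Theta>: "unimodular R m \<Theta>"
  shows "\<exists>i\<in>{1..m}. \<exists>j\<in>{1..m}. \<Theta> i j \<in> Units R"
proof (rule ccontr)
  assume no: "\<not> ?thesis"
  have pm: "pmat m \<Theta>" and cop: "coprime (det (lev m \<Theta> 1)) (int p)" using \<Theta> by (simp_all add: unimodular_iff)
  have dvd: "int p dvd \<Theta> i j 1" if "i \<in> {1..m}" "j \<in> {1..m}" for i j
  proof -
    have "\<Theta> i j \<in> carrier R" "\<Theta> i j \<notin> Units R" using that pm no by (auto simp: pmat_def)
    then have "\<not> coprime (\<Theta> i j 1) (int p)" using padic_units by blast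
    then show ?thesis using prime_imp_coprime[OF prime_int_p(1)] coprime_commute by blast
  qed
  have "mat_cong (int p) (lev m \<Theta> 1) (0\<^sub>m m m)"
  proof (rule mat_congI[of _ m m])
    fix i j assume "i < m" "j < m"
    then show "[lev m \<Theta> 1 $$ (i, j) = 0\<^sub>m m m $$ (i, j)] (mod int p)"
      using dvd[of "Suc i" "Suc j"] by (simp add: lev_def cong_0_iff)
  qed auto
  then have "[det (lev m \<Theta> 1) = 0] (mod int p)" using mat_cong_det[of "int p" "lev m \<Theta> 1" "0\<^sub>m m m"
      m] m by simp
  then have "int p dvd det (lev m \<Theta> 1)" by (simp add: cong_0_iff)
  then have "int p dvd 1" using cop by (metis coprime_common_divisor dvd_refl)
  then show False using prime_int_p(1) not_prime_unit by blast
qed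

theorem std_algebra_isomorphic_det:
  assumes m: "0 < m" "m < N" and \<Theta>: "unimodular R m \<Theta>" and \<Xi>: "pmat m \<Xi>"
    and iso: "isomorphic R (std_algebra N m \<Theta>) (std_algebra N m \<Xi>)"
  shows "\<exists>u\<in>Units R. \<exists>c\<in>Units R.
    u [^]\<^bsub>R\<^esub> m \<otimes>\<^bsub>R\<^esub> ring_det R m \<Theta> = c \<otimes>\<^bsub>R\<^esub> c \<otimes>\<^bsub>R\<^esub> ring_det R m \<Xi>"
proof -
  have pm: "pmat m \<Theta>" using \<Theta> by (simp add: unimodular_iff)
  have mN: "m \<le> N" and NN: "N \<in> {1..N}" and le: "\<And>i. i \<in> {1..m} \<Longrightarrow> i \<in> {1..N}" using m by auto
  let ?S = "std_algebra N m \<Theta>" and ?T = "std_algebra N m \<Xi>" and ?V = "{1..N} \<rightarrow>\<^sub>E carrier R"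
  obtain h where h: "h \<in> algebra_iso R ?S ?T" using iso by (auto simp: isomorphic_def)
  have bij: "bij_betw h ?V ?V" using h by (simp add: algebra_iso_def std_algebra_simps)
  have hV: "h x \<in> ?V" if "x \<in> ?V" for x using bij that by (rule bij_betw_apply)
  have h_mult: "h (x \<otimes>\<^bsub>?S\<^esub> y) = h x \<otimes>\<^bsub>?T\<^esub> h y" if "x \<in> ?V" "y \<in> ?V" for x y
    using h that unfolding algebra_iso_def std_algebra_simps(1) by blast
  have h_smult: "h (r \<odot>\<^bsub>?S\<^esub> x) = r \<odot>\<^bsub>?T\<^esub> h x" if "r \<in> carrier R" "x \<in> ?V" for r x
    using h that unfolding algebra_iso_def std_algebra_simps(1) by blast
  define w where "w = h (unitv N N)"
  have w: "w \<in> ?V" unfolding w_def by (rule hV[OF unitv_mem])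
  define u where "u = w N"
  have u: "u \<in> carrier R" unfolding u_def by (rule PiE_mem[OF w NN])
  define C where "C k i = h (unitv N i) k" for k i
  have C: "pmat m C"
    unfolding pmat_def C_def using PiE_mem[OF hV[OF unitv_mem] le] by blast
  have eq: "h (unitv N i) \<otimes>\<^bsub>?T\<^esub> h (unitv N j) = \<Theta> i j \<odot>\<^bsub>?T\<^esub> w" if i: "i \<in> {1..m}" and j: "j \<in> {1..m}" for i j
  proof -
    have "\<Theta> i j \<in> carrier R" using pm i j by (auto simp: pmat_def)
    then show ?thesis
      using arg_cong[OF unitv_table[OF pm mN i j], of h]
      unfolding h_mult[OF unitv_mem unitv_mem] w_def by (simp only: h_smult[OF _ unitv_mem])
  qed
  have entry: "pform m \<Xi> (h (unitv N i)) (h (unitv N j)) = \<Theta> i j \<otimes>\<^bsub>R\<^esub> u" if i: "i \<in> {1..m}" and j: "j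
      \<in> {1..m}" for i j
    using fun_cong[OF eq[OF i j], of N] NN unfolding std_algebra_simps u_def by simp
  have cong: "pcongruent m u \<Theta> \<Xi> C"
    unfolding pcongruent_def
  proof (intro allI ballI)
    fix n k l assume k: "k \<in> {1..m}" and l: "l \<in> {1..m}"
    have "(\<Sum>i\<in>{1..m}. \<Sum>j\<in>{1..m}. C i k n * \<Xi> i j n * C j l n) =
        (\<Sum>i\<in>{1..m}. \<Sum>j\<in>{1..m}. \<Xi> i j n * h (unitv N k) i n * h (unitv N l) j n)"
      by (simp add: C_def mult_ac)
    then show "[(\<Sum>i\<in>{1..m}. \<Sum>j\<in>{1..m}. C i k n * \<Xi> i j n * C j l n) = u n * \<Theta> k l n] (mod int p ^ n)"
      using fun_cong[OF entry[OF k l], of n] by (simp add: pform_def of_seq_def padic_mult cong_def mult.commute)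
  qed
  obtain i j where ij: "i \<in> {1..m}" "j \<in> {1..m}" "\<Theta> i j \<in> Units R" using unimodular_unit_entry[OF m(1) \<Theta>] by blast
  have w0: "w k = \<zero>\<^bsub>R\<^esub>" if k: "k \<in> {1..N}" "k \<noteq> N" for k
  proof -
    have wk: "w k \<in> carrier R" by (rule PiE_mem[OF w k(1)])
    have "\<Theta> i j \<otimes>\<^bsub>R\<^esub> w k = \<zero>\<^bsub>R\<^esub>"
      using fun_cong[OF eq[OF ij(1,2)], of k] k unfolding std_algebra_simps by simp
    then have "inv\<^bsub>R\<^esub> \<Theta> i j \<otimes>\<^bsub>R\<^esub> (\<Theta> i j \<otimes>\<^bsub>R\<^esub> w k) = \<zero>\<^bsub>R\<^esub>" using ij(3) by simp
    then show ?thesis using ij(3) wk by (simp add: R.m_assoc[symmetric] R.Units_closed)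
  qed
  have wu: "w = u \<odot>\<^bsub>?T\<^esub> unitv N N"
  proof
    fix k
    show "w k = (u \<odot>\<^bsub>?T\<^esub> unitv N N) k"
    proof (cases "k \<in> {1..N}")
      case True
      then show ?thesis using w0[OF True] u u_def unfolding std_algebra_simps by (simp add: unitv_apply)
    next
      case False
      then show ?thesis unfolding std_algebra_simps restrict_def using PiE_arb[OF w False] by (simp only: if_False)
    qed
  qed
  have "unitv N N \<in> h ` ?V" unfolding bij_betw_imp_surj_on[OF bij] by (rule unitv_mem)
  then obtain g where g: "unitv N N = h g" "g \<in> ?V" by (rule imageE)
  have "h (u \<odot>\<^bsub>?S\<^esub> g) = h (unitv N N)" unfolding h_smult[OF u g(2)] g(1)[symmetric] wu[symmetric] by (rule w_def)
  moreover have ug: "u \<odot>\<^bsub>?S\<^esub> g \<in> ?V" using std_algebra_ops_closed[OF pm mN] u g(2)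
      unfolding ops_closed_def std_algebra_simps(1) by blast
  ultimately have "u \<odot>\<^bsub>?S\<^esub> g = unitv N N" using inj_onD[OF bij_betw_imp_inj_on[OF bij] _ _ unitv_mem] by blast
  then have "(u \<odot>\<^bsub>?S\<^esub> g) N = unitv N N N" by (rule fun_cong)
  then have "u \<otimes>\<^bsub>R\<^esub> g N = \<one>\<^bsub>R\<^esub>"
    unfolding std_algebra_simps restrict_apply'[OF NN] unitv_apply[OF NN] by simp
  moreover have gN: "g N \<in> carrier R" by (rule PiE_mem[OF g(2) NN])
  ultimately have uU: "u \<in> Units R" using u R.m_comm[OF u gN] unfolding Units_def by auto
  define c where "c = ring_det R m C"
  have c: "c \<in> carrier R" unfolding c_def by (rule ring_det_closed[OF C])
  have det: "u [^]\<^bsub>R\<^esub> m \<otimes>\<^bsub>R\<^esub> ring_det R m \<Theta> = c \<otimes>\<^bsub>R\<^esub> c \<otimes>\<^bsub>R\<^esub> ring_det R m \<Xi>"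
    unfolding c_def by (rule pcongruent_det[OF pm \<Xi> C u cong])
  have d\<Xi>: "ring_det R m \<Xi> \<in> carrier R" by (rule ring_det_closed[OF \<Xi>])
  have "u [^]\<^bsub>R\<^esub> m \<otimes>\<^bsub>R\<^esub> ring_det R m \<Theta> \<in> Units R"
    using \<Theta> uU by (intro R.Units_m_closed R.Units_pow_closed) (simp_all add: unimodular_def)
  then have "coprime ((c \<otimes>\<^bsub>R\<^esub> c \<otimes>\<^bsub>R\<^esub> ring_det R m \<Xi>) 1) (int p)" unfolding det padic_units by blast
  then have "coprime (c 1) (int p)" by (simp add: padic_mult)
  then have "c \<in> Units R" using c padic_units by blast
  then show ?thesis using uU det by blast
qed

lemma pform_add:
  "pform m \<Theta> (\<lambda>k. x k \<oplus>\<^bsub>R\<^esub> y k) z = pform m \<Theta> x z \<oplus>\<^bsub>R\<^esub> pform m \<Theta> y z"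
  unfolding pform_def of_seq_add
proof (rule of_seq_eqI)
  fix n
  have "[(\<Sum>i\<in>{1..m}. \<Sum>j\<in>{1..m}. \<Theta> i j n * (x i \<oplus>\<^bsub>R\<^esub> y i) n * z j n) =
      (\<Sum>i\<in>{1..m}. \<Sum>j\<in>{1..m}. \<Theta> i j n * (x i n + y i n) * z j n)] (mod int p ^ n)"
    by (intro cong_sum cong_mult) (auto simp: padic_add)
  then show "[(\<Sum>i\<in>{1..m}. \<Sum>j\<in>{1..m}. \<Theta> i j n * (x i \<oplus>\<^bsub>R\<^esub> y i) n * z j n) =
      (\<Sum>i\<in>{1..m}. \<Sum>j\<in>{1..m}. \<Theta> i j n * x i n * z j n) + (\<Sum>i\<in>{1..m}. \<Sum>j\<in>{1..m}. \<Theta> i j n * y i n * z j n)]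
      (mod int p ^ n)"
    by (simp add: distrib_left distrib_right sum.distrib)
qed

lemma pform_smult:
  assumes r: "r \<in> carrier R"
  shows "pform m \<Theta> (\<lambda>k. r \<otimes>\<^bsub>R\<^esub> x k) z = r \<otimes>\<^bsub>R\<^esub> pform m \<Theta> x z"
proof -
  have "r \<otimes>\<^bsub>R\<^esub> pform m \<Theta> x z = of_seq (\<lambda>n. r n * (\<Sum>i\<in>{1..m}. \<Sum>j\<in>{1..m}. \<Theta> i j n * x i n * z j n))"
    unfolding pform_def using of_seq_mult[of r] of_seq_id[OF r] by simp
  moreover have "pform m \<Theta> (\<lambda>k. r \<otimes>\<^bsub>R\<^esub> x k) z =
      of_seq (\<lambda>n. r n * (\<Sum>i\<in>{1..m}. \<Sum>j\<in>{1..m}. \<Theta> i j n * x i n * z j n))"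
    unfolding pform_def
  proof (rule of_seq_eqI)
    fix n
    have "[(\<Sum>i\<in>{1..m}. \<Sum>j\<in>{1..m}. \<Theta> i j n * (r \<otimes>\<^bsub>R\<^esub> x i) n * z j n) =
        (\<Sum>i\<in>{1..m}. \<Sum>j\<in>{1..m}. \<Theta> i j n * (r n * x i n) * z j n)] (mod int p ^ n)"
      by (intro cong_sum cong_mult) (auto simp: padic_mult)
    then show "[(\<Sum>i\<in>{1..m}. \<Sum>j\<in>{1..m}. \<Theta> i j n * (r \<otimes>\<^bsub>R\<^esub> x i) n * z j n) =
        r n * (\<Sum>i\<in>{1..m}. \<Sum>j\<in>{1..m}. \<Theta> i j n * x i n * z j n)] (mod int p ^ n)"
      by (simp add: sum_distrib_left mult_ac)
  qed
  ultimately show ?thesis by simp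
qed

lemma pform_zero: "pform m \<Theta> (\<lambda>k. \<zero>\<^bsub>R\<^esub>) z = \<zero>\<^bsub>R\<^esub>"
proof -
  have "pform m \<Theta> (\<lambda>k. \<zero>\<^bsub>R\<^esub>) z = of_seq (\<lambda>n. 0)"
    unfolding pform_def by (simp add: padic_zero)
  then show ?thesis by (simp only: padic_ops(4))
qed

lemma pform_commute:
  assumes "\<And>i j. i \<in> {1..m} \<Longrightarrow> j \<in> {1..m} \<Longrightarrow> \<Theta> i j = \<Theta> j i"
  shows "pform m \<Theta> x y = pform m \<Theta> y x"
  unfolding pform_def
proof (intro arg_cong[where f = of_seq] ext)
  fix n
  have "(\<Sum>i\<in>{1..m}. \<Sum>j\<in>{1..m}. \<Theta> i j n * x i n * y j n) = (\<Sum>j\<in>{1..m}. \<Sum>i\<in>{1..m}. \<Theta> i j n * x i n * y j n)"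
    by (rule sum.swap)
  also have "\<dots> = (\<Sum>j\<in>{1..m}. \<Sum>i\<in>{1..m}. \<Theta> j i n * y j n * x i n)"
  proof (intro sum.cong refl)
    fix i j assume "j \<in> {1..m}" "i \<in> {1..m}"
    then have "\<Theta> i j = \<Theta> j i" using assms by blast
    then show "\<Theta> i j n * x i n * y j n = \<Theta> j i n * y j n * x i n" by simp
  qed
  finally show "(\<Sum>i\<in>{1..m}. \<Sum>j\<in>{1..m}. \<Theta> i j n * x i n * y j n)
      = (\<Sum>i\<in>{1..m}. \<Sum>j\<in>{1..m}. \<Theta> i j n * y i n * x j n)" .
qed

lemma std_algebra_module: "module R (std_algebra N m \<Theta>)"
proof (rule moduleI)
  let ?S = "std_algebra N m \<Theta>" and ?V = "{1..N} \<rightarrow>\<^sub>E carrier R"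
  have V: "x k \<in> carrier R" if "x \<in> ?V" "k \<in> {1..N}" for x k using that by (rule PiE_mem)
  have ext: "restrict f {1..N} = restrict g {1..N}" if "\<And>k. k \<in> {1..N} \<Longrightarrow> f k = g k" for f g :: "nat \<Rightarrow> padic"
    using that by (rule restrict_ext)
  have ext': "restrict f {1..N} = x" if "x \<in> ?V" "\<And>k. k \<in> {1..N} \<Longrightarrow> f k = x k" for f x
  proof (rule PiE_ext[OF _ that(1)])
    show "restrict f {1..N} \<in> ?V" using that(2) V[OF that(1)] by simp
  qed (simp add: that(2))
  show "cring R" by (rule padic_cring)
  show "abelian_group ?S"
  proof (rule abelian_groupI; (unfold std_algebra_simps)?)
    show "(\<lambda>k\<in>{1..N}. \<zero>\<^bsub>R\<^esub>) \<in> ?V" by simp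
    fix x assume x: "x \<in> ?V"
    show "(\<lambda>k\<in>{1..N}. (\<lambda>k\<in>{1..N}. \<zero>\<^bsub>R\<^esub>) k \<oplus>\<^bsub>R\<^esub> x k) = x" by (rule ext'[OF x]) (simp add: V[OF x])
    show "\<exists>y\<in>?V. (\<lambda>k\<in>{1..N}. y k \<oplus>\<^bsub>R\<^esub> x k) = (\<lambda>k\<in>{1..N}. \<zero>\<^bsub>R\<^esub>)"
    proof
      show "(\<lambda>k\<in>{1..N}. \<ominus>\<^bsub>R\<^esub> x k) \<in> ?V" using V[OF x] by simp
      show "(\<lambda>k\<in>{1..N}. (\<lambda>k\<in>{1..N}. \<ominus>\<^bsub>R\<^esub> x k) k \<oplus>\<^bsub>R\<^esub> x k) = (\<lambda>k\<in>{1..N}. \<zero>\<^bsub>R\<^esub>)"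
        by (rule ext) (simp add: V[OF x] R.l_neg)
    qed
    fix y assume y: "y \<in> ?V"
    show "(\<lambda>k\<in>{1..N}. x k \<oplus>\<^bsub>R\<^esub> y k) \<in> ?V" using V[OF x] V[OF y] by simp
    show "(\<lambda>k\<in>{1..N}. x k \<oplus>\<^bsub>R\<^esub> y k) = (\<lambda>k\<in>{1..N}. y k \<oplus>\<^bsub>R\<^esub> x k)"
      by (rule ext) (simp add: V[OF x] V[OF y] R.a_comm)
    fix z assume z: "z \<in> ?V"
    show "(\<lambda>k\<in>{1..N}. (\<lambda>k\<in>{1..N}. x k \<oplus>\<^bsub>R\<^esub> y k) k \<oplus>\<^bsub>R\<^esub> z k) = (\<lambda>k\<in>{1..N}. x k \<oplus>\<^bsub>R\<^esub> (\<lambda>k\<in>{1..N}. y k \<oplus>\<^bsub>R\<^esub> z k) k)"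
      by (rule ext) (simp add: V[OF x] V[OF y] V[OF z] R.a_assoc)
  qed
  show "r \<odot>\<^bsub>?S\<^esub> x \<in> carrier ?S" if r: "r \<in> carrier R" and xS: "x \<in> carrier ?S" for r x
    using r V[OF xS[unfolded std_algebra_simps]] unfolding std_algebra_simps by simp
  show "\<one>\<^bsub>R\<^esub> \<odot>\<^bsub>?S\<^esub> x = x" if xS: "x \<in> carrier ?S" for x
    unfolding std_algebra_simps
    by (rule ext'[OF xS[unfolded std_algebra_simps]]) (simp add: V[OF xS[unfolded std_algebra_simps]])
  show "(r \<oplus>\<^bsub>R\<^esub> s) \<odot>\<^bsub>?S\<^esub> x = r \<odot>\<^bsub>?S\<^esub> x \<oplus>\<^bsub>?S\<^esub> s \<odot>\<^bsub>?S\<^esub> x"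
    if "r \<in> carrier R" "s \<in> carrier R" and xS: "x \<in> carrier ?S" for r s x
    unfolding std_algebra_simps using that(1,2)
    by (intro ext) (simp add: V[OF xS[unfolded std_algebra_simps]] R.l_distr)
  show "r \<otimes>\<^bsub>R\<^esub> s \<odot>\<^bsub>?S\<^esub> x = r \<odot>\<^bsub>?S\<^esub> (s \<odot>\<^bsub>?S\<^esub> x)"
    if "r \<in> carrier R" "s \<in> carrier R" and xS: "x \<in> carrier ?S" for r s x
    unfolding std_algebra_simps using that(1,2)
    by (intro ext) (simp add: V[OF xS[unfolded std_algebra_simps]] R.m_assoc)
  show "r \<odot>\<^bsub>?S\<^esub> (x \<oplus>\<^bsub>?S\<^esub> y) = r \<odot>\<^bsub>?S\<^esub> x \<oplus>\<^bsub>?S\<^esub> r \<odot>\<^bsub>?S\<^esub> y"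
    if "r \<in> carrier R" and xS: "x \<in> carrier ?S" and yS: "y \<in> carrier ?S" for r x y
    unfolding std_algebra_simps using that(1)
    by (intro ext) (simp add: V[OF xS[unfolded std_algebra_simps]] V[OF yS[unfolded std_algebra_simps]] R.r_distr)
qed

lemma std_algebra_prod_prod:
  assumes "m < N"
  shows "(x \<otimes>\<^bsub>std_algebra N m \<Theta>\<^esub> y) \<otimes>\<^bsub>std_algebra N m \<Theta>\<^esub> z = \<zero>\<^bsub>std_algebra N m \<Theta>\<^esub>"
proof -
  have "pform m \<Theta> (x \<otimes>\<^bsub>std_algebra N m \<Theta>\<^esub> y) z = pform m \<Theta> (\<lambda>k. \<zero>\<^bsub>R\<^esub>) z"
    using assms by (intro pform_cong) (auto simp: std_algebra_simps)
  then have "pform m \<Theta> (x \<otimes>\<^bsub>std_algebra N m \<Theta>\<^esub> y) z = \<zero>\<^bsub>R\<^esub>" by (simp only: pform_zero)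
  then show ?thesis unfolding std_algebra_simps(2)[where y = z] std_algebra_simps(3)
    by (intro restrict_ext) (simp only: if_cancel)
qed

lemma std_algebra_algebra:
  assumes \<Theta>: "pmat m \<Theta>" "\<And>i j. i \<in> {1..m} \<Longrightarrow> j \<in> {1..m} \<Longrightarrow> \<Theta> i j = \<Theta> j i" and m: "m < N"
  shows "nonunital_comm_algebra R (std_algebra N m \<Theta>)"
proof (rule nonunital_comm_algebra.intro[OF std_algebra_module nonunital_comm_algebra_axioms.intro])
  let ?S = "std_algebra N m \<Theta>" and ?V = "{1..N} \<rightarrow>\<^sub>E carrier R"
  have V: "x k \<in> carrier R" if "x \<in> ?V" "k \<in> {1..N}" for x k using that by (rule PiE_mem)
  have le: "k \<in> {1..m} \<Longrightarrow> k \<in> {1..N}" for k using m by simp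
  have pf: "pform m \<Theta> x y \<in> carrier R" if "x \<in> ?V" "y \<in> ?V" for x y
    by (intro pform_closed[OF \<Theta>(1)] V[OF that(1)] V[OF that(2)] le)
  show closed: "x \<otimes>\<^bsub>?S\<^esub> y \<in> carrier ?S" if "x \<in> carrier ?S" "y \<in> carrier ?S" for x y
    using that pf unfolding std_algebra_simps by simp
  show comm: "x \<otimes>\<^bsub>?S\<^esub> y = y \<otimes>\<^bsub>?S\<^esub> x" for x y
  proof -
    have "pform m \<Theta> x y = pform m \<Theta> y x" by (rule pform_commute[OF \<Theta>(2)])
    then show ?thesis unfolding std_algebra_simps by (simp only:)
  qed
  show "(x \<otimes>\<^bsub>?S\<^esub> y) \<otimes>\<^bsub>?S\<^esub> z = x \<otimes>\<^bsub>?S\<^esub> (y \<otimes>\<^bsub>?S\<^esub> z)" for x y z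
    unfolding comm[of x "y \<otimes>\<^bsub>?S\<^esub> z"] std_algebra_prod_prod[OF m] ..
  show "(x \<oplus>\<^bsub>?S\<^esub> y) \<otimes>\<^bsub>?S\<^esub> z = x \<otimes>\<^bsub>?S\<^esub> z \<oplus>\<^bsub>?S\<^esub> y \<otimes>\<^bsub>?S\<^esub> z"
    if "x \<in> carrier ?S" "y \<in> carrier ?S" "z \<in> carrier ?S" for x y z
  proof -
    have "pform m \<Theta> (\<lambda>k\<in>{1..N}. x k \<oplus>\<^bsub>R\<^esub> y k) z = pform m \<Theta> x z \<oplus>\<^bsub>R\<^esub> pform m \<Theta> y z"
      unfolding pform_add[symmetric] using le by (intro pform_cong) simp_all
    then show ?thesis unfolding std_algebra_simps by (intro restrict_ext) simp
  qed
  show "(r \<odot>\<^bsub>?S\<^esub> x) \<otimes>\<^bsub>?S\<^esub> y = r \<odot>\<^bsub>?S\<^esub> (x \<otimes>\<^bsub>?S\<^esub> y)"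
    if "r \<in> carrier R" "x \<in> carrier ?S" "y \<in> carrier ?S" for r x y
  proof -
    have "pform m \<Theta> (\<lambda>k\<in>{1..N}. r \<otimes>\<^bsub>R\<^esub> x k) y = r \<otimes>\<^bsub>R\<^esub> pform m \<Theta> x y"
      unfolding pform_smult[OF that(1), symmetric] using le by (intro pform_cong) simp_all
    then show ?thesis unfolding std_algebra_simps using that(1) by (intro restrict_ext) simp
  qed
qed


lemma std_algebra_finsum:
  assumes "finite I" "f \<in> I \<rightarrow> ({1..N} \<rightarrow>\<^sub>E carrier R)" "k \<in> {1..N}"
  shows "finsum (std_algebra N m \<Theta>) f I k = (\<Oplus>\<^bsub>R\<^esub>i\<in>I. f i k)"
proof -
  let ?S = "std_algebra N m \<Theta>"
  interpret S: module R ?S by (rule std_algebra_module)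
  show ?thesis
    using assms(1,2)
  proof (induction I rule: finite_induct)
    case empty
    then show ?case using assms(3) by (simp add: std_algebra_simps)
  next
    case (insert x F)
    have f: "f \<in> F \<rightarrow> carrier ?S" "f x \<in> carrier ?S" using insert.prems by (auto simp: std_algebra_simps)
    have fk: "f i k \<in> carrier R" if "i \<in> insert x F" for i
      using PiE_mem[OF funcset_mem[OF insert.prems that] assms(3)] .
    have "finsum ?S f (insert x F) k = f x k \<oplus>\<^bsub>R\<^esub> finsum ?S f F k"
      using insert f assms(3) by (simp add: std_algebra_simps(4))
    also have "finsum ?S f F k = (\<Oplus>\<^bsub>R\<^esub>i\<in>F. f i k)" using insert by (intro insert.IH) blast
    also have "f x k \<oplus>\<^bsub>R\<^esub> (\<Oplus>\<^bsub>R\<^esub>i\<in>F. f i k) = (\<Oplus>\<^bsub>R\<^esub>i\<in>insert x F. f i k)"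
      using insert.hyps fk by (intro R.finsum_insert[symmetric]) auto
    finally show ?case .
  qed
qed

lemma lincomb_unitv:
  assumes \<sigma>: "inj_on \<sigma> {1..n}" and c: "c \<in> {1..n} \<rightarrow> carrier R" and k: "k \<in> {1..N}"
  shows "i \<in> {1..n} \<Longrightarrow> k = \<sigma> i \<Longrightarrow> lincomb (std_algebra N m \<Theta>) n (\<lambda>i. unitv N (\<sigma> i)) c k = c i"
    and "k \<notin> \<sigma> ` {1..n} \<Longrightarrow> lincomb (std_algebra N m \<Theta>) n (\<lambda>i. unitv N (\<sigma> i)) c k = \<zero>\<^bsub>R\<^esub>"
proof -
  let ?S = "std_algebra N m \<Theta>"
  interpret S: module R ?S by (rule std_algebra_module)
  have cR: "c i \<in> carrier R" if "i \<in> {1..n}" for i by (rule funcset_mem[OF c that])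
  have "c i \<odot>\<^bsub>?S\<^esub> unitv N (\<sigma> i) \<in> carrier ?S" if "i \<in> {1..n}" for i
    using unitv_mem cR[OF that] by (intro S.smult_closed) (simp_all add: std_algebra_simps)
  then have "lincomb ?S n (\<lambda>i. unitv N (\<sigma> i)) c k = (\<Oplus>\<^bsub>R\<^esub>i\<in>{1..n}. (c i \<odot>\<^bsub>?S\<^esub> unitv N (\<sigma> i)) k)"
    unfolding lincomb_def using k by (intro std_algebra_finsum) (auto simp: std_algebra_simps(1))
  also have "\<dots> = (\<Oplus>\<^bsub>R\<^esub>i\<in>{1..n}. if k = \<sigma> i then c i else \<zero>\<^bsub>R\<^esub>)"
  proof (rule R.finsum_cong')
    fix i assume i: "i \<in> {1..n}"
    show "(c i \<odot>\<^bsub>?S\<^esub> unitv N (\<sigma> i)) k = (if k = \<sigma> i then c i else \<zero>\<^bsub>R\<^esub>)"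
      unfolding std_algebra_simps restrict_apply'[OF k] unitv_apply[OF k] using cR[OF i] by simp
  qed (use cR in auto)
  finally have eq: "lincomb ?S n (\<lambda>i. unitv N (\<sigma> i)) c k = (\<Oplus>\<^bsub>R\<^esub>i\<in>{1..n}. if k = \<sigma> i then c i else \<zero>\<^bsub>R\<^esub>)" .
  show "lincomb ?S n (\<lambda>i. unitv N (\<sigma> i)) c k = c i" if i: "i \<in> {1..n}" "k = \<sigma> i"
  proof -
    have "(\<Oplus>\<^bsub>R\<^esub>j\<in>{1..n}. if k = \<sigma> j then c j else \<zero>\<^bsub>R\<^esub>) = (\<Oplus>\<^bsub>R\<^esub>j\<in>{1..n}. if i = j then c j else \<zero>\<^bsub>R\<^esub>)"
    proof (rule R.finsum_cong')
      fix j assume j: "j \<in> {1..n}"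
      have "k = \<sigma> j \<longleftrightarrow> i = j" unfolding i(2) using inj_on_eq_iff[OF \<sigma> i(1) j] .
      then show "(if k = \<sigma> j then c j else \<zero>\<^bsub>R\<^esub>) = (if i = j then c j else \<zero>\<^bsub>R\<^esub>)" by simp
    qed (use cR in auto)
    also have "\<dots> = c i" by (rule R.finsum_singleton[OF i(1) _ c]) simp
    finally show ?thesis unfolding eq .
  qed
  show "lincomb ?S n (\<lambda>i. unitv N (\<sigma> i)) c k = \<zero>\<^bsub>R\<^esub>" if no: "k \<notin> \<sigma> ` {1..n}"
  proof -
    have "(\<Oplus>\<^bsub>R\<^esub>j\<in>{1..n}. if k = \<sigma> j then c j else \<zero>\<^bsub>R\<^esub>) = (\<Oplus>\<^bsub>R\<^esub>j\<in>{1..n}. \<zero>\<^bsub>R\<^esub>)"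
      using no by (intro R.finsum_cong') (auto simp del: atLeastAtMost_iff)
    also have "\<dots> = \<zero>\<^bsub>R\<^esub>" by (rule R.finsum_zero)
    finally show ?thesis unfolding eq .
  qed
qed

lemma std_algebra_minus:
  assumes "x \<in> {1..N} \<rightarrow>\<^sub>E carrier R" "y \<in> {1..N} \<rightarrow>\<^sub>E carrier R" "k \<in> {1..N}"
  shows "(x \<ominus>\<^bsub>std_algebra N m \<Theta>\<^esub> y) k = x k \<ominus>\<^bsub>R\<^esub> y k"
proof -
  let ?S = "std_algebra N m \<Theta>"
  interpret S: module R ?S by (rule std_algebra_module)
  have yk: "y j \<in> carrier R" if "j \<in> {1..N}" for j by (rule PiE_mem[OF assms(2) that])
  define z where "z = (\<lambda>j\<in>{1..N}. \<ominus>\<^bsub>R\<^esub> y j)"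
  have z: "z \<in> carrier ?S" unfolding z_def std_algebra_simps using yk by simp
  have yS: "y \<in> carrier ?S" using assms(2) by (simp add: std_algebra_simps)
  have "z \<oplus>\<^bsub>?S\<^esub> y = \<zero>\<^bsub>?S\<^esub>"
    unfolding z_def std_algebra_simps using yk by (intro restrict_ext) (simp add: R.l_neg)
  then have "\<ominus>\<^bsub>?S\<^esub> y = z" using yS z by (intro S.M.minus_equality)
  then show ?thesis
    unfolding S.M.minus_eq R.minus_eq using assms(3) by (simp add: std_algebra_simps z_def)
qed

lemma std_algebra_annihilator:
  assumes \<Theta>: "unimodular R m \<Theta>" "\<And>i j. i \<in> {1..m} \<Longrightarrow> j \<in> {1..m} \<Longrightarrow> \<Theta> i j = \<Theta> j i" and m: "m < N"
  shows "annihilator (std_algebra N m \<Theta>) = {x \<in> {1..N} \<rightarrow>\<^sub>E carrier R. \<forall>i\<in>{1..m}. x i = \<zero>\<^bsub>R\<^esub>}"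
proof -
  let ?S = "std_algebra N m \<Theta>" and ?V = "{1..N} \<rightarrow>\<^sub>E carrier R"
  have pm: "pmat m \<Theta>" using \<Theta>(1) by (simp add: unimodular_iff)
  have mN: "m \<le> N" and le: "\<And>i. i \<in> {1..m} \<Longrightarrow> i \<in> {1..N}" and NN: "N \<in> {1..N}" using m by auto
  show ?thesis
  proof (intro equalityI subsetI)
    fix x assume x: "x \<in> annihilator ?S"
    then have xV: "x \<in> ?V" by (simp add: annihilator_def std_algebra_simps)
    have Dx: "papply m \<Theta> x i = \<zero>\<^bsub>R\<^esub>" if i: "i \<in> {1..m}" for i
    proof -
      have "x \<otimes>\<^bsub>?S\<^esub> unitv N i = \<zero>\<^bsub>?S\<^esub>"
        using x unitv_mem unfolding annihilator_def std_algebra_simps(1) by blast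
      then have "(x \<otimes>\<^bsub>?S\<^esub> unitv N i) N = \<zero>\<^bsub>?S\<^esub> N" by (rule fun_cong)
      then have "pform m \<Theta> x (unitv N i) = \<zero>\<^bsub>R\<^esub>"
        unfolding std_algebra_simps restrict_apply'[OF NN] by simp
      then show ?thesis
        using pform_commute[OF \<Theta>(2), where x = x and y = "unitv N i"] pform_unitv[OF pm mN i, of x] by simp
    qed
    obtain D where D: "pmat m D" "pinverse m D \<Theta>"
      using pinverse_exists[OF pm unimodular_coprime_level[OF \<Theta>(1)]] by blast
    have "x i = \<zero>\<^bsub>R\<^esub>" if i: "i \<in> {1..m}" for i
    proof -
      have "x i = papply m D (papply m \<Theta> x) i"
        using papply_inverse[OF D(2) _ i, of x] PiE_mem[OF xV le] by simp
      also have "\<dots> = papply m D (\<lambda>j. \<zero>\<^bsub>R\<^esub>) i" by (rule papply_cong) (rule Dx)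
      also have "\<dots> = of_seq (\<lambda>n. 0)" unfolding papply_def by (simp add: padic_zero)
      finally show ?thesis by (simp only: padic_ops(4))
    qed
    then show "x \<in> {x \<in> ?V. \<forall>i\<in>{1..m}. x i = \<zero>\<^bsub>R\<^esub>}" using xV by blast
  next
    fix x assume x: "x \<in> {x \<in> ?V. \<forall>i\<in>{1..m}. x i = \<zero>\<^bsub>R\<^esub>}"
    have "pform m \<Theta> x y = \<zero>\<^bsub>R\<^esub>" for y
    proof -
      have "pform m \<Theta> x y = pform m \<Theta> (\<lambda>k. \<zero>\<^bsub>R\<^esub>) y" using x by (intro pform_cong) auto
      then show ?thesis by (simp only: pform_zero)
    qed
    then have "x \<otimes>\<^bsub>?S\<^esub> y = \<zero>\<^bsub>?S\<^esub>" for y unfolding std_algebra_simps by (intro restrict_ext) simp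
    then show "x \<in> annihilator ?S" using x unfolding annihilator_def std_algebra_simps(1) by blast
  qed
qed

theorem std_algebra_unimodular:
  assumes \<Theta>: "unimodular R m \<Theta>" "\<And>i j. i \<in> {1..m} \<Longrightarrow> j \<in> {1..m} \<Longrightarrow> \<Theta> i j = \<Theta> j i"
    and m: "0 < m" and d: "0 < d"
  shows "std_algebra (m + d) m \<Theta> \<in> unimodular_algebras p (m + d) d"
proof -
  define N where "N = m + d"
  let ?S = "std_algebra N m \<Theta>" and ?V = "{1..N} \<rightarrow>\<^sub>E carrier R"
  have pm: "pmat m \<Theta>" using \<Theta>(1) by (simp add: unimodular_iff)
  have mN: "m < N" "m \<le> N" and NN: "N \<in> {1..N}" and le: "\<And>i. i \<in> {1..m} \<Longrightarrow> i \<in> {1..N}"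
    and Nm: "N \<notin> {1..m}" using d by (auto simp: N_def)
  have alg: "nonunital_comm_algebra R ?S" by (rule std_algebra_algebra[OF pm \<Theta>(2) mN(1)])
  interpret S: nonunital_comm_algebra R ?S by (rule alg)
  let ?A = "annihilator ?S"
  have SV: "carrier ?S = ?V" by (simp add: std_algebra_simps)
  have A: "?A = {x \<in> ?V. \<forall>i\<in>{1..m}. x i = \<zero>\<^bsub>R\<^esub>}" by (rule std_algebra_annihilator[OF \<Theta> mN(1)])
  have Vk: "x k \<in> carrier R" if "x \<in> ?V" "k \<in> {1..N}" for x k using that by (rule PiE_mem)
  have eS: "unitv N i \<in> carrier ?S" for i unfolding SV by (rule unitv_mem)
  have coord0: "\<zero>\<^bsub>?S\<^esub> k = \<zero>\<^bsub>R\<^esub>" if "k \<in> {1..N}" for k using that by (simp add: std_algebra_simps)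
  have nil: "three_nilpotent ?S" unfolding three_nilpotent_def using std_algebra_prod_prod[OF mN(1)] by blast
  have lc: "lincomb ?S n (\<lambda>i. unitv N (\<sigma> i)) c \<in> ?V" if "c \<in> {1..n} \<rightarrow> carrier R" for n \<sigma> c
    unfolding SV[symmetric] using that eS by (intro S.lincomb_closed) blast+
  have basis: "is_basis R ?S N (\<lambda>i. unitv N (id i))"
  proof (rule S.is_basisI)
    show "(\<lambda>i. unitv N (id i)) \<in> {1..N} \<rightarrow> carrier ?S" using eS by blast
    fix x assume "x \<in> carrier ?S"
    then have x: "x \<in> ?V" unfolding SV .
    then have xR: "x \<in> {1..N} \<rightarrow> carrier R" by blast
    have "x = lincomb ?S N (\<lambda>i. unitv N (id i)) x"
    proof (rule PiE_ext[OF x lc[OF xR]])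
      fix k assume k: "k \<in> {1..N}"
      show "x k = lincomb ?S N (\<lambda>i. unitv N (id i)) x k"
        using lincomb_unitv(1)[OF inj_on_id xR k k] by simp
    qed
    then show "\<exists>c\<in>{1..N} \<rightarrow> carrier R. x = lincomb ?S N (\<lambda>i. unitv N (id i)) c" using xR by blast
  next
    fix c i assume c: "c \<in> {1..N} \<rightarrow> carrier R" and z: "lincomb ?S N (\<lambda>i. unitv N (id i)) c = \<zero>\<^bsub>?S\<^esub>"
        and i: "i \<in> {1..N}"
    show "c i = \<zero>\<^bsub>R\<^esub>"
      using lincomb_unitv(1)[OF inj_on_id c i i, where m = m and \<Theta> = \<Theta>] unfolding z coord0[OF i] by simp
  qed
  have basisA: "is_basis R (?S\<lparr>carrier := ?A\<rparr>) d (\<lambda>i. unitv N (m + i))"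
  proof -
    interpret A: module R "?S\<lparr>carrier := ?A\<rparr>"
      by (rule submodule.submodule_is_module[OF S.annihilator_submodule S.module_axioms])
    have inj: "inj_on (\<lambda>i. m + i) {1..d}" by (simp add: inj_on_def)
    have mi: "m + i \<in> {1..N}" if "i \<in> {1..d}" for i using that by (simp add: N_def)
    have bA: "(\<lambda>i. unitv N (m + i)) \<in> {1..d} \<rightarrow> ?A"
    proof
      fix i assume i: "i \<in> {1..d}"
      have "unitv N (m + i) j = \<zero>\<^bsub>R\<^esub>" if "j \<in> {1..m}" for j
        using that i unfolding unitv_apply[OF le[OF that]] by simp
      then show "unitv N (m + i) \<in> ?A" unfolding A using unitv_mem by blast
    qed
    show ?thesis
    proof (rule A.is_basisI)
      show "(\<lambda>i. unitv N (m + i)) \<in> {1..d} \<rightarrow> carrier (?S\<lparr>carrier := ?A\<rparr>)" using bA by simp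
      fix x assume "x \<in> carrier (?S\<lparr>carrier := ?A\<rparr>)"
      then have x: "x \<in> ?V" and x0: "\<And>i. i \<in> {1..m} \<Longrightarrow> x i = \<zero>\<^bsub>R\<^esub>" using A by auto
      define c where "c i = x (m + i)" for i
      have c: "c \<in> {1..d} \<rightarrow> carrier R" unfolding c_def using Vk[OF x mi] by blast
      have "x = lincomb ?S d (\<lambda>i. unitv N (m + i)) c"
      proof (rule PiE_ext[OF x lc[OF c]])
        fix k assume k: "k \<in> {1..N}"
        show "x k = lincomb ?S d (\<lambda>i. unitv N (m + i)) c k"
        proof (cases "k \<in> {1..m}")
          case True
          then have "k \<notin> (\<lambda>i. m + i) ` {1..d}" by auto
          then show ?thesis using lincomb_unitv(2)[OF inj c k] x0[OF True] by simp
        next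
          case False
          then have "k - m \<in> {1..d}" "k = m + (k - m)" using k unfolding N_def atLeastAtMost_iff by arith+
          then show ?thesis using lincomb_unitv(1)[OF inj c k, of "k - m"] by (simp add: c_def)
        qed
      qed
      then show "\<exists>c\<in>{1..d} \<rightarrow> carrier R. x = lincomb (?S\<lparr>carrier := ?A\<rparr>) d (\<lambda>i. unitv N (m + i)) c"
        using S.submodule_lincomb(1)[OF S.annihilator_submodule bA c] c by metis
    next
      fix c i assume c: "c \<in> {1..d} \<rightarrow> carrier R" and i: "i \<in> {1..d}"
        and "lincomb (?S\<lparr>carrier := ?A\<rparr>) d (\<lambda>i. unitv N (m + i)) c = \<zero>\<^bsub>?S\<lparr>carrier := ?A\<rparr>\<^esub>"
      then have z: "lincomb ?S d (\<lambda>i. unitv N (m + i)) c = \<zero>\<^bsub>?S\<^esub>"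
        using S.submodule_lincomb(1)[OF S.annihilator_submodule bA c] by simp
      show "c i = \<zero>\<^bsub>R\<^esub>"
        using lincomb_unitv(1)[OF inj c mi[OF i] i refl, where m = m and \<Theta> = \<Theta>]
            unfolding z coord0[OF mi[OF i]] by simp
    qed
  qed
  define K where "K = cyclic_span R ?S (unitv N N)"
  have K_mem: "x \<in> K \<longleftrightarrow> x \<in> ?V \<and> (\<forall>k\<in>{1..N}. k \<noteq> N \<longrightarrow> x k = \<zero>\<^bsub>R\<^esub>)" for x
  proof
    assume "x \<in> K"
    then obtain r where r: "r \<in> carrier R" "x = r \<odot>\<^bsub>?S\<^esub> unitv N N" by (auto simp: K_def cyclic_span_def)
    have "x \<in> ?V" unfolding r(2) SV[symmetric] by (rule S.smult_closed[OF r(1) eS])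
    moreover have "x k = \<zero>\<^bsub>R\<^esub>" if "k \<in> {1..N}" "k \<noteq> N" for k
      unfolding r(2) std_algebra_simps restrict_apply'[OF that(1)] unitv_apply[OF that(1)] using that r(1) by simp
    ultimately show "x \<in> ?V \<and> (\<forall>k\<in>{1..N}. k \<noteq> N \<longrightarrow> x k = \<zero>\<^bsub>R\<^esub>)" by blast
  next
    assume x: "x \<in> ?V \<and> (\<forall>k\<in>{1..N}. k \<noteq> N \<longrightarrow> x k = \<zero>\<^bsub>R\<^esub>)"
    have xN: "x N \<in> carrier R" using x NN Vk by blast
    have "x = x N \<odot>\<^bsub>?S\<^esub> unitv N N"
    proof (rule PiE_ext[of _ "{1..N}" "\<lambda>_. carrier R"])
      show "x \<in> ?V" using x by blast
      show "x N \<odot>\<^bsub>?S\<^esub> unitv N N \<in> ?V" unfolding SV[symmetric] by (rule S.smult_closed[OF xN eS])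
      fix k assume k: "k \<in> {1..N}"
      show "x k = (x N \<odot>\<^bsub>?S\<^esub> unitv N N) k"
        unfolding std_algebra_simps restrict_apply'[OF k] unitv_apply[OF k] using x k xN by simp
    qed
    then show "x \<in> K" unfolding K_def cyclic_span_def using xN by blast
  qed
  have submoduleI: "submodule {x \<in> ?V. \<forall>k\<in>J. x k = \<zero>\<^bsub>R\<^esub>} R ?S" if J: "J \<subseteq> {1..N}" for J
  proof (rule S.submoduleI; (unfold SV)?)
    show "\<zero>\<^bsub>?S\<^esub> \<in> {x \<in> ?V. \<forall>k\<in>J. x k = \<zero>\<^bsub>R\<^esub>}" using coord0 J S.M.zero_closed unfolding SV by blast
    fix x assume x: "x \<in> {x \<in> ?V. \<forall>k\<in>J. x k = \<zero>\<^bsub>R\<^esub>}"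
    then have xV: "x \<in> ?V" and x0: "\<And>k. k \<in> J \<Longrightarrow> x k = \<zero>\<^bsub>R\<^esub>" by auto
    have zV: "\<zero>\<^bsub>?S\<^esub> \<in> ?V" using S.M.zero_closed unfolding SV .
    have xS: "x \<in> carrier ?S" unfolding SV by (rule xV)
    have "\<ominus>\<^bsub>?S\<^esub> x = \<zero>\<^bsub>?S\<^esub> \<ominus>\<^bsub>?S\<^esub> x"
      unfolding S.M.minus_eq by (rule S.M.l_zero[OF S.M.a_inv_closed[OF xS], symmetric])
    moreover have "(\<zero>\<^bsub>?S\<^esub> \<ominus>\<^bsub>?S\<^esub> x) k = \<zero>\<^bsub>R\<^esub>" if "k \<in> J" for k
      using std_algebra_minus[OF zV xV, of k] that J x0[OF that] coord0 by (auto simp: R.minus_eq)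
    moreover have "\<ominus>\<^bsub>?S\<^esub> x \<in> ?V" using S.M.a_inv_closed[OF xS] unfolding SV .
    ultimately show "\<ominus>\<^bsub>?S\<^esub> x \<in> {x \<in> ?V. \<forall>k\<in>J. x k = \<zero>\<^bsub>R\<^esub>}" by simp
    fix y assume y: "y \<in> {x \<in> ?V. \<forall>k\<in>J. x k = \<zero>\<^bsub>R\<^esub>}"
    have "x \<oplus>\<^bsub>?S\<^esub> y \<in> ?V" using S.M.a_closed[of x y] x y unfolding SV by blast
    moreover have "(x \<oplus>\<^bsub>?S\<^esub> y) k = \<zero>\<^bsub>R\<^esub>" if "k \<in> J" for k
      unfolding std_algebra_simps restrict_apply'[OF subsetD[OF J that]] using x y that by simp
    ultimately show "x \<oplus>\<^bsub>?S\<^esub> y \<in> {x \<in> ?V. \<forall>k\<in>J. x k = \<zero>\<^bsub>R\<^esub>}" by simp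
  next
    fix r x assume r: "r \<in> carrier R" and x: "x \<in> {x \<in> ?V. \<forall>k\<in>J. x k = \<zero>\<^bsub>R\<^esub>}"
    have "r \<odot>\<^bsub>?S\<^esub> x \<in> ?V" using S.smult_closed[OF r, of x] x unfolding SV by blast
    moreover have "(r \<odot>\<^bsub>?S\<^esub> x) k = \<zero>\<^bsub>R\<^esub>" if "k \<in> J" for k
      unfolding std_algebra_simps restrict_apply'[OF subsetD[OF J that]] using x r that by simp
    ultimately show "r \<odot>\<^bsub>?S\<^esub> x \<in> {x \<in> ?V. \<forall>k\<in>J. x k = \<zero>\<^bsub>R\<^esub>}" by simp
  qed blast
  have K_set: "K = {x \<in> ?V. \<forall>k\<in>{1..N} - {N}. x k = \<zero>\<^bsub>R\<^esub>}" using K_mem by blast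
  have K: "submodule K R ?S" unfolding K_set by (rule submoduleI) blast
  have prod_K: "x \<otimes>\<^bsub>?S\<^esub> y \<in> K" if "x \<in> carrier ?S" "y \<in> carrier ?S" for x y
  proof -
    have "x \<otimes>\<^bsub>?S\<^esub> y \<in> ?V" using S.prod_closed[OF that] unfolding SV .
    moreover have "(x \<otimes>\<^bsub>?S\<^esub> y) k = \<zero>\<^bsub>R\<^esub>" if "k \<in> {1..N}" "k \<noteq> N" for k
      using that unfolding std_algebra_simps by simp
    ultimately show ?thesis using K_mem by blast
  qed
  have eNK: "unitv N N \<in> K" unfolding K_mem using unitv_mem by (auto simp: unitv_apply)
  have product: "product_module R ?S = K"
  proof
    show "product_module R ?S \<subseteq> K" unfolding product_module_def using K prod_K by blast
    obtain i j where ij: "i \<in> {1..m}" "j \<in> {1..m}" "\<Theta> i j \<in> Units R"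
      using unimodular_unit_entry[OF m \<Theta>(1)] by blast
    show "K \<subseteq> product_module R ?S"
      unfolding product_module_def
    proof (intro Inter_greatest subsetI)
      fix P x assume P: "P \<in> {P. submodule P R ?S \<and> (\<forall>x\<in>carrier ?S. \<forall>y\<in>carrier ?S. x \<otimes>\<^bsub>?S\<^esub> y \<in> P)}" and x: "x \<in> K"
      then have sub: "submodule P R ?S" by blast
      have "unitv N i \<otimes>\<^bsub>?S\<^esub> unitv N j \<in> P" using P eS by blast
      then have "\<Theta> i j \<odot>\<^bsub>?S\<^esub> unitv N N \<in> P" unfolding unitv_table[OF pm mN(2) ij(1,2)] .
      then have "inv\<^bsub>R\<^esub> \<Theta> i j \<odot>\<^bsub>?S\<^esub> (\<Theta> i j \<odot>\<^bsub>?S\<^esub> unitv N N) \<in> P"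
        by (rule S.submoduleE(4)[OF sub R.Units_inv_closed[OF ij(3)]])
      also have "inv\<^bsub>R\<^esub> \<Theta> i j \<odot>\<^bsub>?S\<^esub> (\<Theta> i j \<odot>\<^bsub>?S\<^esub> unitv N N) = unitv N N"
        using ij(3) eS by (simp add: S.smult_assoc1[symmetric] R.Units_closed)
      finally have "unitv N N \<in> P" .
      then show "x \<in> P" using x S.submoduleE(4)[OF sub] unfolding K_def cyclic_span_def by blast
    qed
  qed
  have cyc: "cyclic R ?S K" unfolding cyclic_def K_def using eS by blast
  have "unitv N N \<noteq> \<zero>\<^bsub>?S\<^esub>"
    using one_neq_zero fun_cong[of "unitv N N" "\<zero>\<^bsub>?S\<^esub>" N] unfolding coord0[OF NN] unitv_apply[OF NN] by auto
  then have K0: "K \<noteq> {\<zero>\<^bsub>?S\<^esub>}" using eNK by blast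
  have "is_defining_matrix R ?S m \<Theta>"
  proof -
    define H where "H = {x \<in> ?V. \<forall>k\<in>insert N {1..m}. x k = \<zero>\<^bsub>R\<^esub>}"
    have H: "submodule H R ?S" unfolding H_def by (rule submoduleI) (use NN le in blast)
    have HA: "H \<subseteq> ?A" unfolding H_def A by blast
    have KA: "K \<subseteq> ?A" unfolding K_set A using le Nm by blast
    have HK0: "H \<inter> K = {\<zero>\<^bsub>?S\<^esub>}"
    proof
      show "H \<inter> K \<subseteq> {\<zero>\<^bsub>?S\<^esub>}"
      proof
        fix x assume x: "x \<in> H \<inter> K"
        have "x = \<zero>\<^bsub>?S\<^esub>"
        proof (rule PiE_ext[of _ "{1..N}" "\<lambda>_. carrier R"])
          show "x \<in> ?V" using x K_mem by blast
          show "\<zero>\<^bsub>?S\<^esub> \<in> ?V" using S.M.zero_closed unfolding SV .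
          fix k assume k: "k \<in> {1..N}"
          show "x k = \<zero>\<^bsub>?S\<^esub> k" unfolding coord0[OF k] using x k K_mem unfolding H_def by blast
        qed
        then show "x \<in> {\<zero>\<^bsub>?S\<^esub>}" by simp
      qed
      have "\<zero>\<^bsub>?S\<^esub> \<in> H" "\<zero>\<^bsub>?S\<^esub> \<in> K"
        using S.M.zero_closed coord0 NN le unfolding SV H_def K_set by blast+
      then show "{\<zero>\<^bsub>?S\<^esub>} \<subseteq> H \<inter> K" by blast
    qed
    have HK: "H <+>\<^bsub>?S\<^esub> K = ?A"
    proof
      show "H <+>\<^bsub>?S\<^esub> K \<subseteq> ?A"
        unfolding set_add_def' using HA KA S.submoduleE(5)[OF S.annihilator_submodule] by blast
      show "?A \<subseteq> H <+>\<^bsub>?S\<^esub> K"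
      proof
        fix x assume x: "x \<in> ?A"
        then have xV: "x \<in> ?V" and x0: "\<And>k. k \<in> {1..m} \<Longrightarrow> x k = \<zero>\<^bsub>R\<^esub>" unfolding A by auto
        define y where "y = (\<lambda>k\<in>{1..N}. if k = N then \<zero>\<^bsub>R\<^esub> else x k)"
        define z where "z = (\<lambda>k\<in>{1..N}. if k = N then x N else \<zero>\<^bsub>R\<^esub>)"
        have yV: "y \<in> ?V" and zV: "z \<in> ?V" unfolding y_def z_def using Vk[OF xV] by auto
        have yH: "y \<in> H"
          unfolding H_def using yV x0 NN le by (auto simp: y_def simp del: atLeastAtMost_iff)
        have zK: "z \<in> K" unfolding K_mem using zV by (auto simp: z_def)
        have "x = y \<oplus>\<^bsub>?S\<^esub> z"
        proof (rule PiE_ext[OF xV])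
          show "y \<oplus>\<^bsub>?S\<^esub> z \<in> ?V" using S.M.a_closed[of y z] yV zV unfolding SV by blast
          fix k assume k: "k \<in> {1..N}"
          show "x k = (y \<oplus>\<^bsub>?S\<^esub> z) k"
            unfolding std_algebra_simps y_def z_def restrict_apply'[OF k] using Vk[OF xV k] Vk[OF xV NN] by simp
        qed
        then show "x \<in> H <+>\<^bsub>?S\<^esub> K" unfolding set_add_def' using yH zK by blast
      qed
    qed
    define Q where "Q = quotient_algebra ?S H"
    define \<pi> where "\<pi> x = H +>\<^bsub>?S\<^esub> x" for x
    have \<pi>_eq: "\<pi> x = \<pi> y \<longleftrightarrow> (\<forall>k\<in>insert N {1..m}. x k = y k)" if x: "x \<in> ?V" and y: "y \<in> ?V" for x y
    proof -
      have "\<pi> x = \<pi> y \<longleftrightarrow> x \<ominus>\<^bsub>?S\<^esub> y \<in> H"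
        unfolding \<pi>_def by (rule S.coset_eq_iff[OF H]) (use x y SV in blast)+
      also have "\<dots> \<longleftrightarrow> (\<forall>k\<in>insert N {1..m}. (x \<ominus>\<^bsub>?S\<^esub> y) k = \<zero>\<^bsub>R\<^esub>)"
        unfolding H_def using S.M.minus_closed[of x y] x y unfolding SV by blast
      also have "\<dots> \<longleftrightarrow> (\<forall>k\<in>insert N {1..m}. x k = y k)"
      proof (rule ball_cong[OF refl])
        fix k assume "k \<in> insert N {1..m}"
        then have k: "k \<in> {1..N}" using NN le by blast
        show "(x \<ominus>\<^bsub>?S\<^esub> y) k = \<zero>\<^bsub>R\<^esub> \<longleftrightarrow> x k = y k"
          unfolding std_algebra_minus[OF x y k] using Vk[OF x k] Vk[OF y k] by (rule R.r_right_minus_eq)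
      qed
      finally show ?thesis .
    qed
    have Q_mult: "\<pi> x \<otimes>\<^bsub>Q\<^esub> \<pi> y = \<pi> (x \<otimes>\<^bsub>?S\<^esub> y)" if "x \<in> carrier ?S" "y \<in> carrier ?S" for x y
      unfolding \<pi>_def Q_def by (rule S.quotient_mult[OF H HA that])
    have Q_smult: "r \<odot>\<^bsub>Q\<^esub> \<pi> x = \<pi> (r \<odot>\<^bsub>?S\<^esub> x)" if "r \<in> carrier R" "x \<in> carrier ?S" for r x
      unfolding \<pi>_def Q_def by (rule S.quotient_smult[OF H that])
    have Q_carrier: "carrier Q = \<pi> ` carrier ?S" unfolding Q_def \<pi>_def by (rule S.quotient_carrier)
    have Q_zero: "\<zero>\<^bsub>Q\<^esub> = \<pi> \<zero>\<^bsub>?S\<^esub>" unfolding Q_def \<pi>_def S.quotient_zero S.coset_zero[OF H] ..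
    define \<sigma> where "\<sigma> i = (if i \<le> m then i else N)" for i
    define e where "e i = \<pi> (unitv N (\<sigma> i))" for i
    have \<sigma>_inj: "inj_on \<sigma> {1..m + 1}" using mN(1) by (auto simp: inj_on_def \<sigma>_def split: if_splits)
    have \<sigma>_mem: "\<sigma> i \<in> insert N {1..m}" if "i \<in> {1..m + 1}" for i using that by (auto simp: \<sigma>_def)
    have \<sigma>_surj: "\<exists>i\<in>{1..m + 1}. k = \<sigma> i" if "k \<in> insert N {1..m}" for k
    proof (cases "k = N")
      case True
      then show ?thesis by (intro bexI[of _ "m + 1"]) (auto simp: \<sigma>_def)
    next
      case False
      then show ?thesis using that by (intro bexI[of _ k]) (auto simp: \<sigma>_def)
    qed
    have \<sigma>N: "\<sigma> i \<in> {1..N}" if "i \<in> {1..m + 1}" for i using \<sigma>_mem[OF that] NN le by blast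
    have e_last: "e (m + 1) = \<pi> (unitv N N)" by (simp add: e_def \<sigma>_def)
    have Q_lin: "lincomb Q (m + 1) e c = \<pi> (lincomb ?S (m + 1) (\<lambda>i. unitv N (\<sigma> i)) c)"
      if "c \<in> {1..m + 1} \<rightarrow> carrier R" for c
      unfolding Q_def \<pi>_def by (rule S.quotient_lincomb[OF H _ that]) (use eS in \<open>auto simp: e_def \<pi>_def\<close>)
    have Q_lin_eq: "\<pi> x = lincomb Q (m + 1) e c \<longleftrightarrow> (\<forall>i\<in>{1..m + 1}. x (\<sigma> i) = c i)"
      if x: "x \<in> ?V" and c: "c \<in> {1..m + 1} \<rightarrow> carrier R" for x c
    proof -
      have L: "lincomb ?S (m + 1) (\<lambda>i. unitv N (\<sigma> i)) c (\<sigma> i) = c i" if "i \<in> {1..m + 1}" for i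
        by (rule lincomb_unitv(1)[OF \<sigma>_inj c \<sigma>N[OF that] that refl])
      show ?thesis
        unfolding Q_lin[OF c] \<pi>_eq[OF x lc[OF c]] using L \<sigma>_mem \<sigma>_surj by metis
    qed
    have basisQ: "is_basis R Q (m + 1) e"
      unfolding is_basis_def lincomb_def[symmetric]
    proof (intro conjI ballI)
      show "e \<in> {1..m + 1} \<rightarrow> carrier Q" unfolding Q_carrier e_def using eS by blast
      fix s assume "s \<in> carrier Q"
      then obtain x where x: "x \<in> ?V" "s = \<pi> x" unfolding Q_carrier SV by blast
      show "\<exists>!c. c \<in> {1..m + 1} \<rightarrow>\<^sub>E carrier R \<and> s = lincomb Q (m + 1) e c"
      proof (rule ex1I[of _ "\<lambda>i\<in>{1..m + 1}. x (\<sigma> i)"], intro conjI)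
        show mem: "(\<lambda>i\<in>{1..m + 1}. x (\<sigma> i)) \<in> {1..m + 1} \<rightarrow>\<^sub>E carrier R" using Vk[OF x(1) \<sigma>N] by auto
        then have mem': "(\<lambda>i\<in>{1..m + 1}. x (\<sigma> i)) \<in> {1..m + 1} \<rightarrow> carrier R" by auto
        show "s = lincomb Q (m + 1) e (\<lambda>i\<in>{1..m + 1}. x (\<sigma> i))"
          unfolding x(2) Q_lin_eq[OF x(1) mem'] by simp
        fix c assume c: "c \<in> {1..m + 1} \<rightarrow>\<^sub>E carrier R \<and> s = lincomb Q (m + 1) e c"
        then have cE: "c \<in> {1..m + 1} \<rightarrow>\<^sub>E carrier R" and cR: "c \<in> {1..m + 1} \<rightarrow> carrier R" by auto
        have "\<pi> x = lincomb Q (m + 1) e c" using c x(2) by simp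
        then have ci: "\<forall>i\<in>{1..m + 1}. x (\<sigma> i) = c i" unfolding Q_lin_eq[OF x(1) cR] .
        show "c = (\<lambda>i\<in>{1..m + 1}. x (\<sigma> i))"
        proof (rule PiE_ext[OF cE mem])
          fix i assume i: "i \<in> {1..m + 1}"
          show "c i = (\<lambda>i\<in>{1..m + 1}. x (\<sigma> i)) i" unfolding restrict_apply'[OF i] using ci i by simp
        qed
      qed
    qed
    have annQ: "annihilator Q = cyclic_span R Q (e (m + 1))"
    proof (intro equalityI subsetI)
      fix s assume s: "s \<in> annihilator Q"
      then obtain x where x: "x \<in> carrier ?S" "s = \<pi> x" unfolding annihilator_def Q_carrier by blast
      have xV: "x \<in> ?V" using x(1) unfolding SV .
      have "x \<otimes>\<^bsub>?S\<^esub> y = \<zero>\<^bsub>?S\<^esub>" if y: "y \<in> carrier ?S" for y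
      proof -
        have pV: "x \<otimes>\<^bsub>?S\<^esub> y \<in> ?V" "\<zero>\<^bsub>?S\<^esub> \<in> ?V" using S.prod_closed[OF x(1) y] S.M.zero_closed unfolding SV by blast+
        have "\<pi> x \<otimes>\<^bsub>Q\<^esub> \<pi> y = \<zero>\<^bsub>Q\<^esub>" using s y unfolding x(2) annihilator_def Q_carrier by blast
        then have "\<pi> (x \<otimes>\<^bsub>?S\<^esub> y) = \<pi> \<zero>\<^bsub>?S\<^esub>" unfolding Q_mult[OF x(1) y] Q_zero .
        then have "(x \<otimes>\<^bsub>?S\<^esub> y) N = \<zero>\<^bsub>?S\<^esub> N" unfolding \<pi>_eq[OF pV] by blast
        then have "x \<otimes>\<^bsub>?S\<^esub> y \<in> H"
          unfolding H_def using pV(1) prod_K[OF x(1) y] K_mem le Nm coord0[OF NN] by auto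
        then show ?thesis using prod_K[OF x(1) y] HK0 by blast
      qed
      then have "x \<in> ?A" unfolding annihilator_def using x(1) by blast
      then have x0: "\<And>k. k \<in> {1..m} \<Longrightarrow> x k = \<zero>\<^bsub>R\<^esub>" unfolding A by blast
      have xN: "x N \<in> carrier R" by (rule Vk[OF xV NN])
      have rV: "x N \<odot>\<^bsub>?S\<^esub> unitv N N \<in> ?V" using S.smult_closed[OF xN eS] unfolding SV .
      have "\<pi> x = \<pi> (x N \<odot>\<^bsub>?S\<^esub> unitv N N)"
        unfolding \<pi>_eq[OF xV rV]
      proof
        fix k assume k: "k \<in> insert N {1..m}"
        then have kN: "k \<in> {1..N}" using NN le by blast
        show "x k = (x N \<odot>\<^bsub>?S\<^esub> unitv N N) k"
          unfolding std_algebra_simps restrict_apply'[OF kN] unitv_apply[OF kN]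
          using k x0 xN Nm by (auto simp del: atLeastAtMost_iff)
      qed
      then show "s \<in> cyclic_span R Q (e (m + 1))"
        unfolding x(2) e_last cyclic_span_def Q_smult[OF xN eS, symmetric] using xN by blast
    next
      fix s assume "s \<in> cyclic_span R Q (e (m + 1))"
      then obtain r where r: "r \<in> carrier R" "s = r \<odot>\<^bsub>Q\<^esub> e (m + 1)" unfolding cyclic_span_def by blast
      have s: "s = \<pi> (r \<odot>\<^bsub>?S\<^esub> unitv N N)" unfolding r(2) e_last by (rule Q_smult[OF r(1) eS])
      have rS: "r \<odot>\<^bsub>?S\<^esub> unitv N N \<in> carrier ?S" by (rule S.smult_closed[OF r(1) eS])
      have "r \<odot>\<^bsub>?S\<^esub> unitv N N \<in> ?A" using KA r(1) unfolding K_def cyclic_span_def by blast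
      then have "\<pi> (r \<odot>\<^bsub>?S\<^esub> unitv N N) \<otimes>\<^bsub>Q\<^esub> \<pi> y = \<zero>\<^bsub>Q\<^esub>" if "y \<in> carrier ?S" for y
        unfolding Q_mult[OF rS that] Q_zero using that unfolding annihilator_def by simp
      then show "s \<in> annihilator Q" unfolding s annihilator_def Q_carrier using rS by blast
    qed
    have tableQ: "\<Theta> i j \<in> carrier R" "e i \<otimes>\<^bsub>Q\<^esub> e j = \<Theta> i j \<odot>\<^bsub>Q\<^esub> e (m + 1)"
      if i: "i \<in> {1..m}" and j: "j \<in> {1..m}" for i j
    proof -
      show \<Theta>ij: "\<Theta> i j \<in> carrier R" using pm i j by (auto simp: pmat_def)
      have "e i = \<pi> (unitv N i)" "e j = \<pi> (unitv N j)" using i j by (simp_all add: e_def \<sigma>_def)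
      then show "e i \<otimes>\<^bsub>Q\<^esub> e j = \<Theta> i j \<odot>\<^bsub>Q\<^esub> e (m + 1)"
        by (simp only: e_last Q_mult[OF eS eS] Q_smult[OF \<Theta>ij eS] unitv_table[OF pm mN(2) i j])
    qed
    show ?thesis
      unfolding is_defining_matrix_def Let_def
      by (intro exI[of _ H] exI[of _ K] exI[of _ e] conjI ballI H K HK HK0 cyc equalityD1[OF product]
          basisQ[unfolded Q_def] annQ[unfolded Q_def] tableQ[unfolded Q_def])
  qed
  note matrix = this
  have free: "free_of_rank R ?S N" "free_of_rank R (?S\<lparr>carrier := ?A\<rparr>) d"
    unfolding free_of_rank_def by (rule exI, rule basis) (rule exI, rule basisA)
  have Nd: "N - d = m" by (simp add: N_def)
  have "?S \<in> unimodular_algebras p N d"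
    unfolding unimodular_algebras_def mem_Collect_eq product Nd
    by (intro conjI alg nil free exI[of _ \<Theta>] K0 cyc matrix \<Theta>(1))
  then show ?thesis unfolding N_def .
qed

end

section \<open>Isomorphism classes\<close>

lemma exists_quadratic_nonresidue:
  fixes p :: int
  assumes p: "prime p" "odd p"
  shows "\<exists>\<epsilon>. coprime \<epsilon> p \<and> (\<forall>y. \<not> [y\<^sup>2 = \<epsilon>] (mod p))"
proof -
  have p0: "0 < p" using p by (simp add: prime_gt_0_int)
  have p3: "2 < p" using prime_ge_2_int[OF p(1)] p(2) by (cases "p = 2") auto
  define S where "S = (\<lambda>x. x\<^sup>2 mod p) ` {1..(p - 1) div 2}"
  have "card S \<le> card {1..(p - 1) div 2}" unfolding S_def by (rule card_image_le) simp
  also have "\<dots> < card {1..p - 1}" using p3 by simp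
  finally have "\<not> {1..p - 1} \<subseteq> S" using card_mono[of S "{1..p - 1}"] by (auto simp: S_def)
  then obtain \<epsilon> where "\<epsilon> \<in> {1..p - 1}" "\<epsilon> \<notin> S" by blast
  then have \<epsilon>: "1 \<le> \<epsilon>" "\<epsilon> \<le> p - 1" "\<epsilon> \<notin> S" by auto
  have nd: "\<not> p dvd \<epsilon>" using \<epsilon> zdvd_imp_le[of p \<epsilon>] by auto
  then have "coprime \<epsilon> p" using prime_imp_coprime[OF p(1)] coprime_commute by blast
  moreover have "\<not> [y\<^sup>2 = \<epsilon>] (mod p)" for y
  proof
    assume y: "[y\<^sup>2 = \<epsilon>] (mod p)"
    define z where "z = y mod p"
    have z: "0 \<le> z" "z < p" using p0 by (auto simp: z_def)
    have "[z\<^sup>2 = \<epsilon>] (mod p)"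
      using cong_trans[OF cong_pow[of z y p 2] y] by (simp add: z_def cong_def)
    then have eq: "z\<^sup>2 mod p = \<epsilon>" using \<epsilon> by (simp add: cong_def)
    have "z \<noteq> 0" using eq \<epsilon>(1) by auto
    have "\<exists>x\<in>{1..(p - 1) div 2}. x\<^sup>2 mod p = \<epsilon>"
    proof (cases "z \<le> (p - 1) div 2")
      case True
      then show ?thesis using eq z \<open>z \<noteq> 0\<close> by (intro bexI[of _ z]) auto
    next
      case False
      have "(p - z)\<^sup>2 = z\<^sup>2 + p * (p - 2 * z)" by (simp add: power2_eq_square algebra_simps)
      then have "(p - z)\<^sup>2 mod p = \<epsilon>" using eq by simp
      moreover have "p - z \<le> (p - 1) div 2" using False p(2) by presburger
      ultimately show ?thesis using z by (intro bexI[of _ "p - z"]) auto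
    qed
    then show False using \<epsilon>(3) by (auto simp: S_def)
  qed
  ultimately show ?thesis by blast
qed

lemma nonresidues_mult:
  fixes p :: nat and a b :: int
  assumes p: "prime p" "odd p" and ab: "coprime a (int p)" "coprime b (int p)"
    and non: "\<And>y. \<not> [y\<^sup>2 = a] (mod int p)" "\<And>y. \<not> [y\<^sup>2 = b] (mod int p)"
  shows "\<exists>y. [y\<^sup>2 = a * b] (mod int p)"
proof (rule ccontr)
  assume no: "\<not> ?thesis"
  have p2: "2 < p" using prime_ge_2_nat[OF p(1)] p(2) by (cases "p = 2") auto
  have L: "Legendre c (int p) = - 1" if "coprime c (int p)" "\<And>y. \<not> [y\<^sup>2 = c] (mod int p)" for c
  proof -
    have "\<not> [c = 0] (mod int p)"
    proof
      assume "[c = 0] (mod int p)"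
      then have "int p dvd c" by (simp add: cong_0_iff)
      then have "int p dvd 1" using that(1) by (metis coprime_common_divisor dvd_refl)
      then show False using p2 by simp
    qed
    then show ?thesis using that(2) by (simp add: Legendre_def QuadRes_def)
  qed
  let ?k = "(p - 1) div 2"
  have E: "[Legendre c (int p) = c ^ ?k] (mod int p)" for c by (rule euler_criterion[OF p(1) p2])
  have "[- 1 = (a * b) ^ ?k] (mod int p)"
    using E[of "a * b"] L[of "a * b"] ab no by simp
  moreover have "[(- 1) * (- 1) = a ^ ?k * b ^ ?k] (mod int p)"
    using cong_mult[OF E[of a] E[of b]] L[OF ab(1) non(1)] L[OF ab(2) non(2)] by simp
  ultimately have "[- 1 = (1 :: int)] (mod int p)"
    by (simp add: power_mult_distrib) (meson cong_sym cong_trans)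
  then have "int p dvd - 1 - 1" by (simp only: cong_iff_dvd_diff)
  then have "int p dvd 2" by simp
  then show False using p2 zdvd_imp_le[of "int p" 2] by simp
qed

context odd_prime
begin

lemma square_classes:
  assumes \<epsilon>: "coprime \<epsilon> (int p)" "\<And>y. \<not> [y\<^sup>2 = \<epsilon>] (mod int p)" and a: "coprime a (int p)"
  shows "\<exists>s. coprime s (int p) \<and> ([a = s\<^sup>2 * 1] (mod int p) \<or> [a = s\<^sup>2 * \<epsilon>] (mod int p))"
proof (cases "\<exists>y. [y\<^sup>2 = a] (mod int p)")
  case True
  then obtain y where y: "[y\<^sup>2 = a] (mod int p)" by blast
  have "coprime (y\<^sup>2) (int p)" using cong_imp_coprime[OF cong_sym[OF y]] a by blast
  then have "coprime y (int p)" by simp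
  then show ?thesis using cong_sym[OF y] by (intro exI[of _ y]) simp
next
  case False
  then obtain y where y: "[y\<^sup>2 = a * \<epsilon>] (mod int p)"
    using nonresidues_mult[OF prime_p odd_p a \<epsilon>(1)] \<epsilon>(2) by blast
  obtain w where w: "[\<epsilon> * w = 1] (mod int p)" using \<epsilon>(1) by (metis coprime_iff_invertible_int)
  have "coprime (y\<^sup>2) (int p)" using cong_imp_coprime[OF cong_sym[OF y]] a \<epsilon>(1) by simp
  moreover have "coprime w (int p)" using w by (metis coprime_iff_invertible_int mult.commute)
  ultimately have "coprime (y * w) (int p)" by simp
  moreover have "[(y * w)\<^sup>2 * \<epsilon> = a * (\<epsilon> * w) * (\<epsilon> * w)] (mod int p)"
    using cong_mult[OF y cong_refl[of "w\<^sup>2 * \<epsilon>"]] by (simp add: power_mult_distrib power2_eq_square mult_ac)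
  moreover have "[a * (\<epsilon> * w) * (\<epsilon> * w) = a * 1 * 1] (mod int p)" using w by (intro cong_mult) auto
  ultimately have "coprime (y * w) (int p)" "[(y * w)\<^sup>2 * \<epsilon> = a * 1 * 1] (mod int p)"
    using cong_trans by blast+
  then show ?thesis by (intro exI[of _ "y * w"]) (simp add: cong_sym_eq)
qed

definition diag_form :: "int \<Rightarrow> nat \<Rightarrow> nat \<Rightarrow> padic" where
  "diag_form \<epsilon> i j = (if i = j then if i = 1 then of_integer \<epsilon> else \<one>\<^bsub>R\<^esub> else \<zero>\<^bsub>R\<^esub>)"

lemma diag_form:
  assumes m: "0 < m" and \<epsilon>: "coprime \<epsilon> (int p)"
  shows "[det (lev m (diag_form \<epsilon>) 1) = \<epsilon>] (mod int p)" "unimodular R m (diag_form \<epsilon>)"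
    "diag_form \<epsilon> i j = diag_form \<epsilon> j i"
proof -
  obtain k where k: "m = Suc k" using m gr0_conv_Suc by blast
  have "mat_cong (int p) (lev m (diag_form \<epsilon>) 1) (dsum (scalar_mat \<epsilon>) (1\<^sub>m k))"
  proof (rule mat_congI[of _ m m])
    show "dsum (scalar_mat \<epsilon>) (1\<^sub>m k) \<in> carrier_mat m m"
      using dsum_carrier[of "scalar_mat \<epsilon>" 1 "1\<^sub>m k" k] k by simp
    fix i j assume ij: "i < m" "j < m"
    show "[lev m (diag_form \<epsilon>) 1 $$ (i, j) = dsum (scalar_mat \<epsilon>) (1\<^sub>m k) $$ (i, j)] (mod int p)"
      using ij k by (auto simp: lev_def diag_form_def dsum_def of_integer_def of_seq_def padic_one
          padic_zero cong_def)
  qed simp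
  from mat_cong_det[OF this lev_carrier]
  show det: "[det (lev m (diag_form \<epsilon>) 1) = \<epsilon>] (mod int p)" by (simp add: det_dsum[of _ 1 _ k])
  have "pmat m (diag_form \<epsilon>)" by (simp add: pmat_def diag_form_def)
  then show "unimodular R m (diag_form \<epsilon>)"
    unfolding unimodular_iff using cong_imp_coprime[OF cong_sym[OF det]] \<epsilon> by blast
  show "diag_form \<epsilon> i j = diag_form \<epsilon> j i" by (simp add: diag_form_def)
qed

lemma padic_cancel:
  assumes "x \<in> carrier R" "y \<in> carrier R" "z \<in> carrier R" "z \<noteq> \<zero>\<^bsub>R\<^esub>" "x \<otimes>\<^bsub>R\<^esub> z = y \<otimes>\<^bsub>R\<^esub> z"
  shows "x = y"
proof -
  have "(x \<ominus>\<^bsub>R\<^esub> y) \<otimes>\<^bsub>R\<^esub> z = x \<otimes>\<^bsub>R\<^esub> z \<ominus>\<^bsub>R\<^esub> y \<otimes>\<^bsub>R\<^esub> z"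
    using assms(1-3) by (simp add: R.minus_eq R.l_distr R.l_minus)
  also have "\<dots> = \<zero>\<^bsub>R\<^esub>" unfolding assms(5) using assms(2,3) by (simp add: R.minus_eq R.r_neg)
  finally have "x \<ominus>\<^bsub>R\<^esub> y = \<zero>\<^bsub>R\<^esub>" using padic_integral[OF R.minus_closed[OF assms(1,2)] assms(3)] assms(4) by blast
  then show ?thesis using assms(1,2) by simp
qed

lemma fraction_one_mem: "x \<in> carrier R \<Longrightarrow> (x, \<one>\<^bsub>R\<^esub>) \<in> fraction R x \<one>\<^bsub>R\<^esub>"
  using one_neq_zero by (simp add: fraction_def)

lemma fraction_one_inj:
  assumes "x \<in> carrier R" "y \<in> carrier R" "fraction R x \<one>\<^bsub>R\<^esub> = fraction R y \<one>\<^bsub>R\<^esub>"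
  shows "x = y"
proof -
  have "(x, \<one>\<^bsub>R\<^esub>) \<in> fraction R y \<one>\<^bsub>R\<^esub>" using fraction_one_mem[OF assms(1)] assms(3) by simp
  then show ?thesis using assms(1,2) by (simp add: fraction_def)
qed

lemma fraction_one_mult:
  assumes x: "x \<in> carrier R" and y: "y \<in> carrier R"
  shows "fraction R x \<one>\<^bsub>R\<^esub> \<otimes>\<^bsub>padic_field p\<^esub> fraction R y \<one>\<^bsub>R\<^esub> = fraction R (x \<otimes>\<^bsub>R\<^esub> y) \<one>\<^bsub>R\<^esub>"
proof -
  have const: "fraction R (a \<otimes>\<^bsub>R\<^esub> c) (b \<otimes>\<^bsub>R\<^esub> d) = fraction R (x \<otimes>\<^bsub>R\<^esub> y) \<one>\<^bsub>R\<^esub>"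
    if "(a, b) \<in> fraction R x \<one>\<^bsub>R\<^esub>" "(c, d) \<in> fraction R y \<one>\<^bsub>R\<^esub>" for a b c d
  proof -
    have a: "a = x \<otimes>\<^bsub>R\<^esub> b" "b \<in> carrier R" "b \<noteq> \<zero>\<^bsub>R\<^esub>" and c: "c = y \<otimes>\<^bsub>R\<^esub> d" "d \<in> carrier R" "d \<noteq> \<zero>\<^bsub>R\<^esub>"
      using that by (auto simp: fraction_def)
    have bd: "b \<otimes>\<^bsub>R\<^esub> d \<in> carrier R" "b \<otimes>\<^bsub>R\<^esub> d \<noteq> \<zero>\<^bsub>R\<^esub>" using a c padic_integral by auto
    have iff: "a \<otimes>\<^bsub>R\<^esub> c \<otimes>\<^bsub>R\<^esub> f = e \<otimes>\<^bsub>R\<^esub> (b \<otimes>\<^bsub>R\<^esub> d) \<longleftrightarrow> x \<otimes>\<^bsub>R\<^esub> y \<otimes>\<^bsub>R\<^esub> f = e \<otimes>\<^bsub>R\<^esub> \<one>\<^bsub>R\<^esub>"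
      if e: "e \<in> carrier R" and f: "f \<in> carrier R" for e f
    proof -
      have "a \<otimes>\<^bsub>R\<^esub> c \<otimes>\<^bsub>R\<^esub> f = x \<otimes>\<^bsub>R\<^esub> y \<otimes>\<^bsub>R\<^esub> f \<otimes>\<^bsub>R\<^esub> (b \<otimes>\<^bsub>R\<^esub> d)"
        unfolding a(1) c(1) using a(2) c(2) x y f by (simp add: R.m_ac)
      then show ?thesis using padic_cancel[OF _ e bd, of "x \<otimes>\<^bsub>R\<^esub> y \<otimes>\<^bsub>R\<^esub> f"] x y e f by auto
    qed
    show ?thesis unfolding fraction_def using iff by blast
  qed
  have "(\<Union>S\<in>fraction R x \<one>\<^bsub>R\<^esub>. \<Union>T\<in>fraction R y \<one>\<^bsub>R\<^esub>. fraction R (fst S \<otimes>\<^bsub>R\<^esub> fst T) (snd S \<otimes>\<^bsub>R\<^esub> snd T)) =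
      fraction R (x \<otimes>\<^bsub>R\<^esub> y) \<one>\<^bsub>R\<^esub>"
    by (rule UN_constant_eq[OF fraction_one_mem[OF x] ballI], rule UN_constant_eq[OF fraction_one_mem[OF y] ballI],
        rule const) simp_all
  then show ?thesis by (simp add: padic_field_def fraction_field_def case_prod_unfold)
qed

lemma discriminant_eq_iff:
  assumes \<Theta>: "pmat m \<Theta>" and \<Xi>: "pmat m \<Xi>"
  shows "discriminant p m \<Theta> = discriminant p m \<Xi> \<longleftrightarrow>
    (\<exists>s\<in>Units R. ring_det R m \<Theta> = s \<otimes>\<^bsub>R\<^esub> s \<otimes>\<^bsub>R\<^esub> ring_det R m \<Xi>)"
proof -
  have disc: "discriminant p m A = (\<lambda>u. fraction R (u \<otimes>\<^bsub>R\<^esub> u \<otimes>\<^bsub>R\<^esub> ring_det R m A) \<one>\<^bsub>R\<^esub>) ` Units R" if A: "pmat m A" for A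
  proof -
    have "fraction R (u \<otimes>\<^bsub>R\<^esub> u) \<one>\<^bsub>R\<^esub> \<otimes>\<^bsub>padic_field p\<^esub> fraction R (ring_det R m A) \<one>\<^bsub>R\<^esub> =
        fraction R (u \<otimes>\<^bsub>R\<^esub> u \<otimes>\<^bsub>R\<^esub> ring_det R m A) \<one>\<^bsub>R\<^esub>" if "u \<in> Units R" for u
      using that ring_det_closed[OF A] by (intro fraction_one_mult) (auto simp: R.Units_closed)
    moreover have "discriminant p m A = (\<lambda>u. fraction R (u \<otimes>\<^bsub>R\<^esub> u) \<one>\<^bsub>R\<^esub> \<otimes>\<^bsub>padic_field p\<^esub> fraction R
        (ring_det R m A) \<one>\<^bsub>R\<^esub>) ` Units R"
      unfolding discriminant_def unit_squares_def r_coset_def units_of_def by auto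
    ultimately show ?thesis by simp
  qed
  define D where "D = ring_det R m \<Theta>"
  define E where "E = ring_det R m \<Xi>"
  have DE: "D \<in> carrier R" "E \<in> carrier R" using ring_det_closed \<Theta> \<Xi> by (auto simp: D_def E_def)
  have sub: "(\<lambda>u. fraction R (u \<otimes>\<^bsub>R\<^esub> u \<otimes>\<^bsub>R\<^esub> x) \<one>\<^bsub>R\<^esub>) ` Units R \<subseteq> (\<lambda>u. fraction R (u \<otimes>\<^bsub>R\<^esub> u \<otimes>\<^bsub>R\<^esub> y) \<one>\<^bsub>R\<^esub>) ` Units R"
    if "x = s \<otimes>\<^bsub>R\<^esub> s \<otimes>\<^bsub>R\<^esub> y" "s \<in> Units R" "y \<in> carrier R" for x y s
  proof
    fix S assume "S \<in> (\<lambda>u. fraction R (u \<otimes>\<^bsub>R\<^esub> u \<otimes>\<^bsub>R\<^esub> x) \<one>\<^bsub>R\<^esub>) ` Units R"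
    then obtain u where u: "u \<in> Units R" "S = fraction R (u \<otimes>\<^bsub>R\<^esub> u \<otimes>\<^bsub>R\<^esub> x) \<one>\<^bsub>R\<^esub>" by blast
    have "u \<otimes>\<^bsub>R\<^esub> u \<otimes>\<^bsub>R\<^esub> x = (u \<otimes>\<^bsub>R\<^esub> s) \<otimes>\<^bsub>R\<^esub> (u \<otimes>\<^bsub>R\<^esub> s) \<otimes>\<^bsub>R\<^esub> y"
      unfolding that(1) using u(1) that(2,3) by (simp add: R.m_ac R.Units_closed)
    then show "S \<in> (\<lambda>u. fraction R (u \<otimes>\<^bsub>R\<^esub> u \<otimes>\<^bsub>R\<^esub> y) \<one>\<^bsub>R\<^esub>) ` Units R"
      unfolding u(2) by (intro image_eqI[OF _ R.Units_m_closed[OF u(1) that(2)]]) simp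
  qed
  show ?thesis
    unfolding disc[OF \<Theta>] disc[OF \<Xi>] D_def[symmetric] E_def[symmetric]
  proof
    assume eq: "(\<lambda>u. fraction R (u \<otimes>\<^bsub>R\<^esub> u \<otimes>\<^bsub>R\<^esub> D) \<one>\<^bsub>R\<^esub>) ` Units R = (\<lambda>u. fraction R (u \<otimes>\<^bsub>R\<^esub> u \<otimes>\<^bsub>R\<^esub> E) \<one>\<^bsub>R\<^esub>) ` Units R"
    have "fraction R (\<one>\<^bsub>R\<^esub> \<otimes>\<^bsub>R\<^esub> \<one>\<^bsub>R\<^esub> \<otimes>\<^bsub>R\<^esub> D) \<one>\<^bsub>R\<^esub> \<in> (\<lambda>u. fraction R (u \<otimes>\<^bsub>R\<^esub> u \<otimes>\<^bsub>R\<^esub> E) \<one>\<^bsub>R\<^esub>) ` Units R"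
      unfolding eq[symmetric] by (rule imageI[OF R.Units_one_closed])
    then obtain s where s: "s \<in> Units R" "fraction R D \<one>\<^bsub>R\<^esub> = fraction R (s \<otimes>\<^bsub>R\<^esub> s \<otimes>\<^bsub>R\<^esub> E) \<one>\<^bsub>R\<^esub>"
      using DE by auto
    then have "D = s \<otimes>\<^bsub>R\<^esub> s \<otimes>\<^bsub>R\<^esub> E" using DE by (intro fraction_one_inj) (auto simp: R.Units_closed)
    then show "\<exists>s\<in>Units R. D = s \<otimes>\<^bsub>R\<^esub> s \<otimes>\<^bsub>R\<^esub> E" using s(1) by blast
  next
    assume "\<exists>s\<in>Units R. D = s \<otimes>\<^bsub>R\<^esub> s \<otimes>\<^bsub>R\<^esub> E"
    then obtain s where s: "s \<in> Units R" "D = s \<otimes>\<^bsub>R\<^esub> s \<otimes>\<^bsub>R\<^esub> E" by blast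
    let ?t = "inv\<^bsub>R\<^esub> s"
    have t: "?t \<in> Units R" "?t \<in> carrier R" "s \<in> carrier R" "?t \<otimes>\<^bsub>R\<^esub> s = \<one>\<^bsub>R\<^esub>" using s(1) by auto
    have "?t \<otimes>\<^bsub>R\<^esub> ?t \<otimes>\<^bsub>R\<^esub> D = (?t \<otimes>\<^bsub>R\<^esub> s) \<otimes>\<^bsub>R\<^esub> (?t \<otimes>\<^bsub>R\<^esub> s) \<otimes>\<^bsub>R\<^esub> E"
      unfolding s(2) using t(2,3) DE by (simp only: R.m_ac R.m_closed)
    then have "E = ?t \<otimes>\<^bsub>R\<^esub> ?t \<otimes>\<^bsub>R\<^esub> D" unfolding t(4) using DE by simp
    then show "(\<lambda>u. fraction R (u \<otimes>\<^bsub>R\<^esub> u \<otimes>\<^bsub>R\<^esub> D) \<one>\<^bsub>R\<^esub>) ` Units R = (\<lambda>u. fraction R (u \<otimes>\<^bsub>R\<^esub> u \<otimes>\<^bsub>R\<^esub> E) \<one>\<^bsub>R\<^esub>) ` Units R"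
      using sub[OF s(2,1) DE(2)] sub[OF _ t(1) DE(1)] by blast
  qed
qed

lemma nonunital_comm_algebra_ops_closed: "nonunital_comm_algebra R M \<Longrightarrow> ops_closed R M"
proof -
  assume "nonunital_comm_algebra R M"
  then interpret nonunital_comm_algebra R M .
  show ?thesis unfolding ops_closed_def using prod_closed by simp
qed

lemma unimodular_algebra_normal_form:
  assumes M: "M \<in> unimodular_algebras p (m + d) d" and d: "0 < d"
  obtains \<Theta> where "unimodular R m \<Theta>" "\<And>i j. i \<in> {1..m} \<Longrightarrow> j \<in> {1..m} \<Longrightarrow> \<Theta> i j = \<Theta> j i"
    "isomorphic R (std_algebra (m + d) m \<Theta>) M"
proof -
  have alg: "nonunital_comm_algebra R M" and rank: "free_of_rank R (M\<lparr>carrier := annihilator M\<rparr>) d"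
    using M by (auto simp: unimodular_algebras_def)
  obtain \<Theta> where \<Theta>: "is_defining_matrix R M m \<Theta>" "unimodular R m \<Theta>"
    using M by (auto simp: unimodular_algebras_def)
  note S = defining_matrix_standard_form[OF alg \<Theta>(1) d rank]
  show thesis using that[OF \<Theta>(2) S(3,1)] by blast
qed

lemma unimodular_algebra_matrix:
  assumes M: "M \<in> unimodular_algebras p (m + d) d" and d: "0 < d" and m: "0 < m"
    and \<Theta>: "is_defining_matrix R M m \<Theta>"
  shows "unimodular R m \<Theta>" "\<And>i j. i \<in> {1..m} \<Longrightarrow> j \<in> {1..m} \<Longrightarrow> \<Theta> i j = \<Theta> j i"
    "isomorphic R (std_algebra (m + d) m \<Theta>) M"
proof -
  have alg: "nonunital_comm_algebra R M" and rank: "free_of_rank R (M\<lparr>carrier := annihilator M\<rparr>) d"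
    using M by (auto simp: unimodular_algebras_def)
  note S = defining_matrix_standard_form[OF alg \<Theta> d rank]
  show "isomorphic R (std_algebra (m + d) m \<Theta>) M" by (rule S(1))
  show "\<Theta> i j = \<Theta> j i" if "i \<in> {1..m}" "j \<in> {1..m}" for i j by (rule S(3)[OF that])
  obtain \<Theta>0 where \<Theta>0: "unimodular R m \<Theta>0" "isomorphic R (std_algebra (m + d) m \<Theta>0) M"
    by (rule unimodular_algebra_normal_form[OF M d])
  have "isomorphic R M (std_algebra (m + d) m \<Theta>)"
    by (rule isomorphic_sym[OF S(1) std_algebra_ops_closed[OF S(2)]]) simp
  then have iso: "isomorphic R (std_algebra (m + d) m \<Theta>0) (std_algebra (m + d) m \<Theta>)"
    by (rule isomorphic_trans[OF \<Theta>0(2)])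
  have md: "m < m + d" using d by simp
  obtain u c where uc: "u \<in> Units R" "c \<in> Units R"
    "u [^]\<^bsub>R\<^esub> m \<otimes>\<^bsub>R\<^esub> ring_det R m \<Theta>0 = c \<otimes>\<^bsub>R\<^esub> c \<otimes>\<^bsub>R\<^esub> ring_det R m \<Theta>"
    using std_algebra_isomorphic_det[OF m md \<Theta>0(1) S(2) iso] by blast
  have "u [^]\<^bsub>R\<^esub> m \<otimes>\<^bsub>R\<^esub> ring_det R m \<Theta>0 \<in> Units R"
    using uc(1) \<Theta>0(1) by (intro R.Units_m_closed R.Units_pow_closed) (simp_all add: unimodular_def)
  then have "coprime ((c \<otimes>\<^bsub>R\<^esub> c \<otimes>\<^bsub>R\<^esub> ring_det R m \<Theta>) 1) (int p)" unfolding uc(3) padic_units by blast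
  then have "coprime (ring_det R m \<Theta> 1) (int p)" by (simp add: padic_mult)
  then have "ring_det R m \<Theta> \<in> Units R" unfolding padic_units using ring_det_closed[OF S(2)] by blast
  then show "unimodular R m \<Theta>" using S(2) unfolding unimodular_def pmat_def by blast
qed

lemma isomorphic_iff_std_algebra:
  assumes M: "M \<in> unimodular_algebras p (m + d) d" and N: "N \<in> unimodular_algebras p (m + d) d"
    and \<Theta>: "pmat m \<Theta>" "isomorphic R (std_algebra (m + d) m \<Theta>) M"
    and \<Xi>: "pmat m \<Xi>" "isomorphic R (std_algebra (m + d) m \<Xi>) N"
  shows "isomorphic R M N \<longleftrightarrow> isomorphic R (std_algebra (m + d) m \<Theta>) (std_algebra (m + d) m \<Xi>)"
proof -
  have M': "isomorphic R M (std_algebra (m + d) m \<Theta>)"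
    by (rule isomorphic_sym[OF \<Theta>(2) std_algebra_ops_closed[OF \<Theta>(1)]]) simp
  have N': "isomorphic R N (std_algebra (m + d) m \<Xi>)"
    by (rule isomorphic_sym[OF \<Xi>(2) std_algebra_ops_closed[OF \<Xi>(1)]]) simp
  show ?thesis
  proof
    assume "isomorphic R M N"
    then show "isomorphic R (std_algebra (m + d) m \<Theta>) (std_algebra (m + d) m \<Xi>)"
      by (rule isomorphic_trans[OF isomorphic_trans[OF \<Theta>(2)] N'])
  next
    assume "isomorphic R (std_algebra (m + d) m \<Theta>) (std_algebra (m + d) m \<Xi>)"
    then show "isomorphic R M N" by (rule isomorphic_trans[OF isomorphic_trans[OF M'] \<Xi>(2)])
  qed
qed

lemma isomorphic_iff_discriminant:
  assumes M: "M \<in> unimodular_algebras p (m + d) d" and N: "N \<in> unimodular_algebras p (m + d) d"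
    and d: "0 < d" and m: "0 < m" "even m"
    and \<Theta>: "is_defining_matrix R M m \<Theta>" and \<Xi>: "is_defining_matrix R N m \<Xi>"
  shows "isomorphic R M N \<longleftrightarrow> discriminant p m \<Theta> = discriminant p m \<Xi>"
proof -
  note T = unimodular_algebra_matrix[OF M d m(1) \<Theta>] and Z = unimodular_algebra_matrix[OF N d m(1) \<Xi>]
  have pm: "pmat m \<Theta>" "pmat m \<Xi>" using T(1) Z(1) unimodular_iff by blast+
  have md: "m < m + d" using d by simp
  let ?D = "ring_det R m \<Theta>" and ?E = "ring_det R m \<Xi>"
  have DE: "?D \<in> carrier R" "?E \<in> carrier R" using ring_det_closed pm by blast+
  have "isomorphic R (std_algebra (m + d) m \<Theta>) (std_algebra (m + d) m \<Xi>) \<longleftrightarrow> (\<exists>s\<in>Units R. ?D = s \<otimes>\<^bsub>R\<^esub> s \<otimes>\<^bsub>R\<^esub> ?E)"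
  proof
    assume "isomorphic R (std_algebra (m + d) m \<Theta>) (std_algebra (m + d) m \<Xi>)"
    then obtain u c where uc: "u \<in> Units R" "c \<in> Units R" "u [^]\<^bsub>R\<^esub> m \<otimes>\<^bsub>R\<^esub> ?D = c \<otimes>\<^bsub>R\<^esub> c \<otimes>\<^bsub>R\<^esub> ?E"
      using std_algebra_isomorphic_det[OF m(1) md T(1) pm(2)] by blast
    obtain k where k: "m = k + k" using m(2) by (auto elim: evenE simp: mult_2)
    define v where "v = u [^]\<^bsub>R\<^esub> k"
    define w where "w = inv\<^bsub>R\<^esub> v"
    have v: "v \<in> Units R" unfolding v_def by (rule R.Units_pow_closed[OF uc(1)])
    have w: "w \<in> Units R" "w \<in> carrier R" "v \<in> carrier R" "c \<in> carrier R" "w \<otimes>\<^bsub>R\<^esub> v = \<one>\<^bsub>R\<^esub>"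
      using v uc(2) by (auto simp: w_def R.Units_closed)
    have "u [^]\<^bsub>R\<^esub> m = v \<otimes>\<^bsub>R\<^esub> v"
      unfolding v_def by (subst (1) k) (use R.Units_closed[OF uc(1)] in \<open>simp add: R.nat_pow_mult\<close>)
    then have eq: "v \<otimes>\<^bsub>R\<^esub> v \<otimes>\<^bsub>R\<^esub> ?D = c \<otimes>\<^bsub>R\<^esub> c \<otimes>\<^bsub>R\<^esub> ?E" using uc(3) by simp
    have "?D = (w \<otimes>\<^bsub>R\<^esub> v) \<otimes>\<^bsub>R\<^esub> (w \<otimes>\<^bsub>R\<^esub> v) \<otimes>\<^bsub>R\<^esub> ?D" unfolding w(5) using DE by simp
    also have "\<dots> = w \<otimes>\<^bsub>R\<^esub> w \<otimes>\<^bsub>R\<^esub> (v \<otimes>\<^bsub>R\<^esub> v \<otimes>\<^bsub>R\<^esub> ?D)" using w(2,3) DE by (simp only: R.m_ac R.m_closed)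
    also have "\<dots> = (w \<otimes>\<^bsub>R\<^esub> c) \<otimes>\<^bsub>R\<^esub> (w \<otimes>\<^bsub>R\<^esub> c) \<otimes>\<^bsub>R\<^esub> ?E" unfolding eq using w(2,4) DE by (simp only: R.m_ac R.m_closed)
    finally show "\<exists>s\<in>Units R. ?D = s \<otimes>\<^bsub>R\<^esub> s \<otimes>\<^bsub>R\<^esub> ?E" using R.Units_m_closed[OF w(1) uc(2)] by blast
  next
    assume "\<exists>s\<in>Units R. ?D = s \<otimes>\<^bsub>R\<^esub> s \<otimes>\<^bsub>R\<^esub> ?E"
    then obtain s where s: "s \<in> Units R" "?D = s \<otimes>\<^bsub>R\<^esub> s \<otimes>\<^bsub>R\<^esub> ?E" by blast
    have "[\<one>\<^bsub>R\<^esub> 1 ^ m * det (lev m \<Theta> 1) = det (lev m \<Theta> 1)] (mod int p)"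
      using cong_mult[OF cong_pow[of "\<one>\<^bsub>R\<^esub> 1" 1 "int p" m] cong_refl[of "det (lev m \<Theta> 1)"]] by (simp add: padic_one)
    also have "[det (lev m \<Theta> 1) = ?D 1] (mod int p)"
      using ring_det_cong_level[OF pm(1), of 1] by (simp add: cong_sym_eq)
    also have "[?D 1 = s 1 * s 1 * ?E 1] (mod int p)"
      using fun_cong[OF s(2), of 1] by (simp add: padic_mult mod_simps cong_def)
    also have "[s 1 * s 1 * ?E 1 = s 1 * s 1 * det (lev m \<Xi> 1)] (mod int p)"
      using ring_det_cong_level[OF pm(2), of 1] by (intro cong_mult) auto
    finally have "[\<one>\<^bsub>R\<^esub> 1 ^ m * det (lev m \<Theta> 1) = (s 1)\<^sup>2 * det (lev m \<Xi> 1)] (mod int p)"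
      by (simp add: power2_eq_square)
    moreover have "coprime (s 1) (int p)" using s(1) padic_units by blast
    ultimately show "isomorphic R (std_algebra (m + d) m \<Theta>) (std_algebra (m + d) m \<Xi>)"
      by (intro std_algebra_isomorphic_if_det[OF m(1) md T(1,2) Z(1,2) R.Units_one_closed])
  qed
  then show ?thesis
    unfolding isomorphic_iff_std_algebra[OF M N pm(1) T(3) pm(2) Z(3)] discriminant_eq_iff[OF pm] .
qed

definition isomorphism_relation :: "nat \<Rightarrow> nat \<Rightarrow> ((padic, 'a) module \<times> (padic, 'a) module) set" where
  "isomorphism_relation n d = {(M, N). M \<in> unimodular_algebras p n d \<and> N \<in> unimodular_algebras p n d \<and>
    isomorphic R M N}"

lemma equiv_isomorphism_relation: "equiv (unimodular_algebras p n d) (isomorphism_relation n d)"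
proof (rule equivI)
  show "isomorphism_relation n d \<subseteq> unimodular_algebras p n d \<times> unimodular_algebras p n d"
    by (auto simp: isomorphism_relation_def)
  show "refl_on (unimodular_algebras p n d) (isomorphism_relation n d)"
    by (rule refl_onI) (simp add: isomorphism_relation_def isomorphic_refl)
  show "sym (isomorphism_relation n d)"
  proof (rule symI)
    fix M N assume MN: "(M, N) \<in> isomorphism_relation n d"
    then have "nonunital_comm_algebra R M" by (auto simp: isomorphism_relation_def unimodular_algebras_def)
    then have "ops_closed R M" by (rule nonunital_comm_algebra_ops_closed)
    then show "(N, M) \<in> isomorphism_relation n d"
      using MN isomorphic_sym unfolding isomorphism_relation_def by blast
  qed
  show "trans (isomorphism_relation n d)"
  proof (rule transI)
    fix M N P assume "(M, N) \<in> isomorphism_relation n d" "(N, P) \<in> isomorphism_relation n d"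
    then show "(M, P) \<in> isomorphism_relation n d"
      using isomorphic_trans[of R M N P] unfolding isomorphism_relation_def by simp
  qed
qed

lemma isomorphism_classes_eq: "isomorphism_classes p n d = unimodular_algebras p n d // isomorphism_relation n d"
  by (simp add: isomorphism_classes_def isomorphism_relation_def)

lemma isomorphic_diag_form:
  assumes M: "M \<in> unimodular_algebras p (m + d) d" and d: "0 < d" and m: "0 < m"
    and \<Theta>: "unimodular R m \<Theta>" "\<And>i j. i \<in> {1..m} \<Longrightarrow> j \<in> {1..m} \<Longrightarrow> \<Theta> i j = \<Theta> j i"
      "isomorphic R (std_algebra (m + d) m \<Theta>) M"
    and u: "coprime u (int p)" and s: "coprime s (int p)" and \<epsilon>: "coprime \<epsilon> (int p)"
    and eq: "[u ^ m * det (lev m \<Theta> 1) = s\<^sup>2 * \<epsilon>] (mod int p)"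
  shows "isomorphic R M (std_algebra (m + d) m (diag_form \<epsilon>))"
proof -
  have md: "m < m + d" using d by simp
  have pm: "pmat m \<Theta>" using \<Theta>(1) by (simp add: unimodular_iff)
  have u1: "[of_integer u 1 = u] (mod int p)" by (simp add: of_integer_def of_seq_def)
  have uU: "of_integer u \<in> Units R"
    unfolding padic_units using u cong_imp_coprime[OF cong_sym[OF u1]] by simp
  have "[of_integer u 1 ^ m * det (lev m \<Theta> 1) = u ^ m * det (lev m \<Theta> 1)] (mod int p)"
    using u1 by (intro cong_mult cong_pow) auto
  also note eq
  also have "[s\<^sup>2 * \<epsilon> = s\<^sup>2 * det (lev m (diag_form \<epsilon>) 1)] (mod int p)"
    using diag_form(1)[OF m \<epsilon>] by (intro cong_mult) (auto simp: cong_sym_eq)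
  finally have "[of_integer u 1 ^ m * det (lev m \<Theta> 1) = s\<^sup>2 * det (lev m (diag_form \<epsilon>) 1)] (mod int p)" .
  then have "isomorphic R (std_algebra (m + d) m \<Theta>) (std_algebra (m + d) m (diag_form \<epsilon>))"
    by (intro std_algebra_isomorphic_if_det[OF m md \<Theta>(1,2) diag_form(2)[OF m \<epsilon>] diag_form(3)[OF m \<epsilon>] uU s])
  moreover have "isomorphic R M (std_algebra (m + d) m \<Theta>)"
    by (rule isomorphic_sym[OF \<Theta>(3) std_algebra_ops_closed[OF pm]]) simp
  ultimately show ?thesis using isomorphic_trans by blast
qed

lemma diag_form_algebra:
  assumes "0 < d" "0 < m" "coprime \<epsilon> (int p)"
  shows "std_algebra (m + d) m (diag_form \<epsilon>) \<in> unimodular_algebras p (m + d) d"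
  by (rule std_algebra_unimodular[OF diag_form(2)[OF assms(2,3)] diag_form(3)[OF assms(2,3)] assms(2,1)])

lemma isomorphism_classes_even:
  assumes d: "0 < d" and m: "0 < m" "even m"
  shows "card (isomorphism_classes p (m + d) d :: (padic, nat \<Rightarrow> padic) module set set) = 2"
proof -
  let ?U = "unimodular_algebras p (m + d) d :: (padic, nat \<Rightarrow> padic) module set"
  let ?E = "isomorphism_relation (m + d) d :: ((padic, nat \<Rightarrow> padic) module \<times> (padic, nat \<Rightarrow> padic) module) set"
  note equiv = equiv_isomorphism_relation[of "m + d" d, where 'a = "nat \<Rightarrow> padic"]
  obtain \<epsilon> where \<epsilon>: "coprime \<epsilon> (int p)" "\<And>y. \<not> [y\<^sup>2 = \<epsilon>] (mod int p)"
    using exists_quadratic_nonresidue[OF prime_int_p] by blast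
  have c1: "coprime 1 (int p)" by simp
  define A where "A = std_algebra (m + d) m (diag_form 1)"
  define B where "B = std_algebra (m + d) m (diag_form \<epsilon>)"
  have A: "A \<in> ?U" and B: "B \<in> ?U"
    unfolding A_def B_def by (rule diag_form_algebra[OF d m(1) c1]) (rule diag_form_algebra[OF d m(1) \<epsilon>(1)])
  have cover: "(M, A) \<in> ?E \<or> (M, B) \<in> ?E" if M: "M \<in> ?U" for M
  proof -
    obtain \<Theta> where \<Theta>: "unimodular R m \<Theta>" "\<And>i j. i \<in> {1..m} \<Longrightarrow> j \<in> {1..m} \<Longrightarrow> \<Theta> i j = \<Theta> j i"
      "isomorphic R (std_algebra (m + d) m \<Theta>) M"
      by (rule unimodular_algebra_normal_form[OF M d]) (rule that; blast)
    have a: "coprime (det (lev m \<Theta> 1)) (int p)" using \<Theta>(1) by (simp add: unimodular_iff)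
    obtain s where s: "coprime s (int p)"
      "[det (lev m \<Theta> 1) = s\<^sup>2 * 1] (mod int p) \<or> [det (lev m \<Theta> 1) = s\<^sup>2 * \<epsilon>] (mod int p)"
      using square_classes[OF \<epsilon> a] by blast
    then have "isomorphic R M A \<or> isomorphic R M B"
      using isomorphic_diag_form[OF M d m(1) \<Theta> c1 s(1) c1] isomorphic_diag_form[OF M d m(1) \<Theta> c1 s(1) \<epsilon>(1)]
      unfolding A_def B_def by auto
    then show ?thesis using M A B by (auto simp: isomorphism_relation_def)
  qed
  have "?U // ?E = {?E `` {A}, ?E `` {B}}"
  proof (intro equalityI subsetI)
    fix C assume "C \<in> ?U // ?E"
    then obtain M where M: "M \<in> ?U" "C = ?E `` {M}" by (rule quotientE)
    show "C \<in> {?E `` {A}, ?E `` {B}}" using cover[OF M(1)] equiv_class_eq[OF equiv] unfolding M(2) by auto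
  next
    fix C assume "C \<in> {?E `` {A}, ?E `` {B}}"
    then show "C \<in> ?U // ?E" using quotientI[OF A] quotientI[OF B] by blast
  qed
  moreover have "?E `` {A} \<noteq> ?E `` {B}"
  proof
    assume "?E `` {A} = ?E `` {B}"
    then have "(A, B) \<in> ?E" by (rule eq_equiv_class[OF _ equiv B])
    then have iso: "isomorphic R A B" by (simp add: isomorphism_relation_def)
    have md: "m < m + d" using d by simp
    have u1: "unimodular R m (diag_form 1)" and u\<epsilon>: "pmat m (diag_form \<epsilon>)" "pmat m (diag_form 1)"
      using diag_form(2)[OF m(1) c1] diag_form(2)[OF m(1) \<epsilon>(1)] by (simp_all add: unimodular_iff)
    obtain u c where uc: "u \<in> Units R" "c \<in> Units R"
      "u [^]\<^bsub>R\<^esub> m \<otimes>\<^bsub>R\<^esub> ring_det R m (diag_form 1) = c \<otimes>\<^bsub>R\<^esub> c \<otimes>\<^bsub>R\<^esub> ring_det R m (diag_form \<epsilon>)"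
      using std_algebra_isomorphic_det[OF m(1) md u1 u\<epsilon>(1)] iso unfolding A_def B_def by blast
    have det: "[ring_det R m (diag_form \<delta>) 1 = \<delta>] (mod int p)" if "coprime \<delta> (int p)" "pmat m (diag_form \<delta>)" for \<delta>
      using cong_trans[OF _ diag_form(1)[OF m(1) that(1)]] ring_det_cong_level[OF that(2), of 1] by simp
    have "[u 1 ^ m * 1 = u 1 ^ m * ring_det R m (diag_form 1) 1] (mod int p)"
      using det[OF c1 u\<epsilon>(2)] by (intro cong_mult) (auto simp: cong_sym_eq)
    also have "[u 1 ^ m * ring_det R m (diag_form 1) 1 = c 1 * c 1 * ring_det R m (diag_form \<epsilon>) 1] (mod int p)"
      using fun_cong[OF uc(3), of 1] uc(1) by (simp add: padic_mult padic_pow R.Units_closed mod_simps cong_def)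
    also have "[c 1 * c 1 * ring_det R m (diag_form \<epsilon>) 1 = c 1 * c 1 * \<epsilon>] (mod int p)"
      using det[OF \<epsilon>(1) u\<epsilon>(1)] by (intro cong_mult) auto
    finally have eq: "[u 1 ^ m = c 1 * c 1 * \<epsilon>] (mod int p)" by simp
    obtain k where k: "m = 2 * k" using m(2) by (rule evenE)
    obtain w where w: "[c 1 * w = 1] (mod int p)"
      using uc(2) padic_units by (metis coprime_iff_invertible_int)
    have "[(u 1 ^ k * w)\<^sup>2 = c 1 * c 1 * \<epsilon> * (w * w)] (mod int p)"
      using cong_mult[OF eq cong_refl[of "w * w"]] by (simp add: k power_mult_distrib power_mult
          power2_eq_square mult_ac)
    also have "c 1 * c 1 * \<epsilon> * (w * w) = (c 1 * w) * (c 1 * w) * \<epsilon>" by (simp add: mult_ac)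
    also have "[(c 1 * w) * (c 1 * w) * \<epsilon> = 1 * 1 * \<epsilon>] (mod int p)" using w by (intro cong_mult) auto
    finally show False using \<epsilon>(2) by simp
  qed
  ultimately show ?thesis by (simp add: isomorphism_classes_eq)
qed

lemma isomorphism_classes_odd:
  assumes d: "0 < d" and m: "odd m"
  shows "card (isomorphism_classes p (m + d) d :: (padic, nat \<Rightarrow> padic) module set set) = 1"
proof -
  let ?U = "unimodular_algebras p (m + d) d :: (padic, nat \<Rightarrow> padic) module set"
  let ?E = "isomorphism_relation (m + d) d :: ((padic, nat \<Rightarrow> padic) module \<times> (padic, nat \<Rightarrow> padic) module) set"
  note equiv = equiv_isomorphism_relation[of "m + d" d, where 'a = "nat \<Rightarrow> padic"]
  have m0: "0 < m" using m by (rule odd_pos)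
  have c1: "coprime 1 (int p)" by simp
  define A where "A = std_algebra (m + d) m (diag_form 1)"
  have A: "A \<in> ?U" unfolding A_def by (rule diag_form_algebra[OF d m0 c1])
  have cover: "(M, A) \<in> ?E" if M: "M \<in> ?U" for M
  proof -
    obtain \<Theta> where \<Theta>: "unimodular R m \<Theta>" "\<And>i j. i \<in> {1..m} \<Longrightarrow> j \<in> {1..m} \<Longrightarrow> \<Theta> i j = \<Theta> j i"
      "isomorphic R (std_algebra (m + d) m \<Theta>) M"
      by (rule unimodular_algebra_normal_form[OF M d]) (rule that; blast)
    define a where "a = det (lev m \<Theta> 1)"
    have a: "coprime a (int p)" using \<Theta>(1) by (simp add: unimodular_iff a_def)
    obtain k where k: "m = 2 * k + 1" using m by (rule oddE)
    \<comment> \<open>Scaling an odd-dimensional form by its determinant makes the determinant a square.\<close>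
    have "a ^ m * a = (a ^ (k + 1))\<^sup>2 * 1" by (simp add: k power2_eq_square power_add mult_2)
    then have "[a ^ m * a = (a ^ (k + 1))\<^sup>2 * 1] (mod int p)" by simp
    then have "isomorphic R M A"
      unfolding A_def a_def
      by (intro isomorphic_diag_form[OF M d m0 \<Theta> _ _ c1]) (use a in \<open>simp_all add: a_def\<close>)
    then show ?thesis using M A by (simp add: isomorphism_relation_def)
  qed
  have "?U // ?E = {?E `` {A}}"
  proof (intro equalityI subsetI)
    fix C assume "C \<in> ?U // ?E"
    then obtain M where M: "M \<in> ?U" "C = ?E `` {M}" by (rule quotientE)
    show "C \<in> {?E `` {A}}" using equiv_class_eq[OF equiv cover[OF M(1)]] unfolding M(2) by simp
  next
    fix C assume "C \<in> {?E `` {A}}"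
    then show "C \<in> ?U // ?E" using quotientI[OF A] by blast
  qed
  then show ?thesis by (simp add: isomorphism_classes_eq)
qed

lemma isomorphic_to_std_algebra:
  assumes M: "M \<in> unimodular_algebras p (m + d) d" and d: "0 < d" and m: "0 < m"
  shows "\<exists>N :: (padic, nat \<Rightarrow> padic) module. N \<in> unimodular_algebras p (m + d) d \<and> isomorphic R M N"
proof -
  obtain \<Theta> where \<Theta>: "unimodular R m \<Theta>" "\<And>i j. i \<in> {1..m} \<Longrightarrow> j \<in> {1..m} \<Longrightarrow> \<Theta> i j = \<Theta> j i"
    "isomorphic R (std_algebra (m + d) m \<Theta>) M"
    by (rule unimodular_algebra_normal_form[OF M d]) (rule that; blast)
  have pm: "pmat m \<Theta>" using \<Theta>(1) by (simp add: unimodular_iff)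
  have "isomorphic R M (std_algebra (m + d) m \<Theta>)"
    by (rule isomorphic_sym[OF \<Theta>(3) std_algebra_ops_closed[OF pm]]) simp
  then show ?thesis using std_algebra_unimodular[OF \<Theta>(1,2) m d] by blast
qed

end

theorem theorem5p11:
  fixes p n d :: nat
  assumes "prime p" and "odd p" and "0 < d" and "d < n"
  shows
    "(even (n - d) \<longrightarrow>
        card (isomorphism_classes p n d :: (padic, nat \<Rightarrow> padic) module set set) = 2) \<and>
     (odd (n - d) \<longrightarrow>
        card (isomorphism_classes p n d :: (padic, nat \<Rightarrow> padic) module set set) = 1) \<and>
     (\<forall>M :: (padic, 'a) module. M \<in> unimodular_algebras p n d \<longrightarrow>
        (\<exists>N :: (padic, nat \<Rightarrow> padic) module.
            N \<in> unimodular_algebras p n d \<and> isomorphic (padic_int p) M N)) \<and>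
     (even (n - d) \<longrightarrow>
        (\<forall>(M :: (padic, 'a) module) (N :: (padic, 'b) module) \<Theta> \<Xi>.
            M \<in> unimodular_algebras p n d \<longrightarrow> N \<in> unimodular_algebras p n d \<longrightarrow>
            is_defining_matrix (padic_int p) M (n - d) \<Theta> \<longrightarrow>
            is_defining_matrix (padic_int p) N (n - d) \<Xi> \<longrightarrow>
            (isomorphic (padic_int p) M N \<longleftrightarrow>
               discriminant p (n - d) \<Theta> = discriminant p (n - d) \<Xi>)))"
proof -
  interpret odd_prime p by unfold_locales (fact assms(1,2))+
  define m where "m = n - d"
  have n: "n = m + d" and m: "0 < m" using assms(4) by (auto simp: m_def)
  show ?thesis
    unfolding m_def[symmetric] unfolding n
    using isomorphism_classes_even[OF assms(3) m] isomorphism_classes_odd[OF assms(3)]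
      isomorphic_to_std_algebra[OF _ assms(3) m] isomorphic_iff_discriminant[OF _ _ assms(3) m]
    by (intro conjI impI allI) blast+
qed

end
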